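(* Let $(\mathcal{G},\underline{a})$ be a finite metric graph with at least one internal edge, and let $A,B$ be linear maps in $\mathcal{K}$ such that $(A,\,B)\colon\mathcal{K}\oplus\mathcal{K}\to\mathcal{K}$ is surjective and $AB^*$ is self-adjoint, so that $-\Delta(A,B)$ is self-adjoint. Let $-\kappa_1^2\le\dots\le-\kappa_n^2<0$ be the negative eigenvalues of $-\Delta(A,B)$ counted with multiplicity, with $\kappa_1\ge\dots\ge\kappa_n>0$, and let $l_1\ge\dots\ge l_n>0$ be the positive eigenvalues of $L(0,\underline{a})$ counted with multiplicity. Then $$l_i\le\kappa_i\le\eta(l_i,a_{\min}),\qquad 1\le i\le n.$$ Moreover, if $n\ge1$, the lower bound $-\eta(l_1,a_{\min})^2\le-\Delta(A,B)$ on the spectrum is optimal (i.e. $-\eta(l_1,a_{\min})^2$ is the smallest eigenvalue of $-\Delta(A,B)$, equivalently $\kappa_1=\eta(l_1,a_{\min})$) if and only if $$\operatorname{span}\left\{\begin{bmatrix}0\\ e_i\\ -e_i\end{bmatrix}\ \Big|\ i\in\mathcal{I},\ a_i=a_{\min}\right\}\cap\operatorname{Ker}\bigl(L(0,\underline{a})-l_1\bigr)\neq\{0\},$$ where $e_i$ is the $i$-th canonical basis vector of $\mathbb{C}^{|\mathcal{I}|}$ and the vectors are written with respect to $\mathcal{K}=\mathcal{K}_{\mathcal{E}}\oplus\mathcal{K}_{\mathcal{I}}^-\oplus\mathcal{K}_{\mathcal{I}}^+$.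
   Context: A finite metric graph consists of finitely many vertices, a finite set $\mathcal{I}$ of internal edges and a finite set $\mathcal{E}$ of external edges; each internal edge $i$ is identified with an interval $[0,a_i]$, $a_i>0$ (initial vertex at $0$, terminal vertex at $a_i$), each external edge with $[0,\infty)$ (its vertex at $0$); $\underline{a}=\{a_i\}_{i\in\mathcal{I}}$, $a_{\min}=\min_i a_i$. The Hilbert space is $\mathcal{H}=\bigoplus_{j\in\mathcal{E}\cup\mathcal{I}}L^2(I_j)$, $I_j$ the interval of edge $j$. Let $\mathcal{D}$ be the set of $\psi\in\mathcal{H}$ with each $\psi_j,\psi_j'$ absolutely continuous and $\psi_j''\in L^2(I_j)$. Let $\mathcal{K}=\mathcal{K}_{\mathcal{E}}\oplus\mathcal{K}_{\mathcal{I}}^-\oplus\mathcal{K}_{\mathcal{I}}^+$ with $\mathcal{K}_{\mathcal{E}}\cong\mathbb{C}^{|\mathcal{E}|}$, $\mathcal{K}_{\mathcal{I}}^\pm\cong\mathbb{C}^{|\mathcal{I}|}$, and for $\psi\in\mathcal{D}$ set $\underline{\psi}=(\{\psi_e(0)\}_{e\in\mathcal{E}},\{\psi_i(0)\}_{i\in\mathcal{I}},\{\psi_i(a_i)\}_{i\in\mathcal{I}})$, $\underline{\psi'}=(\{\psi_e'(0)\}_{e},\{\psi_i'(0)\}_{i},\{-\psi_i'(a_i)\}_{i})$. The operator $\Delta(A,B)$ acts by $(\Delta\psi)_j=\psi_j''$ on the domain $\{\psi\in\mathcal{D}: A\underline{\psi}+B\underline{\psi'}=0\}$. Let $P$ be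 the orthogonal projector in $\mathcal{K}$ onto $\operatorname{Ker}B$, $P^\perp=1-P$, and let $L=(B|_{\operatorname{Ran}B^*})^{-1}AP^\perp$, a Hermitian operator in $\operatorname{Ran}P^\perp$ (one has $-\Delta(A,B)=-\Delta(L+P,P^\perp)$). With respect to the decomposition of $\mathcal{K}$ let $$M(0,\underline{a})=\begin{bmatrix}0&0&0\\0&-\frac{1}{\underline{a}}&\frac{1}{\underline{a}}\\0&\frac{1}{\underline{a}}&-\frac{1}{\underline{a}}\end{bmatrix},$$ where $\frac1{\underline a}$ is the diagonal $|\mathcal{I}|\times|\mathcal{I}|$ matrix with entries $1/a_i$, and let $L(0,\underline{a})=L+P^\perp M(0,\underline{a})P^\perp$, regarded as a Hermitian operator in $\operatorname{Ran}P^\perp$. (It is known that the number of negative eigenvalues of $-\Delta(A,B)$ equals the number of positive eigenvalues of $L(0,\underline{a})$, both counted with multiplicity.) For $l>0$ and $a>0$, $\eta(l,a)$ denotes the unique positive solution $\kappa$ of $l=\frac{\kappa}{\tanh(\kappa a/2)}-\frac{2}{a}$. *)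

theory Defs
  imports "HOL-Analysis.Analysis" "HOL-Library.Function_Algebras"
begin

text \<open>
  External edges are labelled Inl e with e < ne, internal edges Inr i with i < ni.
  The boundary space K = K_E (+) K_I^- (+) K_I^+ is C^d, d = ne + 2 ni, realised as
  functions nat => complex vanishing at indices >= d:
  index e (e < ne) is external edge e, index ne + i is the initial end (0) of
  internal edge i, index ne + ni + i is its terminal end (a i).
  Linear maps on K are d x d matrices nat => nat => complex (entries at indices < d).
\<close>

definition Kdim :: "nat \<Rightarrow> nat \<Rightarrow> nat" where
  "Kdim ne ni = ne + 2 * ni"

definition Kvec :: "nat \<Rightarrow> (nat \<Rightarrow> complex) \<Rightarrow> bool" where
  "Kvec d x \<longleftrightarrow> (\<forall>k\<ge>d. x k = 0)"

definition mv :: "nat \<Rightarrow> (nat \<Rightarrow> nat \<Rightarrow> complex) \<Rightarrow> (nat \<Rightarrow> complex) \<Rightarrow> nat \<Rightarrow> complex" where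
  "mv d A x = (\<lambda>k. if k < d then (\<Sum>m<d. A k m * x m) else 0)"

definition madj :: "(nat \<Rightarrow> nat \<Rightarrow> complex) \<Rightarrow> nat \<Rightarrow> nat \<Rightarrow> complex" where
  "madj A = (\<lambda>k m. cnj (A m k))"

definition mmul :: "nat \<Rightarrow> (nat \<Rightarrow> nat \<Rightarrow> complex) \<Rightarrow> (nat \<Rightarrow> nat \<Rightarrow> complex) \<Rightarrow> nat \<Rightarrow> nat \<Rightarrow> complex" where
  "mmul d A B = (\<lambda>k m. \<Sum>j<d. A k j * B j m)"

definition kinner :: "nat \<Rightarrow> (nat \<Rightarrow> complex) \<Rightarrow> (nat \<Rightarrow> complex) \<Rightarrow> complex" where
  "kinner d x y = (\<Sum>k<d. x k * cnj (y k))"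

definition cscale :: "complex \<Rightarrow> ('a \<Rightarrow> complex) \<Rightarrow> 'a \<Rightarrow> complex" where
  "cscale c f = (\<lambda>x. c * f x)"

definition cscale2 :: "complex \<Rightarrow> ('a \<Rightarrow> 'b \<Rightarrow> complex) \<Rightarrow> 'a \<Rightarrow> 'b \<Rightarrow> complex" where
  "cscale2 c f = (\<lambda>x y. c * f x y)"

lemma vector_space_cscale: "vector_space (cscale :: complex \<Rightarrow> ('a \<Rightarrow> complex) \<Rightarrow> _)"
  by unfold_locales (auto simp: cscale_def fun_eq_iff algebra_simps)

lemma vector_space_cscale2: "vector_space (cscale2 :: complex \<Rightarrow> ('a \<Rightarrow> 'b \<Rightarrow> complex) \<Rightarrow> _)"
  by unfold_locales (auto simp: cscale2_def fun_eq_iff algebra_simps)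

abbreviation cspan :: "('a \<Rightarrow> complex) set \<Rightarrow> ('a \<Rightarrow> complex) set" where
  "cspan \<equiv> module.span cscale"

abbreviation cdim :: "('a \<Rightarrow> complex) set \<Rightarrow> nat" where
  "cdim \<equiv> vector_space.dim cscale"

abbreviation cdim2 :: "('a \<Rightarrow> 'b \<Rightarrow> complex) set \<Rightarrow> nat" where
  "cdim2 \<equiv> vector_space.dim cscale2"

definition is_edge :: "nat \<Rightarrow> nat \<Rightarrow> nat + nat \<Rightarrow> bool" where
  "is_edge ne ni j = (case j of Inl e \<Rightarrow> e < ne | Inr i \<Rightarrow> i < ni)"

definition edge_int :: "(nat \<Rightarrow> real) \<Rightarrow> nat + nat \<Rightarrow> real set" where
  "edge_int a j = (case j of Inl e \<Rightarrow> {0..} | Inr i \<Rightarrow> {0..a i})"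

definition edge_deriv :: "(nat \<Rightarrow> real) \<Rightarrow> (nat + nat \<Rightarrow> real \<Rightarrow> complex) \<Rightarrow> nat + nat \<Rightarrow> real \<Rightarrow> complex" where
  "edge_deriv a \<psi> j x = vector_derivative (\<psi> j) (at x within edge_int a j)"

definition bval :: "nat \<Rightarrow> nat \<Rightarrow> (nat \<Rightarrow> real) \<Rightarrow> (nat + nat \<Rightarrow> real \<Rightarrow> complex) \<Rightarrow> nat \<Rightarrow> complex" where
  "bval ne ni a \<psi> = (\<lambda>k.
     if k < ne then \<psi> (Inl k) 0
     else if k < ne + ni then \<psi> (Inr (k - ne)) 0
     else if k < ne + 2 * ni then \<psi> (Inr (k - ne - ni)) (a (k - ne - ni))
     else 0)"

definition dval :: "nat \<Rightarrow> nat \<Rightarrow> (nat \<Rightarrow> real) \<Rightarrow> (nat + nat \<Rightarrow> real \<Rightarrow> complex) \<Rightarrow> nat \<Rightarrow> complex" where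
  "dval ne ni a \<psi> = (\<lambda>k.
     if k < ne then edge_deriv a \<psi> (Inl k) 0
     else if k < ne + ni then edge_deriv a \<psi> (Inr (k - ne)) 0
     else if k < ne + 2 * ni then - edge_deriv a \<psi> (Inr (k - ne - ni)) (a (k - ne - ni))
     else 0)"

definition lap_eigenspace ::
  "nat \<Rightarrow> nat \<Rightarrow> (nat \<Rightarrow> real) \<Rightarrow> (nat \<Rightarrow> nat \<Rightarrow> complex) \<Rightarrow> (nat \<Rightarrow> nat \<Rightarrow> complex) \<Rightarrow> real
   \<Rightarrow> (nat + nat \<Rightarrow> real \<Rightarrow> complex) set" where
  "lap_eigenspace ne ni a A B lam = {\<psi>.
     (\<forall>j. \<not> is_edge ne ni j \<longrightarrow> (\<forall>x. \<psi> j x = 0)) \<and>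
     (\<forall>j. is_edge ne ni j \<longrightarrow>
        (\<forall>x. x \<notin> edge_int a j \<longrightarrow> \<psi> j x = 0) \<and>
        (\<forall>x\<in>edge_int a j. \<psi> j differentiable (at x within edge_int a j)) \<and>
        (\<forall>x\<in>edge_int a j. (edge_deriv a \<psi> j has_vector_derivative
              (- of_real lam * \<psi> j x)) (at x within edge_int a j)) \<and>
        (\<lambda>x. (cmod (\<psi> j x))\<^sup>2) integrable_on edge_int a j) \<and>
     mv (Kdim ne ni) A (bval ne ni a \<psi>) + mv (Kdim ne ni) B (dval ne ni a \<psi>) = (\<lambda>_. 0)}"

definition lap_mult :: "nat \<Rightarrow> nat \<Rightarrow> (nat \<Rightarrow> real) \<Rightarrow> (nat \<Rightarrow> nat \<Rightarrow> complex) \<Rightarrow> (nat \<Rightarrow> nat \<Rightarrow> complex) \<Rightarrow> real \<Rightarrow> nat" where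
  "lap_mult ne ni a A B lam = cdim2 (lap_eigenspace ne ni a A B lam)"

definition kerB :: "nat \<Rightarrow> (nat \<Rightarrow> nat \<Rightarrow> complex) \<Rightarrow> (nat \<Rightarrow> complex) set" where
  "kerB d B = {x. Kvec d x \<and> mv d B x = (\<lambda>_. 0)}"

definition ranPperp :: "nat \<Rightarrow> (nat \<Rightarrow> nat \<Rightarrow> complex) \<Rightarrow> (nat \<Rightarrow> complex) set" where
  "ranPperp d B = {x. Kvec d x \<and> (\<forall>y\<in>kerB d B. kinner d x y = 0)}"

definition Pperp :: "nat \<Rightarrow> (nat \<Rightarrow> nat \<Rightarrow> complex) \<Rightarrow> (nat \<Rightarrow> complex) \<Rightarrow> nat \<Rightarrow> complex" where
  "Pperp d B x = (THE y. y \<in> ranPperp d B \<and> x - y \<in> kerB d B)"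

text \<open>L = (B restricted to Ran B^* )^{-1} A P^perp  (note Ran B^* = Ran P^perp).\<close>
definition Lop :: "nat \<Rightarrow> (nat \<Rightarrow> nat \<Rightarrow> complex) \<Rightarrow> (nat \<Rightarrow> nat \<Rightarrow> complex) \<Rightarrow> (nat \<Rightarrow> complex) \<Rightarrow> nat \<Rightarrow> complex" where
  "Lop d A B x = (THE y. y \<in> ranPperp d B \<and> mv d B y = mv d A (Pperp d B x))"

definition Mmat :: "nat \<Rightarrow> nat \<Rightarrow> (nat \<Rightarrow> real) \<Rightarrow> nat \<Rightarrow> nat \<Rightarrow> complex" where
  "Mmat ne ni a = (\<lambda>k m.
     if ne \<le> k \<and> k < ne + 2 * ni \<and> ne \<le> m \<and> m < ne + 2 * ni \<and>
        (k - ne) mod ni = (m - ne) mod ni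
     then (if (k < ne + ni) = (m < ne + ni) then - 1 / of_real (a ((k - ne) mod ni))
           else 1 / of_real (a ((k - ne) mod ni)))
     else 0)"

definition L0 :: "nat \<Rightarrow> nat \<Rightarrow> (nat \<Rightarrow> real) \<Rightarrow> (nat \<Rightarrow> nat \<Rightarrow> complex) \<Rightarrow> (nat \<Rightarrow> nat \<Rightarrow> complex) \<Rightarrow> (nat \<Rightarrow> complex) \<Rightarrow> nat \<Rightarrow> complex" where
  "L0 ne ni a A B x = Lop (Kdim ne ni) A B x
      + Pperp (Kdim ne ni) B (mv (Kdim ne ni) (Mmat ne ni a) (Pperp (Kdim ne ni) B x))"

definition L0_eigenspace :: "nat \<Rightarrow> nat \<Rightarrow> (nat \<Rightarrow> real) \<Rightarrow> (nat \<Rightarrow> nat \<Rightarrow> complex) \<Rightarrow> (nat \<Rightarrow> nat \<Rightarrow> complex) \<Rightarrow> real \<Rightarrow> (nat \<Rightarrow> complex) set" where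
  "L0_eigenspace ne ni a A B l =
     {x \<in> ranPperp (Kdim ne ni) B. L0 ne ni a A B x = cscale (of_real l) x}"

definition L0_mult :: "nat \<Rightarrow> nat \<Rightarrow> (nat \<Rightarrow> real) \<Rightarrow> (nat \<Rightarrow> nat \<Rightarrow> complex) \<Rightarrow> (nat \<Rightarrow> nat \<Rightarrow> complex) \<Rightarrow> real \<Rightarrow> nat" where
  "L0_mult ne ni a A B l = cdim (L0_eigenspace ne ni a A B l)"

definition dvec :: "nat \<Rightarrow> nat \<Rightarrow> nat \<Rightarrow> nat \<Rightarrow> complex" where
  "dvec ne ni i = (\<lambda>k. if k = ne + i then 1 else if k = ne + ni + i then - 1 else 0)"

definition eta :: "real \<Rightarrow> real \<Rightarrow> real" where
  "eta l a = (THE \<kappa>. \<kappa> > 0 \<and> l = \<kappa> / tanh (\<kappa> * a / 2) - 2 / a)"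

end

theory Submission
  imports Defs
begin

text \<open>
  An eigenfunction at energy \<open>- \<kappa>\<^sup>2\<close> is determined by its boundary values, and these are exactly
  the null vectors of the Hermitian form \<open>q \<kappa>\<close> of \<open>L + P\<^sup>\<bottom> M(\<kappa>) P\<^sup>\<bottom>\<close>, where \<open>M(\<kappa>)\<close> is the
  Dirichlet-to-Neumann matrix of the edges. The form \<open>q \<kappa>\<close> is strictly decreasing in \<open>\<kappa>\<close>, so adjoining
  its null space to a \<open>q \<kappa>\<close>-positive subspace gives a subspace that is positive for all smaller
  \<open>\<kappa>\<close>. Climbing down from large \<open>\<kappa>\<close> therefore produces, for each \<open>i\<close>, an \<open>i\<close>-dimensional
  subspace on which \<open>q \<kappa>\<^sub>i\<close> is nonnegative; since \<open>M(0) - M(\<kappa>)\<close> is at least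
  \<open>\<kappa> coth (\<kappa> a\<^sub>m\<^sub>i\<^sub>n / 2) - 2 / a\<^sub>m\<^sub>i\<^sub>n\<close>, the form of \<open>L(0)\<close> is bounded below there and
  min-max gives the upper bound. For the lower bound, if \<open>\<kappa>\<^sub>i < l\<^sub>i\<close>, then \<open>M(0) - M(\<kappa>\<^sub>i) \<le> \<kappa>\<^sub>i\<close>
  makes \<open>q \<kappa>\<^sub>i\<close> positive on the span of the eigenvectors for \<open>l\<^sub>1, \<dots>, l\<^sub>i\<close>; climbing down to \<open>0\<close>
  then gives more positive directions of \<open>L(0)\<close> than its \<open>n\<close> positive eigenvalues allow. In the
  case of equality for \<open>\<kappa>\<^sub>1\<close> a null vector of \<open>q \<kappa>\<^sub>1\<close> attains both estimates, which forces it to be a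
  top eigenvector of \<open>L(0)\<close> and antisymmetric on shortest edges.
\<close>

section \<open>Complex-valued functions as a vector space\<close>

interpretation cv: vector_space "cscale :: complex \<Rightarrow> ('a \<Rightarrow> complex) \<Rightarrow> 'a \<Rightarrow> complex"
  by (rule vector_space_cscale)

lemma cscale_apply: "cscale c f x = c * f x"
  by (simp add: cscale_def)

text \<open>Otherwise the simplifier turns vectors such as \<open>0\<close> and \<open>x + y\<close> into explicit abstractions.\<close>

declare plus_fun_apply [simp del] zero_fun_apply [simp del] minus_apply [simp del]

lemmas fun_simps = plus_fun_apply zero_fun_apply minus_apply cscale_apply

section \<open>The space of vectors supported below a bound\<close>

lemma Kvec_0 [simp]: "Kvec d 0"
  by (simp add: Kvec_def fun_simps)

lemma Kvec_add: "Kvec d x \<Longrightarrow> Kvec d y \<Longrightarrow> Kvec d (x + y)"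
  by (simp add: Kvec_def fun_simps)

lemma Kvec_diff: "Kvec d x \<Longrightarrow> Kvec d y \<Longrightarrow> Kvec d (x - y)"
  by (simp add: Kvec_def fun_simps)

lemma Kvec_cscale: "Kvec d x \<Longrightarrow> Kvec d (cscale c x)"
  by (simp add: Kvec_def fun_simps)

lemma Kvec_mv [simp]: "Kvec d (mv d A x)"
  by (simp add: Kvec_def mv_def)

definition unit_vec :: "nat \<Rightarrow> nat \<Rightarrow> complex" where
  "unit_vec k = (\<lambda>m. if m = k then 1 else 0)"

lemma Kvec_unit_vec: "k < d \<Longrightarrow> Kvec d (unit_vec k)"
  by (simp add: Kvec_def unit_vec_def)

lemma Kvec_expand:
  assumes "Kvec d x"
  shows "x = (\<Sum>k<d. cscale (x k) (unit_vec k))"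
proof
  fix m
  have "(\<Sum>k<d. cscale (x k) (unit_vec k)) m = (\<Sum>k<d. x k * unit_vec k m)"
    by (induction d) (auto simp: fun_simps)
  also have "\<dots> = (\<Sum>k<d. if m = k then x k else 0)"
    by (rule sum.cong) (auto simp: unit_vec_def)
  also have "\<dots> = x m"
    using assms by (simp add: Kvec_def)
  finally show "x m = (\<Sum>k<d. cscale (x k) (unit_vec k)) m" by simp
qed

lemma Kvec_in_span: "Kvec d x \<Longrightarrow> x \<in> cspan (unit_vec ` {..<d})"
  by (subst Kvec_expand, assumption) (intro cv.span_sum cv.span_scale cv.span_base, auto)

lemma independent_card_le:
  assumes "cv.independent S" "\<And>x. x \<in> S \<Longrightarrow> Kvec d x"
  shows "finite S \<and> card S \<le> d"
proof -
  have "S \<subseteq> cspan (unit_vec ` {..<d})"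
    using assms(2) Kvec_in_span by auto
  then have "finite S \<and> card S \<le> card (unit_vec ` {..<d})"
    by (intro cv.independent_span_bound assms) auto
  then show ?thesis
    using card_image_le[of "{..<d}" unit_vec] by auto
qed

text \<open>The ambient space of all functions is infinite-dimensional, so finiteness of a basis has
  to come from the support bound \<open>d\<close>.\<close>

lemma subspace_basis:
  assumes "cv.subspace E" "\<And>x. x \<in> E \<Longrightarrow> Kvec d x"
  obtains F where "finite F" "F \<subseteq> E" "cv.independent F" "cspan F = E" "card F = cdim E"
proof -
  obtain F where F: "F \<subseteq> E" "cv.independent F" "E \<subseteq> cspan F" "card F = cdim E"
    by (rule cv.basis_exists)
  moreover have "finite F"
    using independent_card_le[OF F(2)] F(1) assms(2) by blast
  moreover have "cspan F = E"
    using F assms(1) cv.span_minimal by blast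
  ultimately show ?thesis using that by blast
qed

lemma subspace_dim_eq_0:
  assumes "cv.subspace E" "\<And>x. x \<in> E \<Longrightarrow> Kvec d x"
  shows "cdim E = 0 \<longleftrightarrow> E = {0}"
proof -
  obtain F where F: "finite F" "F \<subseteq> E" "cv.independent F" "cspan F = E" "card F = cdim E"
    using subspace_basis[OF assms] by blast
  have "F = {} \<longleftrightarrow> E = {0}"
  proof
    assume "E = {0}"
    then have "F \<subseteq> {0}" "0 \<notin> F"
      using F(2,3) cv.dependent_zero by auto
    then show "F = {}" by blast
  qed (use F(4) in auto)
  then show ?thesis using F by auto
qed

text \<open>Induction on \<open>T\<close>. If the new \<open>t\<close> were \<open>x + y\<close>
  with \<open>x\<close> and \<open>y\<close> from the two spans, then \<open>x = t - y\<close> would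
  lie in both and vanish, leaving \<open>t\<close> in the span of \<open>T\<close>.\<close>

lemma independent_Un:
  assumes "finite T" "cv.independent S" "cv.independent T" "cspan S \<inter> cspan T \<subseteq> {0}"
  shows "cv.independent (S \<union> T) \<and> S \<inter> T = {}"
  using assms
proof (induction T rule: finite_induct)
  case (insert t T)
  have indT: "cv.independent T" and tT: "t \<notin> cspan T"
    using insert.prems(2) insert.hyps by (auto simp: cv.independent_insert)
  have sub: "cspan T \<subseteq> cspan (insert t T)"
    by (rule cv.span_mono) auto
  have IH: "cv.independent (S \<union> T)" "S \<inter> T = {}"
    using insert.IH insert.prems indT sub by blast+
  have t: "t \<notin> cspan (S \<union> T)"
  proof
    assume "t \<in> cspan (S \<union> T)"
    then obtain x y where xy: "t = x + y" "x \<in> cspan S" "y \<in> cspan T"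
      unfolding cv.span_Un by blast
    have "x = t - y" using xy by simp
    then have "x \<in> cspan (insert t T)"
      using xy sub by (metis cv.span_base cv.span_diff insertI1 subsetD)
    then have "x = 0" using insert.prems(3) xy(2) by auto
    then show False using xy tT by simp
  qed
  then have "cv.independent (insert t (S \<union> T))"
    using IH by (simp add: cv.independent_insertI)
  moreover have "t \<notin> S" using t cv.span_base by blast
  ultimately show ?case using IH by auto
qed auto

text \<open>A dimension count: the image of a basis stays independent, so a vector \<open>y\<close>
  outside its span would give more independent vectors than the space allows.\<close>

lemma Kvec_inj_imp_surj:
  assumes lin: "Vector_Spaces.linear cscale cscale (f :: (nat \<Rightarrow> complex) \<Rightarrow> nat \<Rightarrow> complex)"
    and inj: "\<And>x. Kvec d x \<Longrightarrow> f x = 0 \<Longrightarrow> x = 0"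
    and K: "\<And>x. Kvec d (f x)" and y: "Kvec d y"
  obtains x where "Kvec d x" "f x = y"
proof -
  interpret f: Vector_Spaces.linear cscale cscale f by (rule lin)
  let ?U = "unit_vec ` {..<d}"
  have sub: "cv.subspace {x. Kvec d x}"
    by (auto simp: cv.subspace_def Kvec_add Kvec_cscale)
  have KU: "Kvec d x" if "x \<in> cspan ?U" for x
    using cv.span_minimal[of ?U "{x. Kvec d x}"] sub that Kvec_unit_vec by auto
  have injU: "inj_on f (cspan ?U)"
    using inj KU by (auto simp: f.inj_on_iff_eq_0[OF cv.subspace_span])
  obtain F where F: "finite F" "F \<subseteq> {x. Kvec d x}" "cv.independent F" "cspan F = {x. Kvec d x}"
    "card F = cdim {x. Kvec d x}"
    by (rule subspace_basis[OF sub]) auto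
  have eq: "cspan F = cspan ?U"
    using F(4) KU Kvec_in_span by auto
  have ind: "cv.independent (f ` F)"
    by (rule f.independent_injective_image) (use F(3) injU eq in auto)
  have card: "card (f ` F) = card F"
    by (rule card_image) (metis injU eq inj_on_subset cv.span_superset)
  have "y \<in> cspan (f ` F)"
  proof (rule ccontr)
    assume n: "y \<notin> cspan (f ` F)"
    have "insert y (f ` F) \<subseteq> cspan F"
      using F(4) K y by auto
    then have "card (insert y (f ` F)) \<le> card F"
      using cv.independent_span_bound[OF F(1) cv.independent_insertI[OF n ind]] by blast
    moreover have "y \<notin> f ` F" using n cv.span_base[of y "f ` F"] by argo
    ultimately show False using F(1) card by simp
  qed
  then have "y \<in> f ` cspan F" by (simp add: f.span_image)
  then show ?thesis using that F(4) by auto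
qed

section \<open>Hermitian forms\<close>

definition hermitian_form :: "((nat \<Rightarrow> complex) \<Rightarrow> (nat \<Rightarrow> complex) \<Rightarrow> complex) \<Rightarrow> bool" where
  "hermitian_form h \<longleftrightarrow> (\<forall>x y z. h (x + y) z = h x z + h y z) \<and>
     (\<forall>c x y. h (cscale c x) y = c * h x y) \<and> (\<forall>x y. h y x = cnj (h x y))"

lemma
  assumes "hermitian_form h"
  shows hermitian_form_add_left: "h (x + y) z = h x z + h y z"
    and hermitian_form_scale_left: "h (cscale c x) z = c * h x z"
    and hermitian_form_cnj: "h z x = cnj (h x z)"
    and hermitian_form_add_right: "h z (x + y) = h z x + h z y"
    and hermitian_form_scale_right: "h z (cscale c x) = cnj c * h z x"
proof -
  show 1: "h (x + y) z = h x z + h y z" "h (cscale c x) z = c * h x z"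
    and 2: "h z x = cnj (h x z)" for x y z c
    using assms unfolding hermitian_form_def by blast+
  show "h z (x + y) = h z x + h z y" "h z (cscale c x) = cnj c * h z x"
    by (simp_all only: 2[of z] 1 complex_cnj_add complex_cnj_mult)
qed

lemma hermitian_form_0:
  assumes "hermitian_form h"
  shows "h 0 x = 0" "h x 0 = 0"
  using hermitian_form_scale_left[OF assms, of 0 0 x] hermitian_form_scale_right[OF assms, of x 0 0]
  by simp_all

lemma hermitian_form_diff_left:
  assumes "hermitian_form h"
  shows "h (x - y) z = h x z - h y z"
  using hermitian_form_add_left[OF assms, of "x - y" y z] by simp

lemma hermitian_form_diff_right:
  assumes "hermitian_form h"
  shows "h z (x - y) = h z x - h z y"
  using hermitian_form_add_right[OF assms, of z "x - y" y] by simp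

lemma hermitian_form_real:
  assumes "hermitian_form h"
  shows "h x x = of_real (Re (h x x))"
  using hermitian_form_cnj[OF assms, of x x] by (simp add: complex_eq_iff)

lemma hermitian_form_subtract_scale:
  assumes "hermitian_form h" "hermitian_form g"
  shows "hermitian_form (\<lambda>x y. h x y - of_real c * g x y)"
  unfolding hermitian_form_def
proof (intro conjI allI)
  show "h y x - of_real c * g y x = cnj (h x y - of_real c * g x y)" for x y
    using hermitian_form_cnj[OF assms(1), of y x] hermitian_form_cnj[OF assms(2), of y x] by simp
qed (simp_all add: hermitian_form_add_left[OF assms(1)] hermitian_form_add_left[OF assms(2)]
      hermitian_form_scale_left[OF assms(1)] hermitian_form_scale_left[OF assms(2)]
      algebra_simps)

text \<open>For the form of a compression to \<open>W\<close> this is the kernel of the compressed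
  operator. The eigenspaces of L(0,a) and the boundary values of eigenfunctions are both expressed
  in this way.\<close>

definition radical :: "((nat \<Rightarrow> complex) \<Rightarrow> (nat \<Rightarrow> complex) \<Rightarrow> complex) \<Rightarrow> (nat \<Rightarrow> complex) set \<Rightarrow> (nat \<Rightarrow> complex) set" where
  "radical h W = {u \<in> W. \<forall>w\<in>W. h u w = 0}"

lemma subspace_radical:
  assumes "hermitian_form h" "cv.subspace W"
  shows "cv.subspace (radical h W)"
  using assms(2)
  by (auto simp: cv.subspace_def radical_def hermitian_form_0[OF assms(1)]
      hermitian_form_add_left[OF assms(1)] hermitian_form_scale_left[OF assms(1)])

text \<open>If \<open>c = h u w\<close> were nonzero, moving \<open>u\<close> slightly in the
  direction \<open>cscale c w\<close> would raise the form above 0, since the first-order change is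
  a positive multiple of the squared modulus of \<open>c\<close>.\<close>

lemma semidefinite_null_vector_in_radical:
  assumes h: "hermitian_form h" and W: "cv.subspace W"
    and neg: "\<And>w. w \<in> W \<Longrightarrow> Re (h w w) \<le> 0"
    and u: "u \<in> W" "Re (h u u) \<ge> 0"
  shows "u \<in> radical h W"
proof -
  have "h u w = 0" if w: "w \<in> W" for w
  proof (rule ccontr)
    assume nz: "h u w \<noteq> 0"
    define c where "c = h u w"
    define r where "r = Re (h w w)"
    \<comment> \<open>This step size gives \<open>t * \<bar>r\<bar> < 1\<close>, so the quadratic
      term cannot outweigh the linear one.\<close>
    define t where "t = 1 / (1 + \<bar>r\<bar>)"
    have t: "t > 0" "t * (1 + \<bar>r\<bar>) = 1" by (simp_all add: t_def)
    let ?v = "u + cscale (of_real t * c) w"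
    have "?v \<in> W" using W u w by (auto simp: cv.subspace_def)
    then have le: "Re (h ?v ?v) \<le> 0" by (rule neg)
    have wu: "h w u = cnj c" unfolding c_def by (rule hermitian_form_cnj[OF h])
    have ww: "h w w = of_real r" unfolding r_def by (rule hermitian_form_real[OF h])
    have "h ?v ?v = h u u + 2 * of_real t * (c * cnj c) + of_real (t^2) * (c * cnj c) * of_real r"
      by (simp add: hermitian_form_add_left[OF h] hermitian_form_add_right[OF h]
          hermitian_form_scale_left[OF h] hermitian_form_scale_right[OF h] wu ww
          flip: c_def) (simp add: algebra_simps power2_eq_square)
    then have "h ?v ?v = h u u + of_real (t * (cmod c)\<^sup>2 * (2 + t * r))"
      by (simp add: algebra_simps power2_eq_square flip: complex_norm_square)
    then have "Re (h ?v ?v) = Re (h u u) + t * (cmod c)\<^sup>2 * (2 + t * r)" by simp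
    moreover have "t * \<bar>r\<bar> < 1" using t by (simp add: algebra_simps)
    then have "2 + t * r > 0"
      using t by (smt (verit) abs_mult mult_minus_right mult_left_mono abs_ge_self)
    then have "t * (cmod c)\<^sup>2 * (2 + t * r) > 0"
      using t nz by (simp add: c_def)
    ultimately show False using le u by linarith
  qed
  then show ?thesis using u by (simp add: radical_def)
qed

section \<open>The inner product, Gram-Schmidt and orthogonality\<close>

lemma hermitian_form_kinner: "hermitian_form (kinner d)"
  by (auto simp: hermitian_form_def kinner_def fun_simps algebra_simps sum_distrib_left
      simp flip: sum.distrib)

lemmas kinner_add_left = hermitian_form_add_left[OF hermitian_form_kinner]
  and kinner_add_right = hermitian_form_add_right[OF hermitian_form_kinner]
  and kinner_scale_left = hermitian_form_scale_left[OF hermitian_form_kinner]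
  and kinner_scale_right = hermitian_form_scale_right[OF hermitian_form_kinner]
  and kinner_diff_left = hermitian_form_diff_left[OF hermitian_form_kinner]
  and kinner_diff_right = hermitian_form_diff_right[OF hermitian_form_kinner]
  and kinner_cnj = hermitian_form_cnj[OF hermitian_form_kinner]
  and kinner_0 [simp] = hermitian_form_0[OF hermitian_form_kinner]

definition ksq :: "nat \<Rightarrow> (nat \<Rightarrow> complex) \<Rightarrow> real" where
  "ksq d x = (\<Sum>k<d. (cmod (x k))\<^sup>2)"

lemma kinner_self: "kinner d x x = of_real (ksq d x)"
  by (simp add: kinner_def ksq_def complex_norm_square del: of_real_power)

lemma ksq_nonneg: "ksq d x \<ge> 0"
  by (simp add: ksq_def sum_nonneg)

lemma ksq_0 [simp]: "ksq d 0 = 0"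
  by (simp add: ksq_def fun_simps)

lemma ksq_eq_0: "Kvec d x \<Longrightarrow> ksq d x = 0 \<longleftrightarrow> x = 0"
  by (auto simp: ksq_def sum_nonneg_eq_0_iff Kvec_def fun_eq_iff fun_simps) (metis not_le lessThan_iff)

lemma ksq_pos: "Kvec d x \<Longrightarrow> x \<noteq> 0 \<Longrightarrow> ksq d x > 0"
  using ksq_nonneg[of d x] ksq_eq_0[of d x] by linarith

lemma kinner_self_eq_0: "Kvec d x \<Longrightarrow> kinner d x x = 0 \<longleftrightarrow> x = 0"
  by (simp add: kinner_self ksq_eq_0)

lemma ksq_cscale: "ksq d (cscale c x) = (cmod c)\<^sup>2 * ksq d x"
  by (simp add: ksq_def fun_simps norm_mult power_mult_distrib sum_distrib_left)

lemma kinner_span_right: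
  assumes "y \<in> cspan F" "\<And>f. f \<in> F \<Longrightarrow> kinner d x f = 0"
  shows "kinner d x y = 0"
  using assms(1)
proof (induction rule: cv.span_induct_alt)
  case (step c f y)
  then show ?case by (simp add: kinner_add_right kinner_scale_right assms(2))
qed simp

text \<open>Gram-Schmidt: \<open>s\<close> is first replaced by its part \<open>r\<close> orthogonal
  to \<open>F\<close>, then the component of \<open>x - u\<close> along \<open>r\<close> is
  removed.\<close>

lemma orthogonal_decomposition:
  assumes "finite F"
  obtains u where "u \<in> cspan F" "\<And>f. f \<in> F \<Longrightarrow> kinner d (x - u) f = 0"
  using assms
proof (induction F arbitrary: x thesis rule: finite_induct)
  case empty
  then show ?case using cv.span_zero by blast
next
  case (insert s F)
  have sub: "cspan F \<subseteq> cspan (insert s F)" by (rule cv.span_mono) auto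
  obtain p where p: "p \<in> cspan F" "\<And>f. f \<in> F \<Longrightarrow> kinner d (s - p) f = 0"
    using insert.IH by blast
  obtain u where u: "u \<in> cspan F" "\<And>f. f \<in> F \<Longrightarrow> kinner d (x - u) f = 0"
    using insert.IH by blast
  define r where "r = s - p"
  have rf: "kinner d r f = 0" if "f \<in> cspan F" for f
    using kinner_span_right[OF that] p(2) unfolding r_def by blast
  have xf: "kinner d (x - u) f = 0" if "f \<in> cspan F" for f
    using kinner_span_right[OF that] u(2) by blast
  define c where "c = kinner d (x - u) r / kinner d r r"
  define v where "v = u + cscale c r"
  have "r \<in> cspan (insert s F)"
    unfolding r_def using p sub by (meson cv.span_base cv.span_diff insertI1 subsetD)
  then have v: "v \<in> cspan (insert s F)"
    unfolding v_def using u sub by (meson cv.span_add cv.span_scale subsetD)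
  have eq: "x - v = (x - u) - cscale c r" by (simp add: v_def)
  have "kinner d (x - v) f = 0" if "f \<in> cspan F" for f
    using rf[OF that] xf[OF that] kinner_diff_left[of d "x - u" "cscale c r" f]
    by (simp add: eq kinner_scale_left)
  moreover have "kinner d (x - v) r = 0"
  \<comment> \<open>No support bound is assumed for \<open>x\<close> or the new vector
    \<open>s\<close>, so \<open>r\<close> may be nonzero with norm 0; it then vanishes below
    \<open>d\<close> and pairs to 0 with everything.\<close>
  proof (cases "kinner d r r = 0")
    case True
    then have "ksq d r = 0" by (simp add: kinner_self)
    then have "\<forall>k<d. r k = 0" by (simp add: ksq_def sum_nonneg_eq_0_iff)
    then show ?thesis by (simp add: kinner_def)
  next
    case False
    then show ?thesis
      using kinner_diff_left[of d "x - u" "cscale c r" r]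
      by (simp add: eq kinner_scale_left c_def)
  qed
  moreover have "s = p + r" by (simp add: r_def)
  ultimately have "kinner d (x - v) f = 0" if "f \<in> insert s F" for f
    using that p(1) by (auto simp: kinner_add_right cv.span_base)
  then show ?case using insert.prems(1) v by blast
qed

text \<open>Taking inner products with the elements of \<open>F\<close> maps \<open>cspan S\<close>
  linearly into a space of dimension \<open>card F\<close>, which is too small for an injective
  image.\<close>

lemma exists_orthogonal_in_span:
  assumes "cv.independent S" "finite S" "finite F" "card F < card S"
  obtains v where "v \<in> cspan S" "v \<noteq> 0" "\<And>f. f \<in> F \<Longrightarrow> kinner d v f = 0"
proof -
  obtain fs where fs: "set fs = F" "distinct fs"
    using finite_distinct_list[OF assms(3)] by blast
  define n where "n = length fs"
  have n: "n = card F" using fs by (simp add: n_def distinct_card[symmetric])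
  define p where "p x = (\<lambda>k. if k < n then kinner d x (fs ! k) else 0)" for x
  have lin: "Vector_Spaces.linear cscale cscale p"
    by (intro Vector_Spaces.linear_iff[THEN iffD2] conjI allI vector_space_cscale)
      (auto simp: p_def fun_eq_iff kinner_add_left kinner_scale_left fun_simps)
  interpret p: Vector_Spaces.linear cscale cscale p by (rule lin)
  have "\<not> inj_on p (cspan S)"
  proof
    assume inj: "inj_on p (cspan S)"
    have "cv.independent (p ` S)"
      by (rule p.independent_injective_image[OF assms(1) inj])
    moreover have "Kvec n x" if "x \<in> p ` S" for x
      using that by (auto simp: Kvec_def p_def)
    ultimately have "card (p ` S) \<le> n" using independent_card_le by blast
    moreover have "card (p ` S) = card S"
      by (rule card_image) (meson inj inj_on_subset cv.span_superset)
    ultimately show False using assms(4) n by simp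
  qed
  then obtain v where v: "v \<in> cspan S" "v \<noteq> 0" "p v = 0"
    by (auto simp: p.inj_on_iff_eq_0[OF cv.subspace_span])
  have "kinner d v f = 0" if f: "f \<in> F" for f
  proof -
    obtain k where k: "k < n" "f = fs ! k"
      using f fs(1) n_def by (metis in_set_conv_nth)
    then have "kinner d v f = p v k" by (simp add: p_def)
    then show ?thesis by (simp add: v(3) fun_simps)
  qed
  then show ?thesis using that v by blast
qed

section \<open>Eigenvectors from the Rayleigh quotient\<close>

text \<open>With \<open>N = kerB d B\<close> this is \<open>ranPperp d B\<close>; keeping
  \<open>N\<close> general allows eigenvectors already found to be adjoined to it.\<close>

definition perp :: "nat \<Rightarrow> (nat \<Rightarrow> complex) set \<Rightarrow> (nat \<Rightarrow> complex) set" where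
  "perp d N = {x. Kvec d x \<and> (\<forall>y\<in>N. kinner d x y = 0)}"

lemma subspace_perp: "cv.subspace (perp d N)"
  by (auto simp: cv.subspace_def perp_def Kvec_add Kvec_cscale kinner_add_left kinner_scale_left)

lemma continuous_on_coordinate [continuous_intros]:
  "continuous_on S (\<lambda>x :: nat \<Rightarrow> complex. x k)"
  by (rule continuous_on_subset[OF continuous_on_product_coordinates]) simp

text \<open>In the product topology on vectors the sphere is a closed subset of a product of unit
  discs and points, which is compact by Tychonoff's theorem.\<close>

lemma compact_perp_sphere: "compact {x \<in> perp d N. ksq d x = 1}"
proof -
  let ?C = "PiE UNIV (\<lambda>k. if k < d then cball (0::complex) 1 else {0})"
  have "compactin (product_topology (\<lambda>_::nat. euclidean) UNIV) ?C"
    unfolding compactin_PiE by (simp add: compactin_euclidean_iff)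
  then have C: "compact ?C"
    by (simp add: euclidean_product_topology compactin_euclidean_iff)
  have ce: "closed {x :: nat \<Rightarrow> complex. f x = c}" if "continuous_on UNIV f" for f and c :: "'b :: t1_space"
    using continuous_closed_vimage[of "{c}" f] that
    by (simp add: vimage_def continuous_on_eq_continuous_at)
  have "continuous_on UNIV (ksq d)" "continuous_on UNIV (\<lambda>x. kinner d x y)" for y
    unfolding ksq_def kinner_def by (intro continuous_intros)+
  then have "closed ({x. ksq d x = 1} \<inter> (\<Inter>k\<in>{d..}. {x. x k = 0}) \<inter> (\<Inter>y\<in>N. {x. kinner d x y = 0}))"
    by (intro closed_Int closed_INT ballI ce) (auto intro: continuous_intros)
  then have "compact (?C \<inter> ({x. ksq d x = 1} \<inter> (\<Inter>k\<in>{d..}. {x. x k = 0}) \<inter> (\<Inter>y\<in>N. {x. kinner d x y = 0})))"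
    by (rule compact_Int_closed[OF C])
  moreover have "{x \<in> perp d N. ksq d x = 1} =
    ?C \<inter> ({x. ksq d x = 1} \<inter> (\<Inter>k\<in>{d..}. {x. x k = 0}) \<inter> (\<Inter>y\<in>N. {x. kinner d x y = 0}))"
  proof -
    have "x \<in> ?C" if "Kvec d x" "ksq d x = 1" for x
    proof -
      have "cmod (x k) \<le> 1" if "k < d" for k
      proof -
        have "(cmod (x k))\<^sup>2 \<le> ksq d x"
          unfolding ksq_def by (rule member_le_sum) (use that in auto)
        then show ?thesis using \<open>ksq d x = 1\<close> by (simp add: abs_square_le_1)
      qed
      then show ?thesis using that(1) by (auto simp: PiE_def Kvec_def)
    qed
    then show ?thesis by (auto simp: perp_def Kvec_def)
  qed
  ultimately show ?thesis by simp
qed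

text \<open>By compactness the Rayleigh quotient has a maximiser \<open>u\<close>. With its value
  \<open>\<mu>\<close>, the form \<open>h\<close> minus \<open>\<mu>\<close> times the inner product
  is nonpositive and has the null vector \<open>u\<close>, so \<open>u\<close> lies in its radical:
  this is the eigenvalue equation. The vector \<open>v\<close> makes the sphere nonempty and bounds
  \<open>\<mu>\<close> from below.\<close>

lemma Rayleigh_maximum:
  assumes h: "hermitian_form h" and cont: "continuous_on UNIV (\<lambda>x. h x x)"
    and v: "v \<in> perp d N" "v \<noteq> 0"
  obtains u \<mu> where "u \<in> perp d N" "u \<noteq> 0" "Re (h v v) \<le> \<mu> * ksq d v"
    "\<And>w. w \<in> perp d N \<Longrightarrow> h u w = of_real \<mu> * kinner d u w"
proof -
  let ?S = "{x \<in> perp d N. ksq d x = 1}"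
  have normalize: "\<exists>c>0. ksq d (cscale (of_real c) w) = 1 \<and> cscale (of_real c) w \<in> perp d N"
    if "w \<in> perp d N" "w \<noteq> 0" for w
  proof (intro exI conjI)
    have "ksq d w > 0" using that ksq_pos by (auto simp: perp_def)
    then show "1 / sqrt (ksq d w) > 0"
      "ksq d (cscale (of_real (1 / sqrt (ksq d w))) w) = 1"
      by (simp_all add: ksq_cscale norm_divide power_divide)
    show "cscale (of_real (1 / sqrt (ksq d w))) w \<in> perp d N"
      using that subspace_perp by (auto simp: cv.subspace_def)
  qed
  have "?S \<noteq> {}" using normalize[OF v] by auto
  moreover have "continuous_on ?S (\<lambda>x. Re (h x x))"
    by (intro continuous_intros continuous_on_subset[OF cont]) auto
  ultimately obtain u where u: "u \<in> ?S" "\<And>w. w \<in> ?S \<Longrightarrow> Re (h w w) \<le> Re (h u u)"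
    using continuous_attains_sup[OF compact_perp_sphere] by blast
  define \<mu> where "\<mu> = Re (h u u)"
  have le: "Re (h w w) \<le> \<mu> * ksq d w" if w: "w \<in> perp d N" for w
  proof (cases "w = 0")
    case True
    then show ?thesis by (simp add: hermitian_form_0[OF h] ksq_def fun_simps)
  next
    case False
    then obtain c where c: "c > 0" "ksq d (cscale (of_real c) w) = 1" "cscale (of_real c) w \<in> perp d N"
      using normalize w by blast
    then have "Re (h (cscale (of_real c) w) (cscale (of_real c) w)) \<le> \<mu>"
      using u(2) by (auto simp: \<mu>_def)
    then have "c\<^sup>2 * Re (h w w) \<le> \<mu>"
      by (simp add: hermitian_form_scale_left[OF h] hermitian_form_scale_right[OF h]
          power2_eq_square mult.assoc)
    also have "\<mu> = c\<^sup>2 * (\<mu> * ksq d w)" using c(2) by (simp add: ksq_cscale)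
    finally show ?thesis using c(1) by simp
  qed
  let ?g = "\<lambda>x y. h x y - of_real \<mu> * kinner d x y"
  have "u \<in> radical ?g (perp d N)"
    by (rule semidefinite_null_vector_in_radical)
      (use le u in \<open>auto simp: hermitian_form_subtract_scale h hermitian_form_kinner subspace_perp
          kinner_self \<mu>_def\<close>)
  then have "\<And>w. w \<in> perp d N \<Longrightarrow> h u w = of_real \<mu> * kinner d u w"
    by (simp add: radical_def)
  moreover have "u \<noteq> 0" using u(1) by (auto simp: ksq_def fun_simps)
  ultimately show ?thesis using that u(1) le[OF v(1)] by blast
qed

text \<open>Maximising on the complement of \<open>F\<close> gives the eigenvalue equation only for
  test vectors orthogonal to \<open>F\<close>. It extends to all of \<open>perp d N\<close> because
  \<open>h u\<close> and \<open>kinner d u\<close> both vanish on the span of the eigenvectors in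
  \<open>F\<close>.\<close>

lemma eigenvector_orthogonal_to_eigenvectors:
  assumes h: "hermitian_form h" and cont: "continuous_on UNIV (\<lambda>x. h x x)"
    and F: "finite F" "F \<subseteq> perp d N"
    and eig: "\<And>f. f \<in> F \<Longrightarrow> \<exists>c. \<forall>w\<in>perp d N. h f w = c * kinner d f w"
    and v: "v \<in> perp d N" "v \<noteq> 0" "\<And>f. f \<in> F \<Longrightarrow> kinner d v f = 0"
  obtains u \<mu> where "u \<in> perp d N" "u \<noteq> 0" "\<And>f. f \<in> F \<Longrightarrow> kinner d u f = 0"
    "Re (h v v) \<le> \<mu> * ksq d v" "\<And>w. w \<in> perp d N \<Longrightarrow> h u w = of_real \<mu> * kinner d u w"
proof -
  have v': "v \<in> perp d (N \<union> F)" using v by (auto simp: perp_def)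
  obtain u \<mu> where u: "u \<in> perp d (N \<union> F)" "u \<noteq> 0" "Re (h v v) \<le> \<mu> * ksq d v"
    "\<And>w. w \<in> perp d (N \<union> F) \<Longrightarrow> h u w = of_real \<mu> * kinner d u w"
    using Rayleigh_maximum[OF h cont v' v(2)] by blast
  have uW: "u \<in> perp d N" and uF: "\<And>f. f \<in> F \<Longrightarrow> kinner d u f = 0"
    using u(1) by (auto simp: perp_def)
  have hF: "h u f = 0" if "f \<in> cspan F" for f
    using that
  proof (induction rule: cv.span_induct_alt)
    case base
    then show ?case by (rule hermitian_form_0[OF h])
  next
    case (step c f y)
    obtain b where "h f u = b * kinner d f u" using eig[OF step(1)] uW by blast
    also have "kinner d f u = 0" using uF[OF step(1)] kinner_cnj[of d f u] by simp
    finally have "h u f = 0" using hermitian_form_cnj[OF h, of u f] by simp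
    then show ?case using step(2)
      by (simp add: hermitian_form_add_right[OF h] hermitian_form_scale_right[OF h])
  qed
  have "h u w = of_real \<mu> * kinner d u w" if w: "w \<in> perp d N" for w
  proof -
    obtain p where p: "p \<in> cspan F" "\<And>f. f \<in> F \<Longrightarrow> kinner d (w - p) f = 0"
      using orthogonal_decomposition[OF F(1)] by blast
    have "p \<in> perp d N" using p(1) F(2) cv.span_minimal[OF _ subspace_perp] by blast
    then have "w - p \<in> perp d N" using w cv.subspace_diff[OF subspace_perp] by blast
    then have "w - p \<in> perp d (N \<union> F)" using p(2) by (auto simp: perp_def)
    then have "h u (w - p) = of_real \<mu> * kinner d u (w - p)" by (rule u(4))
    then show ?thesis
      using hF[OF p(1)] kinner_span_right[OF p(1) uF]
      by (simp add: hermitian_form_diff_right[OF h] kinner_diff_right)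
  qed
  then show ?thesis using that uW u uF by blast
qed

section \<open>Counting radicals along a decreasing family of forms\<close>

definition pos_on_span :: "((nat \<Rightarrow> complex) \<Rightarrow> (nat \<Rightarrow> complex) \<Rightarrow> complex) \<Rightarrow> (nat \<Rightarrow> complex) set \<Rightarrow> bool" where
  "pos_on_span h S \<longleftrightarrow> (\<forall>v\<in>cspan S. v \<noteq> 0 \<longrightarrow> Re (h v v) > 0)"

text \<open>Vectors of the radical have no cross terms with \<open>S\<close>, so at a sum
  \<open>x + y\<close> the form takes its value at \<open>x\<close>; positivity on \<open>S\<close>
  keeps the two spans apart.\<close>

lemma extend_by_radical:
  assumes h: "hermitian_form h" and W: "cv.subspace W" "\<And>x. x \<in> W \<Longrightarrow> Kvec d x"
    and S: "finite S" "S \<subseteq> W" "cv.independent S" "pos_on_span h S"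
  obtains S' where "finite S'" "S' \<subseteq> W" "cv.independent S'"
    "card S' = card S + cdim (radical h W)" "\<And>v. v \<in> cspan S' \<Longrightarrow> Re (h v v) \<ge> 0"
proof -
  have "\<And>x. x \<in> radical h W \<Longrightarrow> Kvec d x" using W(2) by (auto simp: radical_def)
  then obtain T where T: "finite T" "T \<subseteq> radical h W" "cv.independent T"
    "cspan T = radical h W" "card T = cdim (radical h W)"
    using subspace_basis[OF subspace_radical[OF h W(1)]] by metis
  have SW: "cspan S \<subseteq> W" by (rule cv.span_minimal[OF S(2) W(1)])
  have "cspan S \<inter> cspan T \<subseteq> {0}"
  proof
    fix x assume "x \<in> cspan S \<inter> cspan T"
    then have "x \<in> cspan S" "h x x = 0" using SW T(4) by (auto simp: radical_def)
    then show "x \<in> {0}" using S(4) by (force simp: pos_on_span_def)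
  qed
  then have ind: "cv.independent (S \<union> T)" "S \<inter> T = {}"
    using independent_Un[OF T(1) S(3) T(3)] by auto
  have "Re (h v v) \<ge> 0" if v: "v \<in> cspan (S \<union> T)" for v
  proof -
    obtain x y where xy: "v = x + y" "x \<in> cspan S" "y \<in> cspan T"
      using v by (auto simp: cv.span_Un)
    have "h y x = 0" "h y y = 0" using xy SW T(4) by (auto simp: radical_def)
    then have "h x y = 0" using hermitian_form_cnj[OF h, of x y] by simp
    then have "h v v = h x x"
      using \<open>h y x = 0\<close> \<open>h y y = 0\<close>
      by (simp add: xy hermitian_form_add_left[OF h] hermitian_form_add_right[OF h])
    then show ?thesis
      using S(4) xy(2) by (cases "x = 0") (auto simp: pos_on_span_def hermitian_form_0[OF h] less_imp_le)
  qed
  moreover have "card (S \<union> T) = card S + cdim (radical h W)"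
    using ind(2) S(1) T(1,5) by (simp add: card_Un_disjoint)
  moreover have "S \<union> T \<subseteq> W" using S T by (auto simp: radical_def)
  ultimately show ?thesis using that[of "S \<union> T"] ind(1) S(1) T(1) by auto
qed

text \<open>The parameter descends from \<open>t\<close> to \<open>s\<close>. At each
  \<open>r\<close> in \<open>T\<close> the radical of \<open>q r\<close> is adjoined, and the
  nonnegativity obtained there becomes strict below \<open>r\<close> because the family is strictly
  decreasing.\<close>

lemma extend_along_decreasing_family:
  fixes q :: "real \<Rightarrow> (nat \<Rightarrow> complex) \<Rightarrow> (nat \<Rightarrow> complex) \<Rightarrow> complex"
  assumes h: "\<And>t. hermitian_form (q t)" and W: "cv.subspace W" "\<And>x. x \<in> W \<Longrightarrow> Kvec d x"
    and dec: "\<And>s t u. 0 \<le> s \<Longrightarrow> s < t \<Longrightarrow> u \<in> W \<Longrightarrow> u \<noteq> 0 \<Longrightarrow> Re (q t u u) < Re (q s u u)"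
    and T: "finite T"
    and S: "finite S" "S \<subseteq> W" "cv.independent S" "pos_on_span (q t) S"
    and s: "0 \<le> s" "s \<le> t" "T \<subseteq> {s<..t}"
  obtains S' where "finite S'" "S' \<subseteq> W" "cv.independent S'"
    "card S' = card S + (\<Sum>r\<in>T. cdim (radical (q r) W))" "pos_on_span (q s) S'"
  using T s
proof (induction T arbitrary: s thesis rule: finite_linorder_min_induct)
  case empty
  have "cspan S \<subseteq> W" by (rule cv.span_minimal[OF S(2) W(1)])
  then have "pos_on_span (q s) S"
    using S(4) dec[OF empty(2)] empty(3) unfolding pos_on_span_def
    by (metis less_le_trans less_imp_le order_le_less subsetD)
  then show ?case using empty(1) S by simp
next
  case (insert b T)
  have b: "0 \<le> b" "b \<le> t" "s < b" "T \<subseteq> {b<..t}"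
    using insert.prems insert.hyps by auto
  \<comment> \<open>The induction inserts a new minimum \<open>b\<close>, so its hypothesis covers
    the descent from \<open>t\<close> to \<open>b\<close>.\<close>
  obtain S1 where S1: "finite S1" "S1 \<subseteq> W" "cv.independent S1"
    "card S1 = card S + (\<Sum>r\<in>T. cdim (radical (q r) W))" "pos_on_span (q b) S1"
    using insert.IH[OF _ b(1,2,4)] by blast
  obtain S2 where S2: "finite S2" "S2 \<subseteq> W" "cv.independent S2"
    "card S2 = card S1 + cdim (radical (q b) W)" "\<And>v. v \<in> cspan S2 \<Longrightarrow> Re (q b v v) \<ge> 0"
    using extend_by_radical[OF h W S1(1,2,3,5)] by blast
  have "cspan S2 \<subseteq> W" by (rule cv.span_minimal[OF S2(2) W(1)])
  then have "pos_on_span (q s) S2"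
    using S2(5) dec[OF insert.prems(2) b(3)] unfolding pos_on_span_def
    by (metis le_less_trans subsetD)
  moreover have "b \<notin> T" using insert.hyps by auto
  then have "card S2 = card S + (\<Sum>r\<in>insert b T. cdim (radical (q r) W))"
    using S2(4) S1(4) insert.hyps by simp
  ultimately show ?case using insert.prems(1) S2 by blast
qed

text \<open>At \<open>s\<close> itself the radical is adjoined without descending any further, so
  only nonnegativity results there.\<close>

lemma nonneg_subspace_of_decreasing_family:
  fixes q :: "real \<Rightarrow> (nat \<Rightarrow> complex) \<Rightarrow> (nat \<Rightarrow> complex) \<Rightarrow> complex"
  assumes h: "\<And>t. hermitian_form (q t)" and W: "cv.subspace W" "\<And>x. x \<in> W \<Longrightarrow> Kvec d x"
    and dec: "\<And>s t u. 0 \<le> s \<Longrightarrow> s < t \<Longrightarrow> u \<in> W \<Longrightarrow> u \<noteq> 0 \<Longrightarrow> Re (q t u u) < Re (q s u u)"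
    and T: "finite T" "s \<notin> T" "T \<subseteq> {s..}" "0 \<le> s"
  obtains S where "finite S" "S \<subseteq> W" "cv.independent S"
    "card S = (\<Sum>r\<in>insert s T. cdim (radical (q r) W))" "\<forall>v\<in>cspan S. Re (q s v v) \<ge> 0"
proof -
  obtain t where t: "s \<le> t" "T \<subseteq> {s<..t}"
  proof -
    have "s < r \<and> r \<le> Max (insert s T)" if "r \<in> T" for r
      using T that by (metis Max_ge atLeast_iff finite_insert insertCI order_le_less subsetD)
    then have "T \<subseteq> {s<..Max (insert s T)}" by (meson greaterThanAtMost_iff subsetI)
    moreover have "s \<le> Max (insert s T)" using T(1) by simp
    ultimately show ?thesis using that by blast
  qed
  \<comment> \<open>The descent starts from the empty set, whose span contains no nonzero
    vector.\<close>
  have pos: "pos_on_span (q t) {}" by (simp add: pos_on_span_def)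
  obtain S1 where S1: "finite S1" "S1 \<subseteq> W" "cv.independent S1"
    "card S1 = card ({} :: (nat \<Rightarrow> complex) set) + (\<Sum>r\<in>T. cdim (radical (q r) W))" "pos_on_span (q s) S1"
    by (rule extend_along_decreasing_family[where q = q and t = t, OF h W dec T(1) finite.emptyI empty_subsetI
          cv.independent_empty pos T(4) t])
  obtain S2 where "finite S2" "S2 \<subseteq> W" "cv.independent S2"
    "card S2 = card S1 + cdim (radical (q s) W)" "\<And>v. v \<in> cspan S2 \<Longrightarrow> Re (q s v v) \<ge> 0"
    using extend_by_radical[OF h W S1(1,2,3,5)] by blast
  then show ?thesis using that[of S2] S1(4) T by simp
qed

section \<open>Matrices\<close>

lemma mv_add: "mv d A (x + y) = mv d A x + mv d A y"
  by (auto simp: mv_def fun_eq_iff fun_simps algebra_simps sum.distrib)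

lemma mv_cscale: "mv d A (cscale c x) = cscale c (mv d A x)"
  by (auto simp: mv_def fun_eq_iff fun_simps algebra_simps sum_distrib_left)

lemma mv_0 [simp]: "mv d A 0 = 0"
  by (auto simp: mv_def fun_eq_iff fun_simps)

lemma mv_diff: "mv d A (x - y) = mv d A x - mv d A y"
  using mv_add[of d A "x - y" y] by simp

lemma mv_matrix_add: "mv d (\<lambda>k m. A k m + B k m) x = mv d A x + mv d B x"
  by (auto simp: mv_def fun_eq_iff fun_simps algebra_simps sum.distrib)

lemma kinner_mv_left: "kinner d (mv d A x) y = (\<Sum>k<d. \<Sum>m<d. A k m * x m * cnj (y k))"
  by (simp add: kinner_def mv_def sum_distrib_right)

lemma kinner_mv_adj: "kinner d (mv d A x) y = kinner d x (mv d (madj A) y)"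
proof -
  have "kinner d x (mv d (madj A) y) = (\<Sum>m<d. \<Sum>k<d. A k m * x m * cnj (y k))"
    by (simp add: kinner_def mv_def madj_def sum_distrib_left mult_ac)
  also have "\<dots> = (\<Sum>k<d. \<Sum>m<d. A k m * x m * cnj (y k))" by (rule sum.swap)
  finally show ?thesis by (simp add: kinner_mv_left)
qed

lemma kinner_mv_madj: "kinner d (mv d (madj A) x) y = kinner d x (mv d A y)"
proof -
  have "madj (madj A) = A" by (simp add: madj_def)
  then show ?thesis by (simp add: kinner_mv_adj)
qed

lemma mv_mmul: "mv d (mmul d A B) x = mv d A (mv d B x)"
proof
  fix k
  have "(\<Sum>m<d. (\<Sum>j<d. A k j * B j m) * x m) = (\<Sum>m<d. \<Sum>j<d. A k j * (B j m * x m))"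
    by (simp add: sum_distrib_right mult.assoc)
  also have "\<dots> = (\<Sum>j<d. \<Sum>m<d. A k j * (B j m * x m))"
    by (rule sum.swap)
  also have "\<dots> = (\<Sum>j<d. A k j * (\<Sum>m<d. B j m * x m))"
    by (simp add: sum_distrib_left)
  finally show "mv d (mmul d A B) x k = mv d A (mv d B x) k"
    by (simp add: mv_def mmul_def)
qed

lemma hermitian_form_matrix:
  assumes "\<And>k m. k < d \<Longrightarrow> m < d \<Longrightarrow> H m k = cnj (H k m)"
  shows "hermitian_form (\<lambda>x y. kinner d (mv d H x) y)"
proof -
  have H: "mv d (madj H) x = mv d H x" for x
  proof -
    have "madj H k m = H k m" if "k < d" "m < d" for k m
      unfolding madj_def by (rule assms[OF that(2,1), symmetric])
    then show ?thesis by (simp add: mv_def fun_eq_iff)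
  qed
  have "kinner d (mv d H x) y = kinner d x (mv d H y)" for x y
    unfolding kinner_mv_adj H ..
  then have "kinner d (mv d H y) x = cnj (kinner d (mv d H x) y)" for x y
    using kinner_cnj[of d "mv d H y" x] by simp
  then show ?thesis
    unfolding hermitian_form_def mv_add mv_cscale kinner_add_left kinner_scale_left by blast
qed

lemma continuous_on_matrix_form: "continuous_on UNIV (\<lambda>x. kinner d (mv d H x) x)"
  unfolding kinner_mv_left by (intro continuous_intros)

text \<open>Linearity of \<open>Lop\<close> is available only on vectors supported below
  \<open>d\<close>; its matrix yields a form that is linear on all vectors, as
  \<open>hermitian_form\<close> demands.\<close>

lemma Kvec_linear_eq_mv:
  assumes add: "\<And>x y. Kvec d x \<Longrightarrow> Kvec d y \<Longrightarrow> f (x + y) = f x + f y"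
    and scale: "\<And>c x. Kvec d x \<Longrightarrow> f (cscale c x) = cscale c (f x)"
    and K: "\<And>x. Kvec d x \<Longrightarrow> Kvec d (f x)" and x: "Kvec d x"
  shows "f x = mv d (\<lambda>k m. f (unit_vec m) k) x"
proof -
  have f0: "f 0 = 0" using scale[of 0 0] by simp
  have "Kvec d (\<Sum>k<n. cscale (x k) (unit_vec k)) \<and>
        f (\<Sum>k<n. cscale (x k) (unit_vec k)) = (\<Sum>k<n. cscale (x k) (f (unit_vec k)))" if "n \<le> d" for n
    using that
  proof (induction n)
    case (Suc n)
    then show ?case
      by (simp add: add scale Kvec_add Kvec_cscale Kvec_unit_vec)
  qed (simp add: f0)
  from this[of d] have eq: "f x = (\<Sum>k<d. cscale (x k) (f (unit_vec k)))"
    using Kvec_expand[OF x] by simp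
  have ap: "(\<Sum>k<n. cscale (x k) (f (unit_vec k))) j = (\<Sum>k<n. x k * f (unit_vec k) j)" for n j
    by (induction n) (auto simp: fun_simps)
  show ?thesis
  proof
    fix j
    show "f x j = mv d (\<lambda>k m. f (unit_vec m) k) x j"
    proof (cases "j < d")
      case True
      then show ?thesis by (simp add: eq ap mv_def mult.commute)
    next
      case False
      then show ?thesis using K[OF x] by (simp add: mv_def Kvec_def)
    qed
  qed
qed

section \<open>Self-adjoint vertex conditions\<close>

lemma ranPperp_eq_perp: "ranPperp d B = perp d (kerB d B)"
  by (simp add: ranPperp_def perp_def)

lemma subspace_ranPperp: "cv.subspace (ranPperp d B)"
  by (simp add: ranPperp_eq_perp subspace_perp)

lemma Kvec_ranPperp: "x \<in> ranPperp d B \<Longrightarrow> Kvec d x"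
  by (simp add: ranPperp_def)

lemma kerB_iff: "x \<in> kerB d B \<longleftrightarrow> Kvec d x \<and> mv d B x = 0"
  by (simp add: kerB_def zero_fun_def)

lemma subspace_kerB: "cv.subspace (kerB d B)"
  by (auto simp: cv.subspace_def kerB_iff Kvec_add Kvec_cscale mv_add mv_cscale)

lemma kinner_ranPperp_kerB:
  assumes "x \<in> ranPperp d B" "y \<in> kerB d B"
  shows "kinner d x y = 0" "kinner d y x = 0"
proof -
  show "kinner d x y = 0" using assms by (simp add: ranPperp_def)
  then show "kinner d y x = 0" using kinner_cnj[of d y x] by simp
qed

lemma ranPperp_Int_kerB: "x \<in> ranPperp d B \<Longrightarrow> x \<in> kerB d B \<Longrightarrow> x = 0"
  using kinner_ranPperp_kerB(1)[of x d B x] by (simp add: kinner_self_eq_0 kerB_iff)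

lemma ranPperp_kerB_decomposition:
  assumes "Kvec d x"
  obtains y where "y \<in> ranPperp d B" "x - y \<in> kerB d B"
proof -
  obtain F where F: "finite F" "cspan F = kerB d B"
    using subspace_basis[OF subspace_kerB] by (metis kerB_iff)
  obtain u where u: "u \<in> cspan F" "\<And>f. f \<in> F \<Longrightarrow> kinner d (x - u) f = 0"
    using orthogonal_decomposition[OF F(1)] by blast
  have "kinner d (x - u) y = 0" if "y \<in> kerB d B" for y
    using kinner_span_right[of y F] u(2) that F(2) by blast
  moreover have "Kvec d (x - u)"
    using u(1) F(2) assms by (auto simp: kerB_iff Kvec_diff)
  ultimately have "x - u \<in> ranPperp d B" by (simp add: ranPperp_def)
  then show ?thesis using that[of "x - u"] u(1) F(2) by simp
qed

lemma Pperp_eq: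
  assumes "y \<in> ranPperp d B" "x - y \<in> kerB d B"
  shows "Pperp d B x = y"
  unfolding Pperp_def
proof (rule the_equality)
  fix z assume z: "z \<in> ranPperp d B \<and> x - z \<in> kerB d B"
  then have "z - y \<in> ranPperp d B" using assms subspace_ranPperp cv.subspace_diff by blast
  moreover have "(x - y) - (x - z) \<in> kerB d B" using assms z subspace_kerB cv.subspace_diff by blast
  then have "z - y \<in> kerB d B" by simp
  ultimately show "z = y" using ranPperp_Int_kerB by fastforce
qed (use assms in simp)

lemma
  assumes "Kvec d x"
  shows Pperp_in_ranPperp: "Pperp d B x \<in> ranPperp d B"
    and diff_Pperp_in_kerB: "x - Pperp d B x \<in> kerB d B"
proof -
  obtain y where "y \<in> ranPperp d B" "x - y \<in> kerB d B"
    by (rule ranPperp_kerB_decomposition[OF assms])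
  then show "Pperp d B x \<in> ranPperp d B" "x - Pperp d B x \<in> kerB d B"
    using Pperp_eq by blast+
qed

lemma Pperp_ident: "x \<in> ranPperp d B \<Longrightarrow> Pperp d B x = x"
  by (rule Pperp_eq) (simp_all add: kerB_iff)

lemma Pperp_add:
  assumes "Kvec d x" "Kvec d y"
  shows "Pperp d B (x + y) = Pperp d B x + Pperp d B y"
proof (rule Pperp_eq)
  show "Pperp d B x + Pperp d B y \<in> ranPperp d B"
    using assms Pperp_in_ranPperp subspace_ranPperp cv.subspace_add by blast
  have "(x - Pperp d B x) + (y - Pperp d B y) \<in> kerB d B"
    using assms diff_Pperp_in_kerB subspace_kerB cv.subspace_add by blast
  then show "x + y - (Pperp d B x + Pperp d B y) \<in> kerB d B" by (simp add: algebra_simps)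
qed

lemma Pperp_cscale:
  assumes "Kvec d x"
  shows "Pperp d B (cscale c x) = cscale c (Pperp d B x)"
proof (rule Pperp_eq)
  show "cscale c (Pperp d B x) \<in> ranPperp d B"
    using assms Pperp_in_ranPperp subspace_ranPperp cv.subspace_scale by blast
  have "cscale c (x - Pperp d B x) \<in> kerB d B"
    using assms diff_Pperp_in_kerB subspace_kerB cv.subspace_scale by blast
  then show "cscale c x - cscale c (Pperp d B x) \<in> kerB d B"
    by (simp add: cv.scale_right_diff_distrib)
qed

lemma kinner_Pperp_left:
  assumes "Kvec d x" "w \<in> ranPperp d B"
  shows "kinner d (Pperp d B x) w = kinner d x w"
  using kinner_ranPperp_kerB(2)[OF assms(2) diff_Pperp_in_kerB[OF assms(1)]]
  by (simp add: kinner_diff_left)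

lemma kinner_Pperp_right:
  assumes "Kvec d x" "w \<in> ranPperp d B"
  shows "kinner d w (Pperp d B x) = kinner d w x"
  using kinner_ranPperp_kerB(1)[OF assms(2) diff_Pperp_in_kerB[OF assms(1)]]
  by (simp add: kinner_diff_right)

lemma orthogonal_ranPperp_iff:
  assumes "Kvec d x"
  shows "(\<forall>w\<in>ranPperp d B. kinner d x w = 0) \<longleftrightarrow> x \<in> kerB d B"
proof
  assume 0: "\<forall>w\<in>ranPperp d B. kinner d x w = 0"
  let ?y = "Pperp d B x"
  have y: "?y \<in> ranPperp d B" by (rule Pperp_in_ranPperp[OF assms])
  then have "kinner d ?y ?y = 0" using 0 kinner_Pperp_left[OF assms y] by simp
  then have "?y = 0" using Kvec_ranPperp[OF y] by (simp add: kinner_self_eq_0)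
  then show "x \<in> kerB d B" using diff_Pperp_in_kerB[OF assms, of B] by simp
qed (use kinner_ranPperp_kerB in auto)

text \<open>The identity between Ran B^* and the orthogonal complement of Ker B. The residual
  \<open>x - u\<close> of the projection to the range is killed by \<open>B\<close>; it is therefore
  orthogonal to \<open>x\<close> as well as to \<open>u\<close>, and so vanishes.\<close>

lemma ranPperp_range_adjoint:
  assumes "x \<in> ranPperp d B"
  obtains z where "Kvec d z" "x = mv d (madj B) z"
proof -
  let ?R = "{mv d (madj B) z | z. Kvec d z}"
  have "cv.subspace ?R"
    unfolding cv.subspace_def
  proof (intro conjI ballI allI)
    show "0 \<in> ?R" by (rule CollectI, rule exI[of _ 0]) simp
    show "x + y \<in> ?R" if xy: "x \<in> ?R" "y \<in> ?R" for x y
    proof -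
      obtain z z' where "Kvec d z" "Kvec d z'" "x = mv d (madj B) z" "y = mv d (madj B) z'"
        using xy by blast
      then show ?thesis
        by (intro CollectI exI[of _ "z + z'"]) (simp add: mv_add Kvec_add)
    qed
    show "cscale c x \<in> ?R" if x: "x \<in> ?R" for c x
    proof -
      obtain z where "Kvec d z" "x = mv d (madj B) z"
        using x by blast
      then show ?thesis
        by (intro CollectI exI[of _ "cscale c z"]) (simp add: mv_cscale Kvec_cscale)
    qed
  qed
  moreover have "\<And>y. y \<in> ?R \<Longrightarrow> Kvec d y" by auto
  ultimately obtain F where F: "finite F" "cspan F = ?R" by (rule subspace_basis)
  obtain u where u: "u \<in> cspan F" "\<And>f. f \<in> F \<Longrightarrow> kinner d (x - u) f = 0"
    using orthogonal_decomposition[OF F(1)] by blast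
  obtain z where z: "Kvec d z" "u = mv d (madj B) z" using u(1) F(2) by auto
  have K: "Kvec d (x - u)" using z Kvec_ranPperp[OF assms] by (simp add: Kvec_diff)
  have R: "kinner d (x - u) y = 0" if "y \<in> ?R" for y
    using kinner_span_right[of y F] u(2) that F(2) by blast
  have Kb: "mv d B (x - u) = 0"
  proof -
    have "kinner d (mv d B (x - u)) (mv d B (x - u)) = 0"
      unfolding kinner_mv_adj by (rule R) auto
    then show ?thesis by (simp add: kinner_self_eq_0)
  qed
  then have "x - u \<in> kerB d B" using K by (simp add: kerB_iff)
  then have "kinner d x (x - u) = 0" using assms kinner_ranPperp_kerB by blast
  moreover have "kinner d u (x - u) = 0"
    unfolding z(2) kinner_mv_madj using Kb z(2) by simp
  ultimately have "kinner d (x - u) (x - u) = 0" by (simp add: kinner_diff_left)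
  then have "x = u" using K by (simp add: kinner_self_eq_0)
  then show ?thesis using that z by blast
qed

section \<open>Consequences of surjectivity and self-adjointness of the vertex conditions\<close>

locale vertex_condition =
  fixes d :: nat and A B :: "nat \<Rightarrow> nat \<Rightarrow> complex"
  assumes surj: "\<forall>y. Kvec d y \<longrightarrow> (\<exists>x z. Kvec d x \<and> Kvec d z \<and> mv d A x + mv d B z = y)"
    and selfadj: "\<forall>k<d. \<forall>m<d. mmul d A (madj B) k m = mmul d B (madj A) k m"
begin

abbreviation "W \<equiv> ranPperp d B"

lemma mv_A_adj_B: "mv d A (mv d (madj B) z) = mv d B (mv d (madj A) z)"
  unfolding mv_mmul[symmetric] using selfadj by (auto simp: mv_def fun_eq_iff intro!: sum.cong)

lemma kinner_adj_commute:
  "kinner d (mv d (madj A) z) (mv d (madj B) z') = kinner d (mv d (madj B) z) (mv d (madj A) z')"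
  by (simp add: kinner_mv_madj mv_A_adj_B)

text \<open>A common null vector of the two adjoints is orthogonal to every A x + B y, hence to
  itself by surjectivity.\<close>

lemma adj_injective:
  assumes "Kvec d z" "mv d (madj A) z = 0" "mv d (madj B) z = 0"
  shows "z = 0"
proof -
  obtain x y where "mv d A x + mv d B y = z" using surj assms(1) by blast
  then have "kinner d z z = kinner d (mv d A x) z + kinner d (mv d B y) z"
    by (metis kinner_add_left)
  also have "\<dots> = 0" by (simp add: kinner_mv_adj assms)
  finally show ?thesis using assms(1) by (simp add: kinner_self_eq_0)
qed

text \<open>The map \<open>A\<^sup>* + \<i> B\<^sup>*\<close> is injective because the cross terms of its squared norm cancel,
  hence surjective by dimension.\<close>

lemma kerB_range_adj_A:
  assumes "w \<in> kerB d B"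
  obtains z where "Kvec d z" "w = mv d (madj A) z" "mv d (madj B) z = 0"
proof -
  define T where "T z = mv d (madj A) z + cscale \<i> (mv d (madj B) z)" for z
  have lin: "Vector_Spaces.linear cscale cscale T"
    by (intro Vector_Spaces.linear_iff[THEN iffD2] conjI allI vector_space_cscale)
      (auto simp: T_def mv_add mv_cscale fun_eq_iff fun_simps algebra_simps)
  have inj: "z = 0" if z: "Kvec d z" "T z = 0" for z
  proof -
    have "kinner d (T z) (T z) = kinner d (mv d (madj A) z) (mv d (madj A) z)
        + kinner d (mv d (madj B) z) (mv d (madj B) z)"
      by (simp add: T_def kinner_add_left kinner_add_right kinner_scale_left kinner_scale_right
          kinner_adj_commute algebra_simps)
    then have "complex_of_real (ksq d (mv d (madj A) z) + ksq d (mv d (madj B) z)) = 0"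
      using z(2) by (simp add: kinner_self)
    then have "ksq d (mv d (madj A) z) + ksq d (mv d (madj B) z) = 0"
      using of_real_eq_0_iff by blast
    then have "ksq d (mv d (madj A) z) = 0" "ksq d (mv d (madj B) z) = 0"
      using ksq_nonneg[of d "mv d (madj A) z"] ksq_nonneg[of d "mv d (madj B) z"] by linarith+
    then show ?thesis using adj_injective[OF z(1)] by (simp add: ksq_eq_0)
  qed
  have KT: "Kvec d (T x)" for x by (simp add: T_def Kvec_add Kvec_cscale)
  have "Kvec d w" using assms by (simp add: kerB_iff)
  then obtain z where z: "Kvec d z" "T z = w"
    using Kvec_inj_imp_surj[OF lin inj KT] by blast
  \<comment> \<open>Pairing B w = 0 with \<open>z\<close> gives a real number plus \<i> times the
    squared norm of B^* z, so the imaginary part forces B^* z = 0.\<close>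
  have "0 = kinner d (mv d B w) z" using assms by (simp add: kerB_iff)
  also have "\<dots> = kinner d (T z) (mv d (madj B) z)" by (simp add: kinner_mv_adj z(2))
  also have "\<dots> = kinner d (mv d (madj A) z) (mv d (madj B) z) + \<i> * of_real (ksq d (mv d (madj B) z))"
    by (simp add: T_def kinner_add_left kinner_scale_left kinner_self)
  finally have "Im (kinner d (mv d (madj A) z) (mv d (madj B) z)) + ksq d (mv d (madj B) z) = 0"
    by (simp add: complex_eq_iff)
  moreover have "kinner d (mv d (madj A) z) (mv d (madj B) z)
      = cnj (kinner d (mv d (madj A) z) (mv d (madj B) z))"
    using kinner_adj_commute[of z z] kinner_cnj[of d "mv d (madj A) z" "mv d (madj B) z"] by simp
  then have "Im (kinner d (mv d (madj A) z) (mv d (madj B) z)) = 0"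
    by (simp add: complex_eq_iff)
  ultimately have "mv d (madj B) z = 0" by (simp add: ksq_eq_0)
  then show ?thesis using that z by (simp add: T_def)
qed

text \<open>Writing an element \<open>w\<close> of Ker B as A^* z with B^* z = 0 turns the pairing
  of \<open>u\<close> with \<open>w\<close> into that of A u = - B v with \<open>z\<close>, which is
  0.\<close>

lemma boundary_value_in_W:
  assumes "Kvec d u" "mv d A u + mv d B v = 0"
  shows "u \<in> W"
proof -
  have "kinner d u w = 0" if w: "w \<in> kerB d B" for w
  proof -
    obtain z where z: "Kvec d z" "w = mv d (madj A) z" "mv d (madj B) z = 0"
      using kerB_range_adj_A[OF w] by blast
    have "mv d A u = - mv d B v" using assms(2) by (simp add: eq_neg_iff_add_eq_0)
    then have "kinner d u w = kinner d (0 - mv d B v) z" by (simp add: z(2) flip: kinner_mv_adj)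
    also have "\<dots> = 0" unfolding kinner_diff_left by (simp add: kinner_mv_adj z(3))
    finally show ?thesis .
  qed
  then show ?thesis using assms(1) by (simp add: ranPperp_def)
qed

section \<open>The operator L and its symmetry\<close>

lemma Lop_eq:
  assumes "y \<in> W" "mv d B y = mv d A (Pperp d B x)"
  shows "Lop d A B x = y"
  unfolding Lop_def
proof (rule the_equality)
  fix z assume z: "z \<in> W \<and> mv d B z = mv d A (Pperp d B x)"
  then have "z - y \<in> W" using assms subspace_ranPperp cv.subspace_diff by blast
  moreover from this have "z - y \<in> kerB d B"
    using z assms by (simp add: kerB_iff mv_diff Kvec_ranPperp)
  ultimately show "z = y" using ranPperp_Int_kerB by fastforce
qed (use assms in simp)

text \<open>Since A B^* = B A^*, the vector A^* z solves B y = A B^* z; projecting it along Ker B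
  gives the solution in \<open>W\<close>.\<close>

lemma Lop_of_adjoint:
  assumes "Kvec d x" "Pperp d B x = mv d (madj B) z"
  shows "Lop d A B x = Pperp d B (mv d (madj A) z)"
proof (rule Lop_eq)
  show "Pperp d B (mv d (madj A) z) \<in> W" by (simp add: Pperp_in_ranPperp)
  have "mv d (madj A) z - Pperp d B (mv d (madj A) z) \<in> kerB d B"
    by (simp add: diff_Pperp_in_kerB)
  then show "mv d B (Pperp d B (mv d (madj A) z)) = mv d A (Pperp d B x)"
    by (simp add: assms(2) mv_A_adj_B kerB_iff mv_diff)
qed

lemma
  assumes "Kvec d x"
  shows Lop_in_W: "Lop d A B x \<in> W"
    and mv_B_Lop: "mv d B (Lop d A B x) = mv d A (Pperp d B x)"
proof -
  obtain z where z: "Pperp d B x = mv d (madj B) z"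
    using ranPperp_range_adjoint[OF Pperp_in_ranPperp[OF assms]] by blast
  let ?y = "mv d (madj A) z"
  have y: "Lop d A B x = Pperp d B ?y" by (rule Lop_of_adjoint[OF assms z])
  show "Lop d A B x \<in> W" by (simp add: y Pperp_in_ranPperp)
  have "?y - Pperp d B ?y \<in> kerB d B" by (simp add: diff_Pperp_in_kerB)
  then show "mv d B (Lop d A B x) = mv d A (Pperp d B x)"
    by (simp add: y z mv_A_adj_B kerB_iff mv_diff)
qed

lemma Lop_add:
  assumes "Kvec d x" "Kvec d y"
  shows "Lop d A B (x + y) = Lop d A B x + Lop d A B y"
  by (rule Lop_eq)
    (use assms in \<open>simp_all add: Lop_in_W mv_B_Lop mv_add Pperp_add cv.subspace_add subspace_ranPperp\<close>)

lemma Lop_cscale: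
  assumes "Kvec d x"
  shows "Lop d A B (cscale c x) = cscale c (Lop d A B x)"
  by (rule Lop_eq)
    (use assms in \<open>simp_all add: Lop_in_W mv_B_Lop mv_cscale Pperp_cscale cv.subspace_scale subspace_ranPperp\<close>)

text \<open>In terms of preimages under B^* this is \<open>kinner_adj_commute\<close>.\<close>

lemma Lop_hermitian:
  assumes "Kvec d x" "Kvec d y"
  shows "kinner d (Lop d A B x) y = kinner d x (Lop d A B y)"
proof -
  obtain z where z: "Pperp d B x = mv d (madj B) z"
    using ranPperp_range_adjoint[OF Pperp_in_ranPperp[OF assms(1)]] by blast
  obtain z' where z': "Pperp d B y = mv d (madj B) z'"
    using ranPperp_range_adjoint[OF Pperp_in_ranPperp[OF assms(2)]] by blast
  have "kinner d (Lop d A B x) y = kinner d (Lop d A B x) (Pperp d B y)"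
    using assms by (simp add: kinner_Pperp_right Lop_in_W)
  also have "\<dots> = kinner d (mv d (madj A) z) (Pperp d B y)"
    using assms by (simp add: Lop_of_adjoint[OF assms(1) z] kinner_Pperp_left Pperp_in_ranPperp)
  also have "\<dots> = kinner d (Pperp d B x) (mv d (madj A) z')"
    by (simp add: z z' kinner_adj_commute)
  also have "\<dots> = kinner d (Pperp d B x) (Lop d A B y)"
    using assms by (simp add: Lop_of_adjoint[OF assms(2) z'] kinner_Pperp_right Pperp_in_ranPperp)
  also have "\<dots> = kinner d x (Lop d A B y)"
    using assms by (simp add: kinner_Pperp_left Lop_in_W)
  finally show ?thesis .
qed

section \<open>Hermitian forms of compressed operators\<close>

definition Lmat :: "nat \<Rightarrow> nat \<Rightarrow> complex" where
  "Lmat = (\<lambda>k m. Lop d A B (unit_vec m) k)"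

lemma Lop_eq_mv: "Kvec d x \<Longrightarrow> Lop d A B x = mv d Lmat x"
  unfolding Lmat_def
  by (rule Kvec_linear_eq_mv) (simp_all add: Lop_add Lop_cscale Kvec_ranPperp[OF Lop_in_W])

lemma Lmat_hermitian:
  assumes "k < d" "m < d"
  shows "Lmat m k = cnj (Lmat k m)"
proof -
  have 1: "kinner d x (unit_vec j) = x j" "kinner d (unit_vec j) x = cnj (x j)" if "j < d" for j x
    using that by (simp_all add: kinner_def unit_vec_def if_distrib if_distribR sum.delta cong: if_cong)
  show ?thesis
    using Lop_hermitian[of "unit_vec m" "unit_vec k"] assms
    by (simp add: 1 Kvec_unit_vec Lmat_def)
qed

text \<open>On \<open>W\<close> the projections in L + P^perp M P^perp drop out, so the form of the
  uncompressed matrix serves.\<close>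

definition qform :: "(nat \<Rightarrow> nat \<Rightarrow> complex) \<Rightarrow> (nat \<Rightarrow> complex) \<Rightarrow> (nat \<Rightarrow> complex) \<Rightarrow> complex" where
  "qform M x y = kinner d (mv d (\<lambda>k m. Lmat k m + M k m) x) y"

lemma qform_eq: "qform M x y = kinner d (mv d Lmat x) y + kinner d (mv d M x) y"
  by (simp add: qform_def mv_matrix_add kinner_add_left)

lemma hermitian_form_qform:
  assumes "\<And>k m. k < d \<Longrightarrow> m < d \<Longrightarrow> M m k = cnj (M k m)"
  shows "hermitian_form (qform M)"
proof -
  have "hermitian_form (\<lambda>x y. kinner d (mv d (\<lambda>k m. Lmat k m + M k m) x) y)"
    by (rule hermitian_form_matrix) (metis assms Lmat_hermitian complex_cnj_add)
  then show ?thesis by (simp add: qform_def[abs_def])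
qed

lemma continuous_on_qform: "continuous_on UNIV (\<lambda>x. qform M x x)"
  unfolding qform_def by (rule continuous_on_matrix_form)

text \<open>The vertex condition forces \<open>u\<close> into \<open>W\<close>, where A u = B L u.
  It then says that L u + M u lies in Ker B, that is, is orthogonal to \<open>W\<close>.\<close>

lemma boundary_condition_iff_radical:
  "{u. Kvec d u \<and> mv d A u + mv d B (mv d M u) = 0} = radical (qform M) W"
proof -
  have "mv d A u + mv d B (mv d M u) = 0 \<longleftrightarrow> (\<forall>w\<in>W. qform M u w = 0)" if u: "u \<in> W" for u
  proof -
    have K: "Kvec d u" using u by (rule Kvec_ranPperp)
    have "mv d A u + mv d B (mv d M u) = mv d B (mv d Lmat u + mv d M u)"
      using mv_B_Lop[OF K] u by (simp add: Pperp_ident mv_add flip: Lop_eq_mv[OF K])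
    then have "mv d A u + mv d B (mv d M u) = 0 \<longleftrightarrow> mv d Lmat u + mv d M u \<in> kerB d B"
      by (simp add: kerB_iff Kvec_add)
    also have "\<dots> \<longleftrightarrow> (\<forall>w\<in>W. qform M u w = 0)"
      by (subst orthogonal_ranPperp_iff[symmetric]) (simp_all add: Kvec_add qform_eq kinner_add_left)
    finally show ?thesis .
  qed
  moreover have "u \<in> W" if "Kvec d u" "mv d A u + mv d B (mv d M u) = 0" for u
    using boundary_value_in_W that by blast
  ultimately show ?thesis using Kvec_ranPperp by (auto simp: radical_def)
qed

text \<open>The residual of the eigenvalue equation lies in \<open>W\<close>, hence vanishes as soon
  as it is orthogonal to \<open>W\<close>; pairing with \<open>W\<close> removes the
  projections.\<close>

lemma compression_eigenspace_iff_radical: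
  "{x \<in> W. Lop d A B x + Pperp d B (mv d M (Pperp d B x)) = cscale (of_real l) x}
    = radical (\<lambda>x y. qform M x y - of_real l * kinner d x y) W"
proof -
  have "Lop d A B x + Pperp d B (mv d M (Pperp d B x)) = cscale (of_real l) x \<longleftrightarrow>
    (\<forall>w\<in>W. qform M x w - of_real l * kinner d x w = 0)" if x: "x \<in> W" for x
  proof -
    have K: "Kvec d x" using x by (rule Kvec_ranPperp)
    let ?y = "Lop d A B x + Pperp d B (mv d M (Pperp d B x)) - cscale (of_real l) x"
    have yW: "?y \<in> W"
      using x K by (intro cv.subspace_diff cv.subspace_add cv.subspace_scale subspace_ranPperp
          Lop_in_W Pperp_in_ranPperp Kvec_mv)
    have ip: "kinner d ?y w = qform M x w - of_real l * kinner d x w" if "w \<in> W" for w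
      using that x K
      by (simp add: kinner_diff_left kinner_add_left kinner_scale_left qform_eq kinner_Pperp_left
          Pperp_ident Lop_eq_mv)
    have "?y = 0 \<longleftrightarrow> (\<forall>w\<in>W. kinner d ?y w = 0)"
      using yW kinner_self_eq_0[OF Kvec_ranPperp[OF yW]] by (metis kinner_0(1))
    then show ?thesis using ip by simp
  qed
  then show ?thesis by (auto simp: radical_def)
qed

end

section \<open>Hyperbolic inequalities\<close>

lemma strict_increasing_on_pos:
  fixes f f' :: "real \<Rightarrow> real"
  assumes "\<And>t. x \<le> t \<Longrightarrow> t \<le> y \<Longrightarrow> (f has_real_derivative f' t) (at t)"
    and "\<And>t. x < t \<Longrightarrow> t < y \<Longrightarrow> f' t > 0" and "x < y"
  shows "f x < f y"
proof (rule DERIV_pos_imp_increasing_open[OF assms(3)])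
  show "\<exists>z. (f has_real_derivative z) (at t) \<and> z > 0" if "x < t" "t < y" for t
    using assms(1,2)[of t] that by force
  show "continuous_on {x..y} f"
    by (rule DERIV_continuous_on) (use assms(1) has_field_derivative_at_within in fastforce)
qed

lemma less_sinh:
  fixes x :: real
  assumes "x > 0"
  shows "x < sinh x"
proof -
  have "cosh t > 1" if "t > 0" for t :: real
    using that cosh_real_strict_mono[of 0 t] by simp
  then have "sinh 0 - 0 < sinh x - x"
    using assms
    by (intro strict_increasing_on_pos[where f = "\<lambda>t. sinh t - t" and f' = "\<lambda>t. cosh t - 1"])
      (auto intro!: derivative_eq_intros)
  then show ?thesis by simp
qed

lemma less_sinh_cosh:
  fixes x :: real
  assumes "x > 0"
  shows "x < sinh x * cosh x"
proof -
  have "x * 1 < sinh x * cosh x"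
    by (rule mult_less_le_imp_less) (use assms less_sinh cosh_real_ge_1 in auto)
  then show ?thesis by simp
qed

lemma divide_tanh_strict_mono:
  fixes x y :: real
  assumes "0 < x" "x < y"
  shows "x / tanh x < y / tanh y"
proof -
  have "x * cosh x / sinh x < y * cosh y / sinh y"
  proof (rule strict_increasing_on_pos[where f = "\<lambda>t. t * cosh t / sinh t" and f' = "\<lambda>t. (sinh t * cosh t - t) / (sinh t)\<^sup>2"])
    fix t :: real assume "x \<le> t"
    then have t: "t > 0" using assms by simp
    have "((\<lambda>t. t * cosh t / sinh t) has_real_derivative
        ((cosh t + t * sinh t) * sinh t - t * cosh t * cosh t) / (sinh t * sinh t)) (at t)"
      using t by (auto intro!: derivative_eq_intros)
    also have "(cosh t + t * sinh t) * sinh t - t * cosh t * cosh t = sinh t * cosh t - t"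
      using cosh_square_eq[of t] by (simp add: algebra_simps power2_eq_square)
    finally show "((\<lambda>t. t * cosh t / sinh t) has_real_derivative (sinh t * cosh t - t) / (sinh t)\<^sup>2) (at t)"
      by (simp add: power2_eq_square)
  next
    fix t :: real assume "x < t"
    then show "(sinh t * cosh t - t) / (sinh t)\<^sup>2 > 0"
      using assms less_sinh_cosh[of t] by simp
  qed (use assms in auto)
  then show ?thesis by (simp add: tanh_def)
qed

lemma one_less_divide_tanh:
  fixes x :: real
  assumes "x > 0"
  shows "1 < x / tanh x"
proof -
  have "0 * cosh 0 - sinh 0 < x * cosh x - sinh x"
    using assms
    by (intro strict_increasing_on_pos[where f = "\<lambda>t. t * cosh t - sinh t" and f' = "\<lambda>t. t * sinh t"])
      (auto intro!: derivative_eq_intros)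
  then show ?thesis using assms by (simp add: tanh_def field_simps)
qed

lemma inverse_tanh_minus_inverse_strict_mono:
  fixes x y :: real
  assumes "0 < x" "x < y"
  shows "1 / tanh x - 1 / x < 1 / tanh y - 1 / y"
proof -
  have "cosh x / sinh x - 1 / x < cosh y / sinh y - 1 / y"
  proof (rule strict_increasing_on_pos[where f = "\<lambda>t. cosh t / sinh t - 1 / t" and f' = "\<lambda>t. 1 / t\<^sup>2 - 1 / (sinh t)\<^sup>2"])
    fix t :: real assume "x \<le> t"
    then have t: "t > 0" using assms by simp
    have "((\<lambda>t. cosh t / sinh t - 1 / t) has_real_derivative
        (sinh t * sinh t - cosh t * cosh t) / (sinh t * sinh t) + 1 / (t * t)) (at t)"
      using t by (auto intro!: derivative_eq_intros simp: field_simps)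
    also have "sinh t * sinh t - cosh t * cosh t = -1"
      using cosh_square_eq[of t] by (simp add: power2_eq_square)
    finally show "((\<lambda>t. cosh t / sinh t - 1 / t) has_real_derivative 1 / t\<^sup>2 - 1 / (sinh t)\<^sup>2) (at t)"
      by (simp add: power2_eq_square)
  next
    fix t :: real assume "x < t"
    then have "0 < t\<^sup>2" "t\<^sup>2 < (sinh t)\<^sup>2"
      using assms less_sinh[of t] by (auto intro!: power_strict_mono)
    then show "1 / t\<^sup>2 - 1 / (sinh t)\<^sup>2 > 0"
      by (simp add: frac_less2)
  qed (use assms in auto)
  then show ?thesis by (simp add: tanh_def)
qed

text \<open>Cleared of denominators, the first estimate is \<open>x * exp (- x) < sinh x\<close> and
  the second is \<open>x < sinh x * cosh x\<close>.\<close>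

lemma divide_tanh_less:
  fixes x :: real
  assumes "x > 0"
  shows "x / tanh x - 1 < x" "x / tanh x - 1 < x * tanh x"
proof -
  have s: "sinh x > 0" using assms by simp
  have "x * exp (- x) < sinh x"
  proof -
    have "x * exp (- x) < x * 1" using assms by (intro mult_strict_left_mono) auto
    then show ?thesis using less_sinh[OF assms] by simp
  qed
  then have "x * cosh x - sinh x < x * sinh x"
    using cosh_minus_sinh[of x] by (simp add: algebra_simps flip: right_diff_distrib)
  then show "x / tanh x - 1 < x" using s by (simp add: tanh_def field_simps)
  have "x * (cosh x * cosh x) - sinh x * cosh x < x * (sinh x * sinh x)"
    using less_sinh_cosh[OF assms] cosh_square_eq[of x] by (simp add: algebra_simps power2_eq_square)
  then show "x / tanh x - 1 < x * tanh x"
    using s by (simp add: tanh_def field_simps)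
qed

section \<open>Edge rates and the function inverse to \<open>eta\<close>\<close>

lemma mult_tanh_strict_mono:
  fixes s t a :: real
  assumes "a > 0" "0 \<le> s" "s < t"
  shows "s * tanh (s * a / 2) < t * tanh (t * a / 2)"
proof -
  have "s * tanh (s * a / 2) \<le> t * tanh (s * a / 2)"
    using assms by (intro mult_right_mono) auto
  also have "\<dots> < t * tanh (t * a / 2)"
    using assms by (intro mult_strict_left_mono) auto
  finally show ?thesis .
qed

text \<open>\<open>antisym_rate t a\<close> is minus the response of the edge of length \<open>a\<close>
  to antisymmetric boundary data at energy \<open>- t\<^sup>2\<close>.\<close>

definition antisym_rate :: "real \<Rightarrow> real \<Rightarrow> real" where
  "antisym_rate t a = (if t = 0 then 2 / a else t / tanh (t * a / 2))"

text \<open>The expression that \<open>eta\<close> inverts, extended by its limit 0 to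
  \<open>t = 0\<close>. It is also the eigenvalue of M(0) - M(t) on antisymmetric data of an edge of
  length \<open>a\<close>.\<close>

definition eta_inv :: "real \<Rightarrow> real \<Rightarrow> real" where
  "eta_inv t a = antisym_rate t a - 2 / a"

lemma antisym_rate_scaled: "a > 0 \<Longrightarrow> t > 0 \<Longrightarrow>
  antisym_rate t a = 2 / a * ((t * a / 2) / tanh (t * a / 2))"
  by (simp add: antisym_rate_def field_simps)

lemma antisym_rate_strict_mono:
  assumes "a > 0" "0 \<le> s" "s < t"
  shows "antisym_rate s a < antisym_rate t a"
proof (cases "s = 0")
  case True
  then show ?thesis
    using one_less_divide_tanh[of "t * a / 2"] assms
    by (subst antisym_rate_scaled[of a t]) (auto simp: antisym_rate_def field_simps)
next
  case False
  then have "(s * a / 2) / tanh (s * a / 2) < (t * a / 2) / tanh (t * a / 2)"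
    using assms by (intro divide_tanh_strict_mono) auto
  then have "2 / a * ((s * a / 2) / tanh (s * a / 2)) < 2 / a * ((t * a / 2) / tanh (t * a / 2))"
    by (rule mult_strict_left_mono) (use assms in simp)
  moreover have "s > 0" "t > 0" using False assms by auto
  ultimately show ?thesis using assms(1) by (simp only: antisym_rate_scaled)
qed

lemma eta_inv_pos: "a > 0 \<Longrightarrow> t > 0 \<Longrightarrow> eta_inv t a > 0"
  using antisym_rate_strict_mono[of a 0 t] by (simp add: eta_inv_def antisym_rate_def)

lemma eta_inv_mono: "a > 0 \<Longrightarrow> 0 \<le> s \<Longrightarrow> s < t \<Longrightarrow> eta_inv s a < eta_inv t a"
  using antisym_rate_strict_mono by (simp add: eta_inv_def)

text \<open>With y = t a / 2 the value is t (coth y - 1 / y), which increases with y. This is why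
  the shortest edges decide the upper bound.\<close>

lemma eta_inv_mono_length:
  assumes "0 < a" "a < b" "t > 0"
  shows "eta_inv t a < eta_inv t b"
proof -
  have eq: "eta_inv t c = t * (1 / tanh (t * c / 2) - 1 / (t * c / 2))" if "c > 0" for c
    using assms that by (simp add: eta_inv_def antisym_rate_def right_diff_distrib)
  have "1 / tanh (t * a / 2) - 1 / (t * a / 2) < 1 / tanh (t * b / 2) - 1 / (t * b / 2)"
    using assms by (intro inverse_tanh_minus_inverse_strict_mono) auto
  then show ?thesis using assms by (simp add: eq del: times_divide_eq_right)
qed

text \<open>The two bounds are the eigenvalues of M(0) - M(t) on an external edge and on symmetric
  data; the antisymmetric eigenvalue lies below both.\<close>

lemma eta_inv_less:
  assumes "a > 0" "t > 0"
  shows "eta_inv t a < t" "eta_inv t a < t * tanh (t * a / 2)"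
proof -
  have eq: "eta_inv t a = 2 / a * ((t * a / 2) / tanh (t * a / 2) - 1)"
    unfolding eta_inv_def antisym_rate_scaled[OF assms] using assms by (simp only: right_diff_distrib)
  have "2 / a * ((t * a / 2) / tanh (t * a / 2) - 1) < 2 / a * (t * a / 2)"
    using assms divide_tanh_less(1)[of "t * a / 2"] by (intro mult_strict_left_mono) auto
  then show "eta_inv t a < t" using assms eq by simp
  have "2 / a * ((t * a / 2) / tanh (t * a / 2) - 1) < 2 / a * (t * a / 2 * tanh (t * a / 2))"
    using assms divide_tanh_less(2)[of "t * a / 2"] by (intro mult_strict_left_mono) auto
  then show "eta_inv t a < t * tanh (t * a / 2)" using assms eq by simp
qed

lemma eta_inv_ge:
  assumes "a > 0" "t > 0"
  shows "t - 2 / a \<le> eta_inv t a"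
proof -
  have "0 < tanh (t * a / 2)" "tanh (t * a / 2) < 1"
    using assms tanh_real_lt_1 by auto
  then show ?thesis using assms by (simp add: eta_inv_def antisym_rate_def field_simps)
qed

text \<open>Since \<open>eta_inv t a\<close> lies between t - 2 / a and t, the intermediate value
  theorem gives a solution between \<open>l\<close> and \<open>l + 2 / a\<close>; strict
  monotonicity makes it unique.\<close>

lemma
  assumes "l > 0" "a > 0"
  shows eta_pos: "eta l a > 0" and eta_inv_eta: "eta_inv (eta l a) a = l"
proof -
  let ?P = "\<lambda>\<kappa>. \<kappa> > 0 \<and> l = \<kappa> / tanh (\<kappa> * a / 2) - 2 / a"
  have iff: "?P \<kappa> \<longleftrightarrow> \<kappa> > 0 \<and> eta_inv \<kappa> a = l" for \<kappa>
    by (auto simp: eta_inv_def antisym_rate_def)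
  have "\<exists>\<kappa>\<ge>l. \<kappa> \<le> l + 2 / a \<and> \<kappa> / tanh (\<kappa> * a / 2) - 2 / a = l"
  proof (rule IVT')
    show "l / tanh (l * a / 2) - 2 / a \<le> l"
      using eta_inv_less(1)[of a l] assms by (simp add: eta_inv_def antisym_rate_def)
    have "l + 2 / a > 0" using assms by (simp add: add_pos_pos)
    then show "l \<le> (l + 2 / a) / tanh ((l + 2 / a) * a / 2) - 2 / a"
      using eta_inv_ge[of a "l + 2 / a"] assms by (simp add: eta_inv_def antisym_rate_def)
    show "continuous_on {l..l + 2 / a} (\<lambda>\<kappa>. \<kappa> / tanh (\<kappa> * a / 2) - 2 / a)"
      using assms by (intro continuous_intros) auto
  qed (use assms in simp)
  then obtain \<kappa> where "l \<le> \<kappa>" "\<kappa> / tanh (\<kappa> * a / 2) - 2 / a = l" by blast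
  then have \<kappa>: "?P \<kappa>" using assms(1) by simp
  moreover have "\<kappa>' = \<kappa>" if "?P \<kappa>'" for \<kappa>'
    using \<kappa> that eta_inv_mono[of a \<kappa> \<kappa>'] eta_inv_mono[of a \<kappa>' \<kappa>] assms
    unfolding iff by (cases \<kappa> \<kappa>' rule: linorder_cases) auto
  ultimately have "?P (eta l a)" unfolding eta_def by (rule theI)
  then show "eta l a > 0" "eta_inv (eta l a) a = l" unfolding iff by auto
qed

lemma le_eta_iff:
  assumes "l > 0" "a > 0" "t > 0"
  shows "t \<le> eta l a \<longleftrightarrow> eta_inv t a \<le> l"
  using eta_inv_mono[of a t "eta l a"] eta_inv_mono[of a "eta l a" t] eta_pos[of l a] eta_inv_eta[of l a] assms
  by (cases t "eta l a" rule: linorder_cases) auto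

section \<open>Edgewise matrices\<close>

text \<open>The matrix acting as \<open>p\<close> on external edges and, on the two ends of the internal edge \<open>i\<close>,
  with eigenvalue \<open>r i\<close> on \<open>(1, 1)\<close> and \<open>s i\<close> on \<open>(1, -1)\<close>.\<close>

definition edge_mat :: "nat \<Rightarrow> nat \<Rightarrow> real \<Rightarrow> (nat \<Rightarrow> real) \<Rightarrow> (nat \<Rightarrow> real) \<Rightarrow> nat \<Rightarrow> nat \<Rightarrow> complex" where
  "edge_mat ne ni p r s k m =
     (if k < ne then (if m = k then of_real p else 0)
      else if ne \<le> m \<and> (k - ne) mod ni = (m - ne) mod ni
      then (if (k < ne + ni) = (m < ne + ni)
            then of_real ((r ((k - ne) mod ni) + s ((k - ne) mod ni)) / 2)
            else of_real ((r ((k - ne) mod ni) - s ((k - ne) mod ni)) / 2))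
      else 0)"

lemma edge_mat_hermitian: "edge_mat ne ni p r s m k = cnj (edge_mat ne ni p r s k m)"
  by (auto simp: edge_mat_def)

lemma sum_Kdim:
  "(\<Sum>k<Kdim ne ni. f k) = (\<Sum>e<ne. f e) + (\<Sum>i<ni. f (ne + i)) + (\<Sum>i<ni. f (ne + ni + i))"
  for f :: "nat \<Rightarrow> 'a :: comm_monoid_add"
proof -
  have split: "(\<Sum>k<m + n. f k) = (\<Sum>k<m. f k) + (\<Sum>k<n. f (m + k))" for m n
    by (induction n) (auto simp: add.assoc)
  have "Kdim ne ni = (ne + ni) + ni" by (simp add: Kdim_def)
  then show ?thesis by (simp only: split)
qed

lemma Kdim_cases [consumes 1, case_names external initial terminal]:
  assumes "k < Kdim ne ni"
  obtains "k < ne" | i where "i < ni" "k = ne + i" | i where "i < ni" "k = ne + ni + i"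
proof -
  consider "k < ne" | "ne \<le> k" "k - ne < ni" | "ne + ni \<le> k" "k - ne - ni < ni"
    using assms by (force simp: Kdim_def)
  then show ?thesis
  proof cases
    case 2
    then show ?thesis using that(2)[of "k - ne"] by simp
  next
    case 3
    then show ?thesis using that(3)[of "k - ne - ni"] by simp
  qed (use that in auto)
qed

lemma
  shows mv_edge_mat_external: "e < ne \<Longrightarrow> mv (Kdim ne ni) (edge_mat ne ni p r s) u e = of_real p * u e"
    and mv_edge_mat_initial: "i < ni \<Longrightarrow> mv (Kdim ne ni) (edge_mat ne ni p r s) u (ne + i) =
      of_real ((r i + s i) / 2) * u (ne + i) + of_real ((r i - s i) / 2) * u (ne + ni + i)"
    and mv_edge_mat_terminal: "i < ni \<Longrightarrow> mv (Kdim ne ni) (edge_mat ne ni p r s) u (ne + ni + i) =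
      of_real ((r i - s i) / 2) * u (ne + i) + of_real ((r i + s i) / 2) * u (ne + ni + i)"
proof -
  have delta: "(\<Sum>j<ni. if i = j then f j else 0) = f i" if "i < ni" for i and f :: "nat \<Rightarrow> complex"
    using that by simp
  have delta': "(\<Sum>j<ne. if j = i then f j else 0) = f i" if "i < ne" for i and f :: "nat \<Rightarrow> complex"
    using that by simp
  have lt: "e < Kdim ne ni" if "e < ne" for e
    using that by (simp add: Kdim_def)
  have lt1: "ne + i < Kdim ne ni" and lt2: "ne + ni + i < Kdim ne ni" if "i < ni" for i
    using that by (simp_all add: Kdim_def)
  show "mv (Kdim ne ni) (edge_mat ne ni p r s) u e = of_real p * u e" if e: "e < ne"
  proof -
    have "(\<Sum>m<ne. edge_mat ne ni p r s e m * u m) = (\<Sum>m<ne. if m = e then of_real p * u m else 0)"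
      by (rule sum.cong) (auto simp: edge_mat_def e)
    moreover have "edge_mat ne ni p r s e (ne + i) = 0" "edge_mat ne ni p r s e (ne + ni + i) = 0" for i
      using e by (auto simp: edge_mat_def)
    ultimately show ?thesis
      using e by (simp add: mv_def lt sum_Kdim delta')
  qed
  have mod: "(ni + i) mod ni = i" if "i < ni" for i using that by simp
  show "mv (Kdim ne ni) (edge_mat ne ni p r s) u (ne + i) =
      of_real ((r i + s i) / 2) * u (ne + i) + of_real ((r i - s i) / 2) * u (ne + ni + i)" if i: "i < ni"
  proof -
    have "edge_mat ne ni p r s (ne + i) m = 0" if "m < ne" for m
      using that by (simp add: edge_mat_def)
    moreover have "(\<Sum>j<ni. edge_mat ne ni p r s (ne + i) (ne + j) * u (ne + j)) =
        (\<Sum>j<ni. if i = j then of_real ((r j + s j) / 2) * u (ne + j) else 0)"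
      by (rule sum.cong) (use i in \<open>auto simp: edge_mat_def\<close>)
    moreover have "(\<Sum>j<ni. edge_mat ne ni p r s (ne + i) (ne + ni + j) * u (ne + ni + j)) =
        (\<Sum>j<ni. if i = j then of_real ((r j - s j) / 2) * u (ne + ni + j) else 0)"
      by (rule sum.cong) (use i in \<open>auto simp: edge_mat_def mod\<close>)
    ultimately show ?thesis
      using i by (simp only: mv_def lt1 sum_Kdim delta if_True) simp
  qed
  show "mv (Kdim ne ni) (edge_mat ne ni p r s) u (ne + ni + i) =
      of_real ((r i - s i) / 2) * u (ne + i) + of_real ((r i + s i) / 2) * u (ne + ni + i)" if i: "i < ni"
  proof -
    have "edge_mat ne ni p r s (ne + ni + i) m = 0" if "m < ne" for m
      using that by (simp add: edge_mat_def)
    moreover have "(\<Sum>j<ni. edge_mat ne ni p r s (ne + ni + i) (ne + j) * u (ne + j)) =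
        (\<Sum>j<ni. if i = j then of_real ((r j - s j) / 2) * u (ne + j) else 0)"
      by (rule sum.cong) (use i in \<open>auto simp: edge_mat_def mod\<close>)
    moreover have "(\<Sum>j<ni. edge_mat ne ni p r s (ne + ni + i) (ne + ni + j) * u (ne + ni + j)) =
        (\<Sum>j<ni. if i = j then of_real ((r j + s j) / 2) * u (ne + ni + j) else 0)"
      by (rule sum.cong) (use i in \<open>auto simp: edge_mat_def mod\<close>)
    ultimately show ?thesis
      using i by (simp only: mv_def lt2 sum_Kdim delta if_True) simp
  qed
qed

text \<open>The quadratic form of \<open>edge_mat\<close>; the factors 1/2 come from the squared
  length 2 of (1, 1) and (1, -1).\<close>

definition edge_quad :: "nat \<Rightarrow> nat \<Rightarrow> real \<Rightarrow> (nat \<Rightarrow> real) \<Rightarrow> (nat \<Rightarrow> real) \<Rightarrow> (nat \<Rightarrow> complex) \<Rightarrow> real" where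
  "edge_quad ne ni p r s u = (\<Sum>e<ne. p * (cmod (u e))\<^sup>2) +
     (\<Sum>i<ni. r i * (cmod (u (ne + i) + u (ne + ni + i)))\<^sup>2 / 2
            + s i * (cmod (u (ne + i) - u (ne + ni + i)))\<^sup>2 / 2)"

lemma Re_kinner_edge_mat:
  "Re (kinner (Kdim ne ni) (mv (Kdim ne ni) (edge_mat ne ni p r s) u) u) = edge_quad ne ni p r s u"
proof -
  have ext: "Re (of_real p * x * cnj x) = p * (cmod x)\<^sup>2" for x
    unfolding cmod_power2 by (simp add: power2_eq_square algebra_simps)
  have int: "Re ((of_real ((b + c) / 2) * x + of_real ((b - c) / 2) * y) * cnj x)
      + Re ((of_real ((b - c) / 2) * x + of_real ((b + c) / 2) * y) * cnj y)
    = b * (cmod (x + y))\<^sup>2 / 2 + c * (cmod (x - y))\<^sup>2 / 2" for b c :: real and x y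
    unfolding cmod_power2 by (simp add: power2_eq_square field_simps)
  let ?v = "mv (Kdim ne ni) (edge_mat ne ni p r s) u"
  have E: "(\<Sum>e<ne. Re (?v e * cnj (u e))) = (\<Sum>e<ne. p * (cmod (u e))\<^sup>2)"
    by (rule sum.cong) (simp_all only: lessThan_iff mv_edge_mat_external ext)
  have I: "(\<Sum>i<ni. Re (?v (ne + i) * cnj (u (ne + i)))) + (\<Sum>i<ni. Re (?v (ne + ni + i) * cnj (u (ne + ni + i))))
      = (\<Sum>i<ni. r i * (cmod (u (ne + i) + u (ne + ni + i)))\<^sup>2 / 2
            + s i * (cmod (u (ne + i) - u (ne + ni + i)))\<^sup>2 / 2)"
    unfolding sum.distrib[symmetric]
    by (rule sum.cong) (simp_all only: lessThan_iff mv_edge_mat_initial mv_edge_mat_terminal int)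
  have "Re (kinner (Kdim ne ni) ?v u) = (\<Sum>e<ne. Re (?v e * cnj (u e))) +
      ((\<Sum>i<ni. Re (?v (ne + i) * cnj (u (ne + i)))) + (\<Sum>i<ni. Re (?v (ne + ni + i) * cnj (u (ne + ni + i)))))"
    by (simp only: kinner_def sum_Kdim plus_complex.sel Re_sum add.assoc)
  then show ?thesis by (simp only: E I edge_quad_def)
qed

text \<open>The parallelogram law. It expresses the norm in the coordinates that diagonalise
  \<open>edge_mat\<close>, so that forms can be compared coefficient by coefficient.\<close>

lemma ksq_eq_edge_quad: "ksq (Kdim ne ni) u = edge_quad ne ni 1 (\<lambda>_. 1) (\<lambda>_. 1) u"
proof -
  have "(cmod x)\<^sup>2 + (cmod y)\<^sup>2 = (cmod (x + y))\<^sup>2 / 2 + (cmod (x - y))\<^sup>2 / 2" for x y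
    unfolding cmod_power2 by (simp add: power2_eq_square field_simps)
  then show ?thesis
    by (simp add: ksq_def sum_Kdim edge_quad_def add.assoc flip: sum.distrib)
qed

lemma edge_quad_diff:
  "edge_quad ne ni p r s u - edge_quad ne ni p' r' s' u =
   edge_quad ne ni (p - p') (\<lambda>i. r i - r' i) (\<lambda>i. s i - s' i) u"
  by (simp add: edge_quad_def sum_subtractf sum.distrib left_diff_distrib diff_divide_distrib)

lemma edge_quad_scale:
  "c * edge_quad ne ni p r s u = edge_quad ne ni (c * p) (\<lambda>i. c * r i) (\<lambda>i. c * s i) u"
  by (simp add: edge_quad_def sum_distrib_left distrib_left mult.assoc)

lemma edge_quad_nonneg:
  assumes "p \<ge> 0" "\<And>i. i < ni \<Longrightarrow> r i \<ge> 0" "\<And>i. i < ni \<Longrightarrow> s i \<ge> 0"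
  shows "edge_quad ne ni p r s u \<ge> 0"
  unfolding edge_quad_def using assms by (intro add_nonneg_nonneg sum_nonneg) auto

text \<open>All summands are nonnegative and so vanish separately. Where \<open>s i\<close> is 0
  antisymmetric data survive, which is the situation of the equality case.\<close>

lemma edge_quad_eq_0:
  assumes "p > 0" "\<And>i. i < ni \<Longrightarrow> r i > 0" "\<And>i. i < ni \<Longrightarrow> s i \<ge> 0"
    and 0: "edge_quad ne ni p r s u = 0"
  shows "e < ne \<Longrightarrow> u e = 0"
    and "i < ni \<Longrightarrow> u (ne + ni + i) = - u (ne + i)"
    and "i < ni \<Longrightarrow> s i > 0 \<Longrightarrow> u (ne + i) = 0"
proof -
  let ?f = "\<lambda>i. r i * (cmod (u (ne + i) + u (ne + ni + i)))\<^sup>2 / 2"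
  let ?g = "\<lambda>i. s i * (cmod (u (ne + i) - u (ne + ni + i)))\<^sup>2 / 2"
  have n: "p * (cmod (u e))\<^sup>2 \<ge> 0" for e using assms(1) by simp
  have nf: "?f i \<ge> 0" "?g i \<ge> 0" if "i < ni" for i
    using assms(2,3)[OF that] by auto
  have "(\<Sum>e<ne. p * (cmod (u e))\<^sup>2) \<ge> 0" "(\<Sum>i<ni. ?f i + ?g i) \<ge> 0"
    using n nf by (auto intro!: sum_nonneg add_nonneg_nonneg)
  then have z: "(\<Sum>e<ne. p * (cmod (u e))\<^sup>2) = 0" "(\<Sum>i<ni. ?f i + ?g i) = 0"
    using 0 unfolding edge_quad_def by linarith+
  have "p * (cmod (u e))\<^sup>2 = 0" if "e < ne" for e
    using z(1) n that sum_nonneg_eq_0_iff[of "{..<ne}" "\<lambda>e. p * (cmod (u e))\<^sup>2"] by auto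
  then show "e < ne \<Longrightarrow> u e = 0" using assms(1) by simp
  have fg: "?f i = 0" "?g i = 0" if "i < ni" for i
  proof -
    have "?f i + ?g i = 0"
      using z(2) nf that sum_nonneg_eq_0_iff[of "{..<ni}" "\<lambda>i. ?f i + ?g i"] by auto
    then show "?f i = 0" "?g i = 0" using nf[OF that] by linarith+
  qed
  show 1: "u (ne + ni + i) = - u (ne + i)" if "i < ni" for i
    using fg(1)[OF that] assms(2)[OF that] by (simp add: eq_neg_iff_add_eq_0 add.commute)
  show "u (ne + i) = 0" if "i < ni" "s i > 0"
    using fg(2)[OF that(1)] that(2) 1[OF that(1)] by simp
qed

lemma edge_quad_pos:
  assumes "p > 0" "\<And>i. i < ni \<Longrightarrow> r i > 0" "\<And>i. i < ni \<Longrightarrow> s i > 0"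
    and u: "Kvec (Kdim ne ni) u" "u \<noteq> 0"
  shows "edge_quad ne ni p r s u > 0"
proof (rule ccontr)
  assume "\<not> ?thesis"
  moreover have ge: "edge_quad ne ni p r s u \<ge> 0"
    using assms by (intro edge_quad_nonneg) (auto intro: less_imp_le)
  ultimately have 0: "edge_quad ne ni p r s u = 0" by simp
  note z = edge_quad_eq_0[OF assms(1,2) less_imp_le[OF assms(3)] 0]
  have "u k = 0" for k
  proof (cases "k < Kdim ne ni")
    case True
    then show ?thesis
    proof (cases rule: Kdim_cases)
      case external
      then show ?thesis using z(1) by blast
    next
      case (initial i)
      then show ?thesis using z(3) assms(3) by blast
    next
      case (terminal i)
      then show ?thesis using z(2,3)[of i] assms(3) by simp
    qed
  next
    case False
    then show ?thesis using u(1) by (simp add: Kvec_def)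
  qed
  then show False using u(2) by (auto simp: fun_eq_iff fun_simps)
qed

section \<open>The Dirichlet-to-Neumann matrix at negative energy\<close>

text \<open>Symmetric data on an internal edge extend to multiples of cosh (t (x - a / 2)),
  antisymmetric data to multiples of sinh of the same argument; the inward end derivatives give the
  two eigenvalues. At \<open>t = 0\<close> affine functions take their place and give
  M(0,a).\<close>

definition DN :: "nat \<Rightarrow> nat \<Rightarrow> (nat \<Rightarrow> real) \<Rightarrow> real \<Rightarrow> nat \<Rightarrow> nat \<Rightarrow> complex" where
  "DN ne ni a t = edge_mat ne ni (- t) (\<lambda>i. - (t * tanh (t * a i / 2))) (\<lambda>i. - antisym_rate t (a i))"

lemma mv_Mmat: "mv (Kdim ne ni) (Mmat ne ni a) = mv (Kdim ne ni) (DN ne ni a 0)"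
proof -
  have "Mmat ne ni a k m = DN ne ni a 0 k m" if "k < Kdim ne ni" "m < Kdim ne ni" for k m
    using that by (auto simp: Mmat_def DN_def edge_mat_def antisym_rate_def Kdim_def)
  then show ?thesis by (auto simp: mv_def fun_eq_iff intro!: sum.cong)
qed

lemma Re_kinner_DN_diff:
  "Re (kinner (Kdim ne ni) (mv (Kdim ne ni) (DN ne ni a s) u) u)
    - Re (kinner (Kdim ne ni) (mv (Kdim ne ni) (DN ne ni a t) u) u)
   = edge_quad ne ni (t - s) (\<lambda>i. t * tanh (t * a i / 2) - s * tanh (s * a i / 2))
       (\<lambda>i. antisym_rate t (a i) - antisym_rate s (a i)) u"
  by (simp add: DN_def Re_kinner_edge_mat edge_quad_diff algebra_simps)

section \<open>Solutions of \<open>f'' = \<kappa>\<^sup>2 f\<close>\<close>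

interpretation cv2: vector_space "cscale2 :: complex \<Rightarrow> ('a \<Rightarrow> 'b \<Rightarrow> complex) \<Rightarrow> 'a \<Rightarrow> 'b \<Rightarrow> complex"
  by (rule vector_space_cscale2)

text \<open>The equation factorises: for s = \<kappa> and s = - \<kappa> the function (f' + s f) exp
  (- s x) has derivative 0, and the two constants determine f.\<close>

lemma second_order_general_solution:
  fixes f f' :: "real \<Rightarrow> complex"
  assumes \<kappa>: "\<kappa> > 0" and S: "convex S"
    and f: "\<And>x. x \<in> S \<Longrightarrow> (f has_vector_derivative f' x) (at x within S)"
    and f': "\<And>x. x \<in> S \<Longrightarrow> (f' has_vector_derivative of_real (\<kappa>\<^sup>2) * f x) (at x within S)"
  obtains \<alpha> \<beta> where "\<And>x. x \<in> S \<Longrightarrow> f x = \<alpha> * of_real (exp (\<kappa> * x)) + \<beta> * of_real (exp (- (\<kappa> * x)))"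
proof -
  have const: "\<exists>c. \<forall>x\<in>S. (f' x + of_real s * f x) * of_real (exp (- (s * x))) = c" if s: "s\<^sup>2 = \<kappa>\<^sup>2" for s :: real
  proof -
    let ?g = "\<lambda>x. (f' x + of_real s * f x) * of_real (exp (- (s * x)))"
    have "(?g has_vector_derivative 0) (at x within S)" if x: "x \<in> S" for x
    proof -
      have e: "((\<lambda>x. complex_of_real (exp (- (s * x)))) has_vector_derivative of_real (- s * exp (- (s * x)))) (at x within S)"
        by (auto intro!: has_vector_derivative_of_real derivative_eq_intros)
      have "(?g has_vector_derivative (f' x + of_real s * f x) * of_real (- s * exp (- (s * x)))
          + (of_real (\<kappa>\<^sup>2) * f x + of_real s * f' x) * of_real (exp (- (s * x)))) (at x within S)"
        by (intro has_vector_derivative_mult e has_vector_derivative_add f' has_vector_derivative_mult_right f x)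
      moreover have "(f' x + of_real s * f x) * of_real (- s * exp (- (s * x)))
          + (of_real (\<kappa>\<^sup>2) * f x + of_real s * f' x) * of_real (exp (- (s * x))) = 0"
        unfolding s[symmetric] by (simp add: algebra_simps power2_eq_square)
      ultimately show ?thesis by simp
    qed
    then show ?thesis
      by (intro has_derivative_zero_constant[OF S]) (simp add: has_vector_derivative_def)
  qed
  obtain c where c: "\<And>x. x \<in> S \<Longrightarrow> (f' x + of_real \<kappa> * f x) * of_real (exp (- (\<kappa> * x))) = c"
    using const[of \<kappa>] by auto
  obtain c' where c': "\<And>x. x \<in> S \<Longrightarrow> (f' x - of_real \<kappa> * f x) * of_real (exp (\<kappa> * x)) = c'"
    using const[of "- \<kappa>"] by auto
  have "f x = (c / (2 * of_real \<kappa>)) * of_real (exp (\<kappa> * x)) + (- c' / (2 * of_real \<kappa>)) * of_real (exp (- (\<kappa> * x)))"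
    if x: "x \<in> S" for x
  proof -
    have ee: "complex_of_real (exp (- (\<kappa> * x))) * of_real (exp (\<kappa> * x)) = 1"
      by (simp add: exp_minus flip: of_real_mult)
    have 1: "c * of_real (exp (\<kappa> * x)) = f' x + of_real \<kappa> * f x"
      unfolding c[OF x, symmetric] mult.assoc ee by simp
    have 2: "c' * of_real (exp (- (\<kappa> * x))) = f' x - of_real \<kappa> * f x"
      unfolding c'[OF x, symmetric] mult.assoc using ee by (simp add: mult.commute)
    have "c * of_real (exp (\<kappa> * x)) - c' * of_real (exp (- (\<kappa> * x))) = 2 * of_real \<kappa> * f x"
      unfolding 1 2 by simp
    then show ?thesis using \<kappa> by (simp add: field_simps)
  qed
  then show ?thesis using that by blast
qed

text \<open>The condition at 0 leaves a multiple of sinh (\<kappa> x), which is nonzero at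
  \<open>a\<close> unless the multiple is 0.\<close>

lemma Dirichlet_solution_zero:
  fixes f f' :: "real \<Rightarrow> complex"
  assumes \<kappa>: "\<kappa> > 0" and a: "a > 0"
    and f: "\<And>x. x \<in> {0..a} \<Longrightarrow> (f has_vector_derivative f' x) (at x within {0..a})"
    and f': "\<And>x. x \<in> {0..a} \<Longrightarrow> (f' has_vector_derivative of_real (\<kappa>\<^sup>2) * f x) (at x within {0..a})"
    and bc: "f 0 = 0" "f a = 0" and x: "x \<in> {0..a}"
  shows "f x = 0"
proof -
  obtain \<alpha> \<beta> where s: "\<And>x. x \<in> {0..a} \<Longrightarrow> f x = \<alpha> * of_real (exp (\<kappa> * x)) + \<beta> * of_real (exp (- (\<kappa> * x)))"
    using second_order_general_solution[OF \<kappa> _ f f'] by (metis convex_real_interval(5))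
  have \<beta>: "\<beta> = - \<alpha>" using s[of 0] bc(1) a by (simp add: eq_neg_iff_add_eq_0 add.commute)
  have "\<alpha> * of_real (exp (\<kappa> * a) - exp (- (\<kappa> * a))) = 0"
    using s[of a] bc(2) a \<beta> by (simp add: algebra_simps)
  moreover have "exp (\<kappa> * a) - exp (- (\<kappa> * a)) \<noteq> 0" using \<kappa> a by simp
  ultimately have "\<alpha> = 0" by (metis mult_eq_0_iff of_real_eq_0_iff)
  then show ?thesis using s[OF x] \<beta> by simp
qed

lemma square_integrable_no_growth:
  fixes \<alpha> \<beta> :: complex
  assumes \<kappa>: "\<kappa> > 0"
    and int: "(\<lambda>x. (cmod (\<alpha> * of_real (exp (\<kappa> * x)) + \<beta> * of_real (exp (- (\<kappa> * x)))))\<^sup>2) integrable_on {0..}"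
  shows "\<alpha> = 0"
proof (rule ccontr)
  assume "\<alpha> \<noteq> 0"
  then have \<alpha>: "cmod \<alpha> > 0" by simp
  let ?f = "\<lambda>x. (cmod (\<alpha> * of_real (exp (\<kappa> * x)) + \<beta> * of_real (exp (- (\<kappa> * x)))))\<^sup>2"
  \<comment> \<open>Beyond \<open>X\<close> the growing term is at least
    \<open>cmod \<beta> + 1\<close>, because exp y \<ge> y, and so exceeds the decaying term by at
    least 1.\<close>
  define X where "X = (cmod \<beta> + 1) / (cmod \<alpha> * \<kappa>)"
  have X: "X \<ge> 0" using \<alpha> \<kappa> by (simp add: X_def)
  have ge: "?f x \<ge> 1" if x: "x \<ge> X" for x
  proof -
    have "cmod \<beta> + 1 = cmod \<alpha> * (\<kappa> * X)" using \<alpha> \<kappa> by (simp add: X_def)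
    also have "\<dots> \<le> cmod \<alpha> * exp (\<kappa> * x)"
    proof (rule mult_left_mono)
      have "\<kappa> * X \<le> \<kappa> * x" using \<kappa> x by simp
      then show "\<kappa> * X \<le> exp (\<kappa> * x)" using exp_ge_add_one_self[of "\<kappa> * x"] by linarith
    qed simp
    finally have 1: "cmod \<beta> + 1 \<le> cmod (\<alpha> * of_real (exp (\<kappa> * x)))" by (simp add: norm_mult)
    have "exp (- (\<kappa> * x)) \<le> 1" using \<kappa> X x by simp
    then have "cmod (\<beta> * of_real (exp (- (\<kappa> * x)))) \<le> cmod \<beta>"
      using mult_left_mono[of "exp (- (\<kappa> * x))" 1 "cmod \<beta>"] by (simp add: norm_mult)
    then have "1 \<le> cmod (\<alpha> * of_real (exp (\<kappa> * x)) + \<beta> * of_real (exp (- (\<kappa> * x))))"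
      using 1 norm_diff_ineq[of "\<alpha> * of_real (exp (\<kappa> * x))" "\<beta> * of_real (exp (- (\<kappa> * x)))"] by linarith
    then show ?thesis by (simp add: one_le_power)
  qed
  have bound: "n \<le> integral {0..} ?f" if n: "n \<ge> 0" for n
  proof -
    have sub: "{X..X + n} \<subseteq> {0..}" using X by auto
    have i: "?f integrable_on {X..X + n}" by (rule integrable_on_subinterval[OF int sub])
    have "n = integral {X..X + n} (\<lambda>_. 1)" using n by simp
    also have "\<dots> \<le> integral {X..X + n} ?f"
      by (rule integral_le) (use i ge in auto)
    also have "\<dots> \<le> integral {0..} ?f"
      by (rule integral_subset_le[OF sub i int]) simp
    finally show ?thesis .
  qed
  have "integral {0..} ?f \<ge> 0" using bound[of 0] by simp
  then show False using bound[of "integral {0..} ?f + 1"] by simp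
qed

section \<open>Eigenfunctions from boundary values\<close>

fun esol :: "nat \<Rightarrow> nat \<Rightarrow> (nat \<Rightarrow> real) \<Rightarrow> real \<Rightarrow> (nat \<Rightarrow> complex) \<Rightarrow> nat + nat \<Rightarrow> real \<Rightarrow> complex" where
  "esol ne ni a \<kappa> u (Inl e) x = of_real (exp (- (\<kappa> * x))) * u e"
| "esol ne ni a \<kappa> u (Inr i) x = of_real (sinh (\<kappa> * (a i - x)) / sinh (\<kappa> * a i)) * u (ne + i)
     + of_real (sinh (\<kappa> * x) / sinh (\<kappa> * a i)) * u (ne + ni + i)"

fun esol' :: "nat \<Rightarrow> nat \<Rightarrow> (nat \<Rightarrow> real) \<Rightarrow> real \<Rightarrow> (nat \<Rightarrow> complex) \<Rightarrow> nat + nat \<Rightarrow> real \<Rightarrow> complex" where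
  "esol' ne ni a \<kappa> u (Inl e) x = of_real (- \<kappa> * exp (- (\<kappa> * x))) * u e"
| "esol' ne ni a \<kappa> u (Inr i) x = of_real (- \<kappa> * cosh (\<kappa> * (a i - x)) / sinh (\<kappa> * a i)) * u (ne + i)
     + of_real (\<kappa> * cosh (\<kappa> * x) / sinh (\<kappa> * a i)) * u (ne + ni + i)"

lemma has_vector_derivative_esol:
  "(esol ne ni a \<kappa> u j has_vector_derivative esol' ne ni a \<kappa> u j x) (at x within S)"
proof (cases j)
  case (Inl e)
  have "((\<lambda>x. complex_of_real (exp (- (\<kappa> * x))) * u e) has_vector_derivative
      of_real (- \<kappa> * exp (- (\<kappa> * x))) * u e) (at x within S)"
    by (intro has_vector_derivative_mult_left has_vector_derivative_of_real)
      (auto intro!: derivative_eq_intros)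
  then show ?thesis unfolding Inl esol.simps[abs_def] esol'.simps by simp
next
  case (Inr i)
  have "((\<lambda>x. complex_of_real (sinh (\<kappa> * (a i - x)) / sinh (\<kappa> * a i)) * u (ne + i)
     + of_real (sinh (\<kappa> * x) / sinh (\<kappa> * a i)) * u (ne + ni + i)) has_vector_derivative
      of_real (- \<kappa> * cosh (\<kappa> * (a i - x)) / sinh (\<kappa> * a i)) * u (ne + i)
     + of_real (\<kappa> * cosh (\<kappa> * x) / sinh (\<kappa> * a i)) * u (ne + ni + i)) (at x within S)"
    by (intro has_vector_derivative_add has_vector_derivative_mult_left has_vector_derivative_of_real
        DERIV_cdivide)
      (auto intro!: derivative_eq_intros)
  then show ?thesis unfolding Inr esol.simps[abs_def] esol'.simps by simp
qed

lemma has_vector_derivative_esol':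
  "(esol' ne ni a \<kappa> u j has_vector_derivative of_real (\<kappa>\<^sup>2) * esol ne ni a \<kappa> u j x) (at x within S)"
proof (cases j)
  case (Inl e)
  have "((\<lambda>x. complex_of_real (- \<kappa> * exp (- (\<kappa> * x))) * u e) has_vector_derivative
      of_real (\<kappa>\<^sup>2 * exp (- (\<kappa> * x))) * u e) (at x within S)"
    by (intro has_vector_derivative_mult_left has_vector_derivative_of_real)
      (auto intro!: derivative_eq_intros simp: power2_eq_square)
  then show ?thesis unfolding Inl esol.simps esol'.simps[abs_def] by (simp add: mult.assoc)
next
  case (Inr i)
  have "((\<lambda>x. complex_of_real (- \<kappa> * cosh (\<kappa> * (a i - x)) / sinh (\<kappa> * a i)) * u (ne + i)
     + of_real (\<kappa> * cosh (\<kappa> * x) / sinh (\<kappa> * a i)) * u (ne + ni + i)) has_vector_derivative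
      of_real (\<kappa>\<^sup>2 * sinh (\<kappa> * (a i - x)) / sinh (\<kappa> * a i)) * u (ne + i)
     + of_real (\<kappa>\<^sup>2 * sinh (\<kappa> * x) / sinh (\<kappa> * a i)) * u (ne + ni + i)) (at x within S)"
    by (intro has_vector_derivative_add has_vector_derivative_mult_left has_vector_derivative_of_real
        DERIV_cdivide)
      (auto intro!: derivative_eq_intros simp: power2_eq_square)
  then show ?thesis unfolding Inr esol.simps esol'.simps[abs_def]
    by (simp add: distrib_left mult.assoc)
qed

text \<open>Extension by 0 off the edges matches the normalisation in \<open>lap_eigenspace\<close>,
  so that eigenfunctions can be compared as functions.\<close>

definition sol :: "nat \<Rightarrow> nat \<Rightarrow> (nat \<Rightarrow> real) \<Rightarrow> real \<Rightarrow> (nat \<Rightarrow> complex) \<Rightarrow> nat + nat \<Rightarrow> real \<Rightarrow> complex" where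
  "sol ne ni a \<kappa> u j x = (if is_edge ne ni j \<and> x \<in> edge_int a j then esol ne ni a \<kappa> u j x else 0)"

lemma linear_sol: "Vector_Spaces.linear cscale cscale2 (sol ne ni a \<kappa>)"
proof (intro Vector_Spaces.linear_iff[THEN iffD2] conjI allI vector_space_cscale vector_space_cscale2)
  have "esol ne ni a \<kappa> (u + v) j x = esol ne ni a \<kappa> u j x + esol ne ni a \<kappa> v j x" for u v j x
    by (cases j) (simp_all add: fun_simps algebra_simps add_divide_distrib)
  then show "sol ne ni a \<kappa> (u + v) = sol ne ni a \<kappa> u + sol ne ni a \<kappa> v" for u v
    by (auto simp: fun_eq_iff fun_simps sol_def)
  have "esol ne ni a \<kappa> (cscale c u) j x = c * esol ne ni a \<kappa> u j x" for c u j x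
    by (cases j) (simp_all add: fun_simps algebra_simps add_divide_distrib)
  then show "sol ne ni a \<kappa> (cscale c u) = cscale2 c (sol ne ni a \<kappa> u)" for c u
    by (auto simp: fun_eq_iff sol_def cscale2_def)
qed

locale metric_graph =
  fixes ne ni :: nat and a :: "nat \<Rightarrow> real" and \<kappa> :: real
  assumes lengths: "\<forall>i<ni. a i > 0" and \<kappa>: "\<kappa> > 0"
begin

text \<open>A derivative within a set is unique only at limit points of the set; this makes
  \<open>edge_deriv\<close> computable.\<close>

lemma edge_int_not_bot:
  assumes "is_edge ne ni j" "x \<in> edge_int a j"
  shows "at x within edge_int a j \<noteq> bot"
proof -
  have c: "connected (edge_int a j)" by (cases j) (auto simp: edge_int_def)
  have "\<exists>b>0. {0, b} \<subseteq> edge_int a j"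
    using assms(1) lengths
    by (cases j) (auto simp: edge_int_def is_edge_def intro: exI[of _ 1] less_imp_le)
  then have "\<And>y. edge_int a j \<noteq> {y}" by fastforce
  then have "x islimpt edge_int a j" using connected_imp_perfect[OF c assms(2)] by blast
  then show ?thesis by (simp add: trivial_limit_within)
qed

lemma convex_edge_int: "convex (edge_int a j)"
  by (cases j) (auto simp: edge_int_def)

lemma edge_int_0: "is_edge ne ni j \<Longrightarrow> 0 \<in> edge_int a j"
  using lengths by (cases j) (auto simp: edge_int_def is_edge_def intro: less_imp_le)

lemma has_vector_derivative_sol:
  assumes "is_edge ne ni j" "x \<in> edge_int a j"
  shows "(sol ne ni a \<kappa> u j has_vector_derivative esol' ne ni a \<kappa> u j x) (at x within edge_int a j)"
  by (rule has_vector_derivative_transform[OF assms(2) _ has_vector_derivative_esol])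
    (use assms(1) in \<open>simp add: sol_def\<close>)

lemma edge_deriv_sol:
  assumes "is_edge ne ni j" "x \<in> edge_int a j"
  shows "edge_deriv a (sol ne ni a \<kappa> u) j x = esol' ne ni a \<kappa> u j x"
  unfolding edge_deriv_def
  by (rule vector_derivative_within[OF edge_int_not_bot[OF assms] has_vector_derivative_sol[OF assms]])

lemma bval_sol:
  assumes "Kvec (Kdim ne ni) u"
  shows "bval ne ni a (sol ne ni a \<kappa> u) = u"
proof
  fix k
  show "bval ne ni a (sol ne ni a \<kappa> u) k = u k"
  proof (cases "k < Kdim ne ni")
    case True
    then show ?thesis
    proof (cases rule: Kdim_cases)
      case external
      then show ?thesis by (simp add: bval_def sol_def is_edge_def edge_int_def)
    next
      case (initial i)
      moreover have "sinh (\<kappa> * a i) \<noteq> 0" using initial(1) lengths \<kappa> by force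
      ultimately show ?thesis using lengths
        by (auto simp: bval_def sol_def is_edge_def edge_int_def less_imp_le)
    next
      case (terminal i)
      moreover have "sinh (\<kappa> * a i) \<noteq> 0" using terminal(1) lengths \<kappa> by force
      ultimately show ?thesis using lengths
        by (auto simp: bval_def sol_def is_edge_def edge_int_def less_imp_le)
    qed
  next
    case False
    then show ?thesis using assms by (simp add: bval_def Kvec_def Kdim_def)
  qed
qed

text \<open>At half of \<kappa> times the edge length, these turn the symmetric and antisymmetric
  eigenvalues of \<open>DN\<close> into the coefficients obtained by differentiating
  \<open>esol\<close>.\<close>

lemma half_angle:
  assumes "y > (0::real)"
  shows "(tanh y + 1 / tanh y) / 2 = cosh (2 * y) / sinh (2 * y)"
    and "(1 / tanh y - tanh y) / 2 = 1 / sinh (2 * y)"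
proof -
  have s: "sinh y \<noteq> 0" "cosh y \<noteq> 0" using assms by auto
  show "(tanh y + 1 / tanh y) / 2 = cosh (2 * y) / sinh (2 * y)"
    unfolding tanh_def sinh_double cosh_double using s by (simp add: field_simps power2_eq_square)
  have "(1 / tanh y - tanh y) / 2 = ((cosh y)\<^sup>2 - (sinh y)\<^sup>2) / (2 * sinh y * cosh y)"
    using s by (simp add: tanh_def field_simps power2_eq_square)
  then show "(1 / tanh y - tanh y) / 2 = 1 / sinh (2 * y)"
    by (simp add: cosh_square_eq sinh_double)
qed

lemma dval_sol: "dval ne ni a (sol ne ni a \<kappa> u) = mv (Kdim ne ni) (DN ne ni a \<kappa>) u"
proof
  fix k
  have c: "(- (\<kappa> * tanh (\<kappa> * a i / 2)) + - antisym_rate \<kappa> (a i)) / 2 = - \<kappa> * cosh (\<kappa> * a i) / sinh (\<kappa> * a i)"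
    "(- (\<kappa> * tanh (\<kappa> * a i / 2)) - - antisym_rate \<kappa> (a i)) / 2 = \<kappa> / sinh (\<kappa> * a i)" if "i < ni" for i
  proof -
    have "\<kappa> * a i / 2 > 0" using that lengths \<kappa> by simp
    note h = half_angle[OF this]
    have "(- (\<kappa> * tanh (\<kappa> * a i / 2)) + - antisym_rate \<kappa> (a i)) / 2
        = - \<kappa> * ((tanh (\<kappa> * a i / 2) + 1 / tanh (\<kappa> * a i / 2)) / 2)"
      using \<kappa> by (simp add: antisym_rate_def algebra_simps)
    then show "(- (\<kappa> * tanh (\<kappa> * a i / 2)) + - antisym_rate \<kappa> (a i)) / 2 = - \<kappa> * cosh (\<kappa> * a i) / sinh (\<kappa> * a i)"
      by (simp add: h(1))
    have "(- (\<kappa> * tanh (\<kappa> * a i / 2)) - - antisym_rate \<kappa> (a i)) / 2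
        = \<kappa> * ((1 / tanh (\<kappa> * a i / 2) - tanh (\<kappa> * a i / 2)) / 2)"
      using \<kappa> by (simp add: antisym_rate_def algebra_simps)
    then show "(- (\<kappa> * tanh (\<kappa> * a i / 2)) - - antisym_rate \<kappa> (a i)) / 2 = \<kappa> / sinh (\<kappa> * a i)"
      by (simp add: h(2))
  qed
  show "dval ne ni a (sol ne ni a \<kappa> u) k = mv (Kdim ne ni) (DN ne ni a \<kappa>) u k"
  proof (cases "k < Kdim ne ni")
    case True
    then show ?thesis
    proof (cases rule: Kdim_cases)
      case external
      then have "is_edge ne ni (Inl k)" by (simp add: is_edge_def)
      then show ?thesis using external
        by (simp add: dval_def DN_def mv_edge_mat_external edge_deriv_sol edge_int_0)
    next
      case (initial i)
      then have "is_edge ne ni (Inr i)" by (simp add: is_edge_def)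
      then show ?thesis using initial(1) unfolding initial(2) DN_def mv_edge_mat_initial[OF initial(1)] c[OF initial(1)]
        by (simp add: dval_def edge_deriv_sol edge_int_0)
    next
      case (terminal i)
      then have e: "is_edge ne ni (Inr i)" "a i \<in> edge_int a (Inr i)"
        using lengths by (auto simp: is_edge_def edge_int_def less_imp_le)
      then show ?thesis using terminal(1) unfolding terminal(2) DN_def mv_edge_mat_terminal[OF terminal(1)] c[OF terminal(1)]
        by (simp add: dval_def edge_deriv_sol)
    qed
  next
    case False
    then show ?thesis by (simp add: dval_def mv_def Kdim_def)
  qed
qed

lemma square_integrable_sol:
  assumes "is_edge ne ni j"
  shows "(\<lambda>x. (cmod (sol ne ni a \<kappa> u j x))\<^sup>2) integrable_on edge_int a j"
proof (cases j)
  case (Inl e)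
  have "(\<lambda>x. exp (- (2 * \<kappa>) * x) * (cmod (u e))\<^sup>2) integrable_on {0..}"
    using \<kappa> by (intro integrable_on_mult_left integrable_on_exp_minus_to_infinity) simp
  moreover have "exp (- (2 * \<kappa>) * x) * (cmod (u e))\<^sup>2 = (cmod (sol ne ni a \<kappa> u j x))\<^sup>2" if "x \<in> {0..}" for x
  proof -
    have "exp (- (2 * \<kappa>) * x) = (exp (- (\<kappa> * x)))\<^sup>2"
      by (simp add: power2_eq_square flip: exp_add)
    then show ?thesis
      using that assms Inl by (simp add: edge_int_def sol_def norm_mult power_mult_distrib)
  qed
  ultimately have "(\<lambda>x. (cmod (sol ne ni a \<kappa> u j x))\<^sup>2) integrable_on {0..}"
    by (rule integrable_eq)
  then show ?thesis using Inl by (simp add: edge_int_def)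
next
  case (Inr i)
  have "continuous_on (edge_int a j) (sol ne ni a \<kappa> u j)"
    by (rule continuous_on_vector_derivative[OF has_vector_derivative_sol[OF assms]])
  then have "continuous_on {0..a i} (\<lambda>x. (cmod (sol ne ni a \<kappa> u j x))\<^sup>2)"
    using Inr by (intro continuous_intros) (simp add: edge_int_def)
  then show ?thesis using Inr by (simp add: edge_int_def integrable_continuous_interval)
qed

lemma sol_in_eigenspace:
  assumes "Kvec (Kdim ne ni) u"
    and "mv (Kdim ne ni) A u + mv (Kdim ne ni) B (mv (Kdim ne ni) (DN ne ni a \<kappa>) u) = 0"
  shows "sol ne ni a \<kappa> u \<in> lap_eigenspace ne ni a A B (- (\<kappa>\<^sup>2))"
proof -
  let ?\<psi> = "sol ne ni a \<kappa> u"
  have "(edge_deriv a ?\<psi> j has_vector_derivative - of_real (- (\<kappa>\<^sup>2)) * ?\<psi> j x) (at x within edge_int a j)"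
    if "is_edge ne ni j" "x \<in> edge_int a j" for j x
  proof (rule has_vector_derivative_transform[OF that(2)])
    show "edge_deriv a ?\<psi> j y = esol' ne ni a \<kappa> u j y" if "y \<in> edge_int a j" for y
      using edge_deriv_sol \<open>is_edge ne ni j\<close> that by blast
    show "(esol' ne ni a \<kappa> u j has_vector_derivative - of_real (- (\<kappa>\<^sup>2)) * ?\<psi> j x) (at x within edge_int a j)"
      using has_vector_derivative_esol'[of ne ni a \<kappa> u j x] that by (simp add: sol_def)
  qed
  moreover have "?\<psi> j differentiable (at x within edge_int a j)"
    if "is_edge ne ni j" "x \<in> edge_int a j" for j x
    using has_vector_derivative_sol[OF that] by (rule differentiableI_vector)
  moreover have "mv (Kdim ne ni) A (bval ne ni a ?\<psi>) + mv (Kdim ne ni) B (dval ne ni a ?\<psi>) = (\<lambda>_. 0)"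
    using assms(2) by (simp add: bval_sol[OF assms(1)] dval_sol zero_fun_def)
  ultimately show ?thesis
    unfolding lap_eigenspace_def using square_integrable_sol by (auto simp: sol_def)
qed

text \<open>On an external edge square integrability excludes the growing exponential. On an
  internal edge the difference to \<open>esol\<close> has zero end values and so vanishes.\<close>

lemma eigenfunction_is_sol:
  assumes "\<psi> \<in> lap_eigenspace ne ni a A B lam" and lam: "lam = - (\<kappa>\<^sup>2)"
  shows "\<psi> = sol ne ni a \<kappa> (bval ne ni a \<psi>)"
proof (intro ext)
  fix j x
  let ?u = "bval ne ni a \<psi>"
  let ?S = "edge_int a j"
  show "\<psi> j x = sol ne ni a \<kappa> ?u j x"
  proof (cases "is_edge ne ni j \<and> x \<in> ?S")
    case False
    moreover have "\<psi> j x = 0"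
    proof (cases "is_edge ne ni j")
      case True
      then show ?thesis using False assms(1) by (simp add: lap_eigenspace_def)
    next
      case False
      then show ?thesis using assms(1) by (simp add: lap_eigenspace_def)
    qed
    ultimately show ?thesis by (auto simp: sol_def)
  next
    case True
    then have j: "is_edge ne ni j" and x: "x \<in> ?S" by auto
    have d1: "(\<psi> j has_vector_derivative edge_deriv a \<psi> j y) (at y within ?S)" if "y \<in> ?S" for y
      using assms j that by (simp add: lap_eigenspace_def edge_deriv_def flip: vector_derivative_works)
    have d2: "(edge_deriv a \<psi> j has_vector_derivative of_real (\<kappa>\<^sup>2) * \<psi> j y) (at y within ?S)" if "y \<in> ?S" for y
      using assms j that by (simp add: lap_eigenspace_def)
    have int: "(\<lambda>x. (cmod (\<psi> j x))\<^sup>2) integrable_on ?S"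
      using assms j by (simp add: lap_eigenspace_def)
    have "\<psi> j x = esol ne ni a \<kappa> ?u j x"
    proof (cases j)
      case (Inl e)
      then have S: "?S = {0..}" and e: "e < ne" using j by (auto simp: edge_int_def is_edge_def)
      obtain \<alpha> \<beta> where s: "\<And>x. x \<in> ?S \<Longrightarrow> \<psi> j x = \<alpha> * of_real (exp (\<kappa> * x)) + \<beta> * of_real (exp (- (\<kappa> * x)))"
        using second_order_general_solution[OF \<kappa> convex_edge_int d1 d2] by blast
      have "(\<lambda>x. (cmod (\<alpha> * of_real (exp (\<kappa> * x)) + \<beta> * of_real (exp (- (\<kappa> * x)))))\<^sup>2) integrable_on {0..}"
        by (rule integrable_eq[OF int[unfolded S]]) (simp add: s S)
      then have "\<alpha> = 0" by (rule square_integrable_no_growth[OF \<kappa>])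
      moreover have "?u e = \<beta>" using s[of 0] \<open>\<alpha> = 0\<close> e S Inl by (simp add: bval_def)
      ultimately show ?thesis using s[OF x] Inl by (simp add: mult.commute)
    next
      case (Inr i)
      then have S: "?S = {0..a i}" and i: "i < ni" using j by (auto simp: edge_int_def is_edge_def)
      have ai: "a i > 0" using i lengths by simp
      then have sh: "sinh (\<kappa> * a i) \<noteq> 0" using \<kappa> by simp
      have "\<psi> j x - esol ne ni a \<kappa> ?u j x = 0"
      proof (rule Dirichlet_solution_zero[OF \<kappa> ai, where f = "\<lambda>x. \<psi> j x - esol ne ni a \<kappa> ?u j x"
            and f' = "\<lambda>x. edge_deriv a \<psi> j x - esol' ne ni a \<kappa> ?u j x"])
        fix y assume y: "y \<in> {0..a i}"
        then show "((\<lambda>x. \<psi> j x - esol ne ni a \<kappa> ?u j x) has_vector_derivative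
            edge_deriv a \<psi> j y - esol' ne ni a \<kappa> ?u j y) (at y within {0..a i})"
          using d1 has_vector_derivative_esol unfolding S by (intro has_vector_derivative_diff) auto
        have "((\<lambda>x. edge_deriv a \<psi> j x - esol' ne ni a \<kappa> ?u j x) has_vector_derivative
            of_real (\<kappa>\<^sup>2) * \<psi> j y - of_real (\<kappa>\<^sup>2) * esol ne ni a \<kappa> ?u j y) (at y within {0..a i})"
          using y d2 has_vector_derivative_esol' unfolding S by (intro has_vector_derivative_diff) auto
        then show "((\<lambda>x. edge_deriv a \<psi> j x - esol' ne ni a \<kappa> ?u j x) has_vector_derivative
            of_real (\<kappa>\<^sup>2) * (\<psi> j y - esol ne ni a \<kappa> ?u j y)) (at y within {0..a i})"
          by (simp add: right_diff_distrib)
      qed (use x S i sh Inr in \<open>auto simp: bval_def\<close>)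
      then show ?thesis by simp
    qed
    then show ?thesis using j x by (simp add: sol_def)
  qed
qed

lemma Kvec_bval: "Kvec (Kdim ne ni) (bval ne ni a \<psi>)"
  by (simp add: Kvec_def bval_def Kdim_def)

lemma lap_eigenspace_eq:
  "lap_eigenspace ne ni a A B (- (\<kappa>\<^sup>2)) = sol ne ni a \<kappa> `
    {u. Kvec (Kdim ne ni) u \<and> mv (Kdim ne ni) A u + mv (Kdim ne ni) B (mv (Kdim ne ni) (DN ne ni a \<kappa>) u) = 0}"
    (is "?E = sol ne ni a \<kappa> ` ?U")
proof
  show "sol ne ni a \<kappa> ` ?U \<subseteq> ?E" using sol_in_eigenspace by blast
  show "?E \<subseteq> sol ne ni a \<kappa> ` ?U"
  proof
    fix \<psi> assume \<psi>: "\<psi> \<in> ?E"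
    let ?u = "bval ne ni a \<psi>"
    have eq: "\<psi> = sol ne ni a \<kappa> ?u" using eigenfunction_is_sol[OF \<psi> refl] .
    have "dval ne ni a \<psi> = mv (Kdim ne ni) (DN ne ni a \<kappa>) ?u" using dval_sol eq by metis
    then have "mv (Kdim ne ni) A ?u + mv (Kdim ne ni) B (mv (Kdim ne ni) (DN ne ni a \<kappa>) ?u) = 0"
      using \<psi> by (simp add: lap_eigenspace_def zero_fun_def)
    then show "\<psi> \<in> sol ne ni a \<kappa> ` ?U" using eq Kvec_bval by blast
  qed
qed

lemma inj_on_sol: "inj_on (sol ne ni a \<kappa>) {u. Kvec (Kdim ne ni) u}"
  by (rule inj_on_inverseI[where g = "bval ne ni a"]) (simp add: bval_sol)

text \<open>Solutions depend linearly and injectively on their boundary values, so multiplicities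
  can be computed among boundary vectors.\<close>

lemma lap_mult_eq:
  assumes "{u. Kvec (Kdim ne ni) u \<and> mv (Kdim ne ni) A u + mv (Kdim ne ni) B (mv (Kdim ne ni) (DN ne ni a \<kappa>) u) = 0} = U"
    and "cv.subspace U"
  shows "lap_mult ne ni a A B (- (\<kappa>\<^sup>2)) = cdim U"
proof -
  interpret T: Vector_Spaces.linear cscale cscale2 "sol ne ni a \<kappa>" by (rule linear_sol)
  have U: "U \<subseteq> {u. Kvec (Kdim ne ni) u}" using assms(1) by blast
  obtain F where F: "F \<subseteq> U" "cv.independent F" "U \<subseteq> cspan F" "card F = cdim U"
    by (rule cv.basis_exists)
  have FU: "cspan F = U" using F assms(2) cv.span_minimal by blast
  have inj: "inj_on (sol ne ni a \<kappa>) (cspan F)"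
    unfolding FU using inj_on_sol U by (rule inj_on_subset)
  have "cv2.independent (sol ne ni a \<kappa> ` F)"
    by (rule T.independent_injective_image[OF F(2) inj])
  moreover have "card (sol ne ni a \<kappa> ` F) = cdim U"
    using card_image[OF inj_on_subset[OF inj cv.span_superset]] F(4) by simp
  moreover have "cv2.span (sol ne ni a \<kappa> ` F) = sol ne ni a \<kappa> ` U"
    by (simp add: T.span_image FU)
  ultimately have "cdim2 (sol ne ni a \<kappa> ` U) = cdim U"
    using cv2.dim_span_eq_card_independent by metis
  then show ?thesis by (simp add: lap_mult_def lap_eigenspace_eq assms(1))
qed

end

section \<open>Counting eigenvalues\<close>

text \<open>One half of min-max. If \<open>S\<close> were larger, some nonzero \<open>v\<close> in
  its span would be orthogonal to all eigenspaces for \<open>T\<close>. Maximising over the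
  complement of these eigenspaces gives an eigenvector \<open>u\<close> there whose eigenvalue
  bounds the Rayleigh quotient of \<open>v\<close>; by \<open>top\<close> it belongs to
  \<open>T\<close>, so \<open>u\<close> is orthogonal to itself.\<close>

lemma card_le_sum_dim_eigenspaces:
  fixes h :: "(nat \<Rightarrow> complex) \<Rightarrow> (nat \<Rightarrow> complex) \<Rightarrow> complex" and d :: nat and N
  defines "E \<equiv> \<lambda>l. radical (\<lambda>x y. h x y - of_real l * kinner d x y) (perp d N)"
  assumes h: "hermitian_form h" and cont: "continuous_on UNIV (\<lambda>x. h x x)"
    and S: "finite S" "S \<subseteq> perp d N" "cv.independent S" and T: "finite T"
    and top: "\<And>v \<mu>. v \<in> cspan S \<Longrightarrow> v \<noteq> 0 \<Longrightarrow> Re (h v v) \<le> \<mu> * ksq d v \<Longrightarrow> \<mu> \<in> T \<or> E \<mu> = {0}"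
  shows "card S \<le> (\<Sum>l\<in>T. cdim (E l))"
proof (rule ccontr)
  assume less: "\<not> ?thesis"
  have subE: "cv.subspace (E l)" for l
    unfolding E_def
    by (intro subspace_radical hermitian_form_subtract_scale h hermitian_form_kinner subspace_perp)
  have EW: "E l \<subseteq> perp d N" for l by (auto simp: E_def radical_def)
  then have KE: "Kvec d x" if "x \<in> E l" for l x using that by (auto simp: perp_def)
  have "\<exists>F. finite F \<and> cspan F = E l \<and> card F = cdim (E l)" for l
    by (rule subspace_basis[OF subE KE, of l]) auto
  then obtain F where F: "\<And>l. finite (F l)" "\<And>l. cspan (F l) = E l" "\<And>l. card (F l) = cdim (E l)"
    by metis
  have FE: "F l \<subseteq> E l" for l using F(2) cv.span_superset by blast
  let ?F = "\<Union>l\<in>T. F l"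
  have "card ?F \<le> (\<Sum>l\<in>T. card (F l))" by (rule card_UN_le[OF T])
  then have "card ?F < card S" using less F(3) by simp
  moreover have finF: "finite ?F" using T F(1) by blast
  ultimately obtain v where v: "v \<in> cspan S" "v \<noteq> 0" "\<And>f. f \<in> ?F \<Longrightarrow> kinner d v f = 0"
    using exists_orthogonal_in_span[OF S(3,1)] by metis
  have vW: "v \<in> perp d N" using v(1) cv.span_minimal[OF S(2) subspace_perp] by blast
  have FW: "?F \<subseteq> perp d N" using FE EW by blast
  have eig: "\<exists>c. \<forall>w\<in>perp d N. h f w = c * kinner d f w" if f: "f \<in> ?F" for f
  proof -
    obtain l where "f \<in> E l" using f FE by blast
    then have "\<forall>w\<in>perp d N. h f w = of_real l * kinner d f w" by (simp add: E_def radical_def)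
    then show ?thesis by blast
  qed
  obtain u \<mu> where u: "u \<in> perp d N" "u \<noteq> 0" "\<And>f. f \<in> ?F \<Longrightarrow> kinner d u f = 0"
    "Re (h v v) \<le> \<mu> * ksq d v" "\<And>w. w \<in> perp d N \<Longrightarrow> h u w = of_real \<mu> * kinner d u w"
    using eigenvector_orthogonal_to_eigenvectors[OF h cont finF FW eig vW v(2,3)] by metis
  have uE: "u \<in> E \<mu>" using u(1,5) by (simp add: E_def radical_def)
  then have "\<mu> \<in> T" using top[OF v(1,2) u(4)] u(2) by blast
  then have "kinner d u f = 0" if "f \<in> F \<mu>" for f using that u(3) by blast
  moreover have "u \<in> cspan (F \<mu>)" using uE F(2) by simp
  ultimately have "kinner d u u = 0" by (rule kinner_span_right[rotated])
  then show False using u(1,2) by (simp add: perp_def kinner_self_eq_0)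
qed

section \<open>Multiplicities and positions in descending lists\<close>

lemma sum_count_list: "finite T \<Longrightarrow> (\<Sum>r\<in>T. count_list xs r) = length (filter (\<lambda>x. x \<in> T) xs)"
proof (induction xs)
  case (Cons x xs)
  have "(\<Sum>r\<in>T. count_list (x # xs) r) = (\<Sum>r\<in>T. count_list xs r + (if r = x then 1 else 0))"
    by (rule sum.cong) auto
  also have "\<dots> = (\<Sum>r\<in>T. count_list xs r) + (if x \<in> T then 1 else 0)"
    using Cons.prems by (simp add: sum.distrib)
  finally show ?case using Cons by simp
qed simp

lemma descending_nth:
  "sorted_wrt (\<ge>) (xs :: real list) \<Longrightarrow> i \<le> j \<Longrightarrow> j < length xs \<Longrightarrow> xs ! j \<le> xs ! i"
  by (cases "i = j") (auto simp: sorted_wrt_iff_nth_less)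

lemma length_filter_ge_nth:
  assumes "sorted_wrt (\<ge>) (xs :: real list)" "i < length xs"
  shows "i + 1 \<le> length (filter (\<lambda>x. x \<ge> xs ! i) xs)"
proof -
  have "card {..i} \<le> card {j. j < length xs \<and> xs ! j \<ge> xs ! i}"
    by (rule card_mono) (use assms descending_nth in auto)
  then show ?thesis by (simp add: length_filter_conv_card)
qed

lemma length_filter_le_nth:
  assumes "sorted_wrt (\<ge>) (xs :: real list)" "i < length xs"
  shows "length xs - i \<le> length (filter (\<lambda>x. x \<le> xs ! i) xs)"
proof -
  have "card {i..<length xs} \<le> card {j. j < length xs \<and> xs ! j \<le> xs ! i}"
    by (rule card_mono) (use assms descending_nth in auto)
  then show ?thesis by (simp add: length_filter_conv_card)
qed

lemma nth_ge_if_length_filter: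
  assumes "sorted_wrt (\<ge>) (xs :: real list)" "i < length xs"
    and "i + 1 \<le> length (filter (\<lambda>x. x \<ge> c) xs)"
  shows "xs ! i \<ge> c"
proof (rule ccontr)
  assume n: "\<not> ?thesis"
  have "j < i" if "j < length xs" "xs ! j \<ge> c" for j
    using descending_nth[OF assms(1), of i j] that n by (cases "j < i") auto
  then have "card {j. j < length xs \<and> xs ! j \<ge> c} \<le> card {..<i}"
    by (intro card_mono) auto
  then show False using assms(3) by (simp add: length_filter_conv_card)
qed

lemma span_dvec_iff:
  "u \<in> cspan {dvec ne ni i | i. i < ni \<and> a i = amin} \<longleftrightarrow>
    Kvec (Kdim ne ni) u \<and> (\<forall>e<ne. u e = 0) \<and>
    (\<forall>i<ni. u (ne + ni + i) = - u (ne + i) \<and> (a i \<noteq> amin \<longrightarrow> u (ne + i) = 0))"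
    (is "u \<in> cspan ?D \<longleftrightarrow> ?P u")
proof
  have "cspan ?D \<subseteq> Collect ?P"
  proof (rule cv.span_minimal)
    show "?D \<subseteq> Collect ?P" by (auto simp: dvec_def Kvec_def Kdim_def)
    show "cv.subspace (Collect ?P)"
      unfolding cv.subspace_def
      by (auto simp: fun_simps Kvec_add Kvec_cscale)
  qed
  then show "u \<in> cspan ?D \<Longrightarrow> ?P u" by blast
next
  assume P: "?P u"
  let ?I = "{i. i < ni \<and> a i = amin}"
  let ?v = "\<Sum>i\<in>?I. cscale (u (ne + i)) (dvec ne ni i)"
  have ap: "(\<Sum>i\<in>I. cscale (c i) (f i)) k = (\<Sum>i\<in>I. c i * f i k)" if "finite I"
    for I :: "nat set" and c :: "nat \<Rightarrow> complex" and f :: "nat \<Rightarrow> nat \<Rightarrow> complex" and k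
    using that by (induction I rule: finite_induct) (auto simp: fun_simps)
  have fin: "finite ?I" by simp
  have "u k = ?v k" for k
  proof -
    have v: "?v k = (\<Sum>i\<in>?I. u (ne + i) * dvec ne ni i k)" by (rule ap[OF fin])
    show ?thesis
    proof (cases "k < Kdim ne ni")
      case True
      then show ?thesis
      proof (cases rule: Kdim_cases)
        case external
        then show ?thesis unfolding v using P by (simp add: dvec_def)
      next
        case (initial j)
        have "(\<Sum>i\<in>?I. u (ne + i) * dvec ne ni i k) = (\<Sum>i\<in>?I. if i = j then u (ne + i) else 0)"
          by (rule sum.cong) (use initial in \<open>auto simp: dvec_def\<close>)
        then show ?thesis unfolding v using P initial by (auto simp: sum.delta[OF fin])
      next
        case (terminal j)
        have "(\<Sum>i\<in>?I. u (ne + i) * dvec ne ni i k) = (\<Sum>i\<in>?I. if i = j then - u (ne + i) else 0)"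
          by (rule sum.cong) (use terminal in \<open>auto simp: dvec_def\<close>)
        then show ?thesis unfolding v using P terminal by (auto simp: sum.delta[OF fin])
      qed
    next
      case False
      then have "(\<Sum>i\<in>?I. u (ne + i) * dvec ne ni i k) = 0"
        by (intro sum.neutral) (auto simp: dvec_def Kdim_def)
      then show ?thesis unfolding v using False P by (simp add: Kvec_def)
    qed
  qed
  then have "u = ?v" by (rule ext)
  also have "?v \<in> cspan ?D"
    by (intro cv.span_sum cv.span_scale cv.span_base) auto
  finally show "u \<in> cspan ?D" .
qed

section \<open>Comparison of the forms at different energies\<close>

locale graph_laplacian = vertex_condition "Kdim ne ni" A B
  for ne ni :: nat and a :: "nat \<Rightarrow> real" and A B +
  assumes internal: "ni \<ge> 1" and lengths: "\<forall>i<ni. a i > 0"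
begin

abbreviation "d \<equiv> Kdim ne ni"
abbreviation "amin \<equiv> Min (a ` {..<ni})"

text \<open>\<open>q t\<close> is the form of \<open>L + P\<^sup>\<bottom> M(t) P\<^sup>\<bottom>\<close> on the range of \<open>P\<^sup>\<bottom>\<close>.\<close>

definition q :: "real \<Rightarrow> (nat \<Rightarrow> complex) \<Rightarrow> (nat \<Rightarrow> complex) \<Rightarrow> complex" where
  "q t = qform (DN ne ni a t)"

text \<open>As a family in \<open>l\<close> this is strictly decreasing like \<open>q\<close>, so
  the same counting applies to the eigenvalues of L(0,a).\<close>

definition L0_form :: "real \<Rightarrow> (nat \<Rightarrow> complex) \<Rightarrow> (nat \<Rightarrow> complex) \<Rightarrow> complex" where
  "L0_form l = (\<lambda>x y. q 0 x y - of_real l * kinner d x y)"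

lemma amin_pos: "amin > 0" and amin_le: "i < ni \<Longrightarrow> amin \<le> a i"
proof -
  have "a ` {..<ni} \<noteq> {}" using internal by (auto simp: lessThan_empty_iff)
  then show "amin > 0" using lengths by (subst Min_gr_iff) auto
  show "i < ni \<Longrightarrow> amin \<le> a i" by simp
qed

lemma hermitian_form_q: "hermitian_form (q t)"
  unfolding q_def by (rule hermitian_form_qform) (simp add: DN_def edge_mat_hermitian[symmetric])

lemma hermitian_form_L0_form: "hermitian_form (L0_form l)"
  unfolding L0_form_def
  by (rule hermitian_form_subtract_scale[OF hermitian_form_q hermitian_form_kinner])

lemma Re_q_diff:
  "Re (q s u u) - Re (q t u u) =
    edge_quad ne ni (t - s) (\<lambda>i. t * tanh (t * a i / 2) - s * tanh (s * a i / 2))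
       (\<lambda>i. antisym_rate t (a i) - antisym_rate s (a i)) u"
  by (simp add: q_def qform_eq Re_kinner_DN_diff[symmetric])

lemma q_decreasing:
  assumes "0 \<le> s" "s < t" "u \<in> W" "u \<noteq> 0"
  shows "Re (q t u u) < Re (q s u u)"
proof -
  have "0 < Re (q s u u) - Re (q t u u)"
    unfolding Re_q_diff
    by (rule edge_quad_pos)
      (use assms lengths mult_tanh_strict_mono antisym_rate_strict_mono Kvec_ranPperp in auto)
  then show ?thesis by simp
qed

lemma L0_form_decreasing:
  assumes "s < t" "u \<in> W" "u \<noteq> 0"
  shows "Re (L0_form t u u) < Re (L0_form s u u)"
  using assms ksq_pos[OF Kvec_ranPperp[OF assms(2)] assms(3)]
  by (simp add: L0_form_def kinner_self)

lemma Re_q_gap: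
  assumes "t > 0"
  shows "Re (q 0 u u) - Re (q t u u) - c * ksq d u =
    edge_quad ne ni (t - c) (\<lambda>i. t * tanh (t * a i / 2) - c) (\<lambda>i. eta_inv t (a i) - c) u"
  by (simp add: Re_q_diff ksq_eq_edge_quad edge_quad_scale edge_quad_diff eta_inv_def antisym_rate_def)

lemma eta_inv_amin_le:
  assumes "t > 0" "i < ni"
  shows "eta_inv t amin \<le> eta_inv t (a i)"
  using eta_inv_mono_length[OF amin_pos _ assms(1), of "a i"] amin_le[OF assms(2)]
  by (cases "amin = a i") (auto intro: less_imp_le)

lemma eta_inv_amin_less_tanh:
  assumes "t > 0" "i < ni"
  shows "eta_inv t amin < t * tanh (t * a i / 2)"
  using eta_inv_amin_le[OF assms] eta_inv_less(2)[of "a i" t] lengths assms by fastforce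

text \<open>The smallest eigenvalue of M(0) - M(t) is the antisymmetric one on a shortest
  edge.\<close>

lemma q_gap_ge:
  assumes "t > 0"
  shows "eta_inv t amin * ksq d u \<le> Re (q 0 u u) - Re (q t u u)"
proof -
  have "0 \<le> Re (q 0 u u) - Re (q t u u) - eta_inv t amin * ksq d u"
    unfolding Re_q_gap[OF assms]
    by (rule edge_quad_nonneg)
      (use assms eta_inv_less(1)[OF amin_pos assms] eta_inv_amin_less_tanh[OF assms]
        eta_inv_amin_le[OF assms] in \<open>auto intro: less_imp_le\<close>)
  then show ?thesis by simp
qed

text \<open>No eigenvalue of M(0) - M(t) exceeds \<open>t\<close>, the one on external
  edges.\<close>

lemma q_gap_le:
  assumes "t > 0"
  shows "Re (q 0 u u) - Re (q t u u) \<le> t * ksq d u"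
proof -
  have "t * ksq d u - (Re (q 0 u u) - Re (q t u u)) =
      edge_quad ne ni 0 (\<lambda>i. t - t * tanh (t * a i / 2)) (\<lambda>i. t - eta_inv t (a i)) u"
    by (simp add: Re_q_diff ksq_eq_edge_quad edge_quad_scale edge_quad_diff eta_inv_def antisym_rate_def)
  also have "\<dots> \<ge> 0"
  proof (rule edge_quad_nonneg)
    show "t - t * tanh (t * a i / 2) \<ge> 0" for i
      using tanh_real_lt_1[of "t * a i / 2"] assms by (simp add: mult_le_cancel_left2)
    show "t - eta_inv t (a i) \<ge> 0" if "i < ni" for i
      using eta_inv_less(1)[of "a i" t] lengths that assms by (simp add: less_imp_le)
  qed simp
  finally show ?thesis by simp
qed

lemma L0_eigenspace_eq: "L0_eigenspace ne ni a A B l = radical (L0_form l) W"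
  unfolding L0_eigenspace_def L0_def mv_Mmat L0_form_def q_def
  by (rule compression_eigenspace_iff_radical)

lemma L0_mult_eq: "L0_mult ne ni a A B l = cdim (radical (L0_form l) W)"
  by (simp add: L0_mult_def L0_eigenspace_eq)

lemma lap_mult_eq_radical:
  assumes "\<kappa> > 0"
  shows "lap_mult ne ni a A B (- (\<kappa>\<^sup>2)) = cdim (radical (q \<kappa>) W)"
proof -
  interpret metric_graph ne ni a \<kappa> using assms lengths by unfold_locales
  show ?thesis
    unfolding q_def
    by (rule lap_mult_eq[OF boundary_condition_iff_radical])
      (use subspace_radical[OF hermitian_form_q subspace_ranPperp] in \<open>simp add: q_def\<close>)
qed

lemma radical_eq_0_iff:
  assumes "hermitian_form h"
  shows "cdim (radical h W) = 0 \<longleftrightarrow> radical h W = {0}"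
  by (rule subspace_dim_eq_0[where d = d, OF subspace_radical[OF assms subspace_ranPperp]])
    (auto simp: radical_def Kvec_ranPperp)

lemma W_eq_perp: "W = perp d (kerB d B)"
  by (rule ranPperp_eq_perp)

lemma continuous_on_q: "continuous_on UNIV (\<lambda>x. q t x x)"
  unfolding q_def by (rule continuous_on_qform)

end

section \<open>The two eigenvalue estimates and the case of equality\<close>

locale graph_laplacian_spectrum = graph_laplacian ne ni a A B
  for ne ni :: nat and a :: "nat \<Rightarrow> real" and A B +
  fixes ks ls :: "real list"
  assumes ks_sorted: "sorted_wrt (\<ge>) ks" and ks_pos: "\<forall>\<kappa>\<in>set ks. \<kappa> > 0"
    and ks_mult: "\<forall>\<kappa>>0. count_list ks \<kappa> = lap_mult ne ni a A B (- (\<kappa>\<^sup>2))"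
    and ls_sorted: "sorted_wrt (\<ge>) ls" and ls_pos: "\<forall>l\<in>set ls. l > 0"
    and ls_mult: "\<forall>l>0. count_list ls l = L0_mult ne ni a A B l"
    and same_n: "length ks = length ls"
begin

lemma sum_dim_radical_q:
  assumes "finite T" "T \<subseteq> {0<..}"
  shows "(\<Sum>r\<in>T. cdim (radical (q r) W)) = length (filter (\<lambda>x. x \<in> T) ks)"
proof -
  have "(\<Sum>r\<in>T. cdim (radical (q r) W)) = (\<Sum>r\<in>T. count_list ks r)"
    by (rule sum.cong) (use assms ks_mult lap_mult_eq_radical in auto)
  then show ?thesis using assms(1) by (simp add: sum_count_list)
qed

lemma sum_dim_radical_L0:
  assumes "finite T" "T \<subseteq> {0<..}"
  shows "(\<Sum>r\<in>T. cdim (radical (L0_form r) W)) = length (filter (\<lambda>x. x \<in> T) ls)"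
proof -
  have "(\<Sum>r\<in>T. cdim (radical (L0_form r) W)) = (\<Sum>r\<in>T. count_list ls r)"
    by (rule sum.cong) (use assms ls_mult L0_mult_eq in auto)
  then show ?thesis using assms(1) by (simp add: sum_count_list)
qed

lemma mem_ks_iff: "\<kappa> > 0 \<Longrightarrow> \<kappa> \<in> set ks \<longleftrightarrow> radical (q \<kappa>) W \<noteq> {0}"
  using ks_mult count_list_0_iff[of ks \<kappa>] radical_eq_0_iff[OF hermitian_form_q, of \<kappa>]
  by (simp add: lap_mult_eq_radical)

lemma mem_ls_iff: "l > 0 \<Longrightarrow> l \<in> set ls \<longleftrightarrow> radical (L0_form l) W \<noteq> {0}"
  using ls_mult count_list_0_iff[of ls l] radical_eq_0_iff[OF hermitian_form_L0_form, of l]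
  by (simp add: L0_mult_eq)

text \<open>The form in which min-max is applied: positivity in \<open>top\<close> ensures that an
  eigenvalue found above a vector of the span is an entry of \<open>ls\<close>.\<close>

lemma card_le_count_ls:
  assumes S: "finite S" "S \<subseteq> W" "cv.independent S"
    and top: "\<And>v \<mu>. v \<in> cspan S \<Longrightarrow> v \<noteq> 0 \<Longrightarrow> Re (q 0 v v) \<le> \<mu> * ksq d v \<Longrightarrow> \<mu> > 0 \<and> P \<mu>"
  shows "card S \<le> length (filter P ls)"
proof -
  let ?T = "{l \<in> set ls. P l}"
  have "card S \<le> (\<Sum>l\<in>?T. cdim (radical (L0_form l) W))"
    unfolding L0_form_def W_eq_perp
  proof (rule card_le_sum_dim_eigenspaces[OF hermitian_form_q continuous_on_q S(1) _ S(3)])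
    show "S \<subseteq> perp d (kerB d B)" using S(2) by (simp add: W_eq_perp)
    fix v \<mu> assume "v \<in> cspan S" "v \<noteq> 0" "Re (q 0 v v) \<le> \<mu> * ksq d v"
    then have "\<mu> > 0" "P \<mu>" using top by blast+
    then show "\<mu> \<in> ?T \<or> radical (\<lambda>x y. q 0 x y - of_real \<mu> * kinner d x y) (perp d (kerB d B)) = {0}"
      using mem_ls_iff[of \<mu>] by (auto simp: L0_form_def W_eq_perp)
  qed simp
  also have "\<dots> = length (filter (\<lambda>x. x \<in> ?T) ls)"
    by (rule sum_dim_radical_L0) (use ls_pos in auto)
  also have "filter (\<lambda>x. x \<in> ?T) ls = filter P ls" by (rule filter_cong) auto
  finally show ?thesis .
qed

lemma upper_bound:
  assumes i: "i < length ks"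
  shows "ks ! i \<le> eta (ls ! i) amin"
proof -
  let ?\<kappa> = "ks ! i"
  let ?c = "eta_inv ?\<kappa> amin"
  have \<kappa>: "?\<kappa> > 0" using i ks_pos by simp
  have c: "?c > 0" by (rule eta_inv_pos[OF amin_pos \<kappa>])
  let ?T = "{r \<in> set ks. r > ?\<kappa>}"
  have fin: "finite ?T" and notin: "?\<kappa> \<notin> ?T" and sub: "?T \<subseteq> {?\<kappa>..}" by auto
  obtain S where S: "finite S" "S \<subseteq> W" "cv.independent S"
    "card S = (\<Sum>r\<in>insert ?\<kappa> ?T. cdim (radical (q r) W))"
    "\<forall>v\<in>cspan S. Re (q ?\<kappa> v v) \<ge> 0"
    by (rule nonneg_subspace_of_decreasing_family[where q = q, OF hermitian_form_q subspace_ranPperp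
        Kvec_ranPperp q_decreasing fin notin sub less_imp_le[OF \<kappa>]])
  have SW: "cspan S \<subseteq> W" by (rule cv.span_minimal[OF S(2) subspace_ranPperp])
  have "i + 1 \<le> length (filter (\<lambda>x. x \<ge> ?\<kappa>) ks)"
    by (rule length_filter_ge_nth[OF ks_sorted i])
  also have "filter (\<lambda>x. x \<ge> ?\<kappa>) ks = filter (\<lambda>x. x \<in> insert ?\<kappa> ?T) ks"
    by (rule filter_cong) auto
  also have "length \<dots> = card S"
    unfolding S(4) by (rule sum_dim_radical_q[symmetric]) (use \<kappa> in auto)
  also have "\<dots> \<le> length (filter (\<lambda>l. l \<ge> ?c) ls)"
  proof (rule card_le_count_ls[OF S(1,2,3)])
    fix v \<mu> assume v: "v \<in> cspan S" "v \<noteq> 0" and le: "Re (q 0 v v) \<le> \<mu> * ksq d v"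
    \<comment> \<open>On this span \<open>q ?\<kappa>\<close> is nonnegative, so the gap bound
      passes to \<open>q 0\<close> in full.\<close>
    have "?c * ksq d v \<le> Re (q 0 v v)" using q_gap_ge[OF \<kappa>, of v] bspec[OF S(5) v(1)] by linarith
    then have "?c * ksq d v \<le> \<mu> * ksq d v" using le by linarith
    moreover have "ksq d v > 0" using v SW Kvec_ranPperp ksq_pos by blast
    ultimately show "\<mu> > 0 \<and> ?c \<le> \<mu>" using c by auto
  qed
  finally have "ls ! i \<ge> ?c"
    using nth_ge_if_length_filter[OF ls_sorted] i same_n by simp
  moreover have "ls ! i > 0" using i same_n ls_pos by simp
  ultimately show ?thesis using le_eta_iff[OF _ amin_pos \<kappa>] by blast
qed

lemma lower_bound:
  assumes i: "i < length ks"
  shows "ls ! i \<le> ks ! i"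
proof (rule ccontr)
  let ?\<kappa> = "ks ! i" and ?l = "ls ! i"
  assume "\<not> ?l \<le> ?\<kappa>"
  then have less: "?\<kappa> < ?l" by simp
  have \<kappa>: "?\<kappa> > 0" using i ks_pos by simp
  have l: "?l > 0" using less \<kappa> by simp
  have i': "i < length ls" using i same_n by simp
  let ?T = "{r \<in> set ls. r > ?l}"
  have fin: "finite ?T" and notin: "?l \<notin> ?T" and sub: "?T \<subseteq> {?l..}" by auto
  \<comment> \<open>The span of the eigenvectors for all eigenvalues at least \<open>?l\<close> is
    replaced by a space obtained by descending through the forms \<open>L0_form\<close>.\<close>
  obtain S where S: "finite S" "S \<subseteq> W" "cv.independent S"
    "card S = (\<Sum>r\<in>insert ?l ?T. cdim (radical (L0_form r) W))"
    "\<forall>v\<in>cspan S. Re (L0_form ?l v v) \<ge> 0"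
    by (rule nonneg_subspace_of_decreasing_family[where q = L0_form, OF hermitian_form_L0_form
        subspace_ranPperp Kvec_ranPperp L0_form_decreasing fin notin sub less_imp_le[OF l]])
  have SW: "cspan S \<subseteq> W" by (rule cv.span_minimal[OF S(2) subspace_ranPperp])
  have "i + 1 \<le> length (filter (\<lambda>x. x \<ge> ?l) ls)"
    by (rule length_filter_ge_nth[OF ls_sorted i'])
  also have "filter (\<lambda>x. x \<ge> ?l) ls = filter (\<lambda>x. x \<in> insert ?l ?T) ls"
    by (rule filter_cong) auto
  also have "length \<dots> = card S"
    unfolding S(4) by (rule sum_dim_radical_L0[symmetric]) (use l in auto)
  finally have cS: "i + 1 \<le> card S" .
  have pos: "pos_on_span (q ?\<kappa>) S"
    unfolding pos_on_span_def
  proof (intro ballI impI)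
    fix v assume v: "v \<in> cspan S" "v \<noteq> 0"
    have n: "ksq d v > 0" using v SW Kvec_ranPperp ksq_pos by blast
    have "?l * ksq d v \<le> Re (q 0 v v)"
      using bspec[OF S(5) v(1)] by (simp add: L0_form_def kinner_self)
    moreover have "?\<kappa> * ksq d v < ?l * ksq d v" using less n by simp
    ultimately show "Re (q ?\<kappa> v v) > 0" using q_gap_le[OF \<kappa>, of v] by linarith
  qed
  \<comment> \<open>Together with \<open>S\<close>, the radicals met on the descent from
    \<open>?\<kappa>\<close> to 0 account for one dimension too many: \<open>i + 1\<close> from
    \<open>S\<close> and at least \<open>length ks - i\<close> from the entries at position
    \<open>i\<close> and later.\<close>
  let ?U = "{r \<in> set ks. r \<le> ?\<kappa>}"
  have finU: "finite ?U" and U: "?U \<subseteq> {0<..?\<kappa>}" using ks_pos by auto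
  obtain S' where S': "finite S'" "S' \<subseteq> W" "cv.independent S'"
    "card S' = card S + (\<Sum>r\<in>?U. cdim (radical (q r) W))" "pos_on_span (q 0) S'"
    by (rule extend_along_decreasing_family[where q = q and t = ?\<kappa> and s = 0, OF hermitian_form_q
          subspace_ranPperp Kvec_ranPperp q_decreasing finU S(1-3) pos order_refl less_imp_le[OF \<kappa>] U])
  have SW': "cspan S' \<subseteq> W" by (rule cv.span_minimal[OF S'(2) subspace_ranPperp])
  have "length ks - i \<le> length (filter (\<lambda>x. x \<le> ?\<kappa>) ks)"
    by (rule length_filter_le_nth[OF ks_sorted i])
  also have "filter (\<lambda>x. x \<le> ?\<kappa>) ks = filter (\<lambda>x. x \<in> ?U) ks"
    by (rule filter_cong) auto
  also have "length \<dots> = (\<Sum>r\<in>?U. cdim (radical (q r) W))"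
    by (rule sum_dim_radical_q[symmetric]) (use ks_pos in auto)
  finally have "length ks + 1 \<le> card S'" using cS S'(4) i by linarith
  also have "card S' \<le> length (filter (\<lambda>_. True) ls)"
  proof (rule card_le_count_ls[OF S'(1,2,3)])
    fix v \<mu> assume v: "v \<in> cspan S'" "v \<noteq> 0" and le: "Re (q 0 v v) \<le> \<mu> * ksq d v"
    have "Re (q 0 v v) > 0" using S'(5) v by (simp add: pos_on_span_def)
    then have "\<mu> * ksq d v > 0" using le by linarith
    moreover have "ksq d v > 0" using v SW' Kvec_ranPperp ksq_pos by blast
    ultimately show "\<mu> > 0 \<and> True" by (simp add: zero_less_mult_iff)
  qed
  finally show False using same_n by simp
qed

text \<open>The maximum of the Rayleigh quotient above \<open>u\<close> is an eigenvalue of L(0,a),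
  so it is either nonpositive or an entry of \<open>ls\<close>.\<close>

lemma q0_le_top:
  assumes n: "length ks \<ge> 1" and u: "u \<in> W"
  shows "Re (q 0 u u) \<le> ls ! 0 * ksq d u"
proof (cases "u = 0")
  case True
  then show ?thesis by (simp add: hermitian_form_0[OF hermitian_form_q])
next
  case False
  have l: "ls ! 0 > 0" using n same_n ls_pos by (simp add: Suc_le_eq)
  obtain w \<mu> where w: "w \<in> W" "w \<noteq> 0" "Re (q 0 u u) \<le> \<mu> * ksq d u"
    "\<And>x. x \<in> W \<Longrightarrow> q 0 w x = of_real \<mu> * kinner d w x"
    using Rayleigh_maximum[OF hermitian_form_q continuous_on_q u[unfolded W_eq_perp] False]
    unfolding W_eq_perp by metis
  have "w \<in> radical (L0_form \<mu>) W" using w by (simp add: radical_def L0_form_def)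
  then have "\<mu> \<le> 0 \<or> \<mu> \<in> set ls" using mem_ls_iff[of \<mu>] w(2) by force
  then have "\<mu> \<le> ls ! 0"
    using l descending_nth[OF ls_sorted, of 0] by (auto simp: in_set_conv_nth)
  then have "\<mu> * ksq d u \<le> ls ! 0 * ksq d u" by (rule mult_right_mono) (rule ksq_nonneg)
  then show ?thesis using w(3) by linarith
qed

lemma optimal_imp_antisymmetric_eigenvector:
  assumes n: "length ks \<ge> 1" and eq: "ks ! 0 = eta (ls ! 0) amin"
  obtains u where "u \<noteq> 0" "u \<in> cspan {dvec ne ni i | i. i < ni \<and> a i = amin}"
    "u \<in> L0_eigenspace ne ni a A B (ls ! 0)"
proof -
  let ?\<kappa> = "ks ! 0" and ?l = "ls ! 0"
  have k_in: "?\<kappa> \<in> set ks" using n by (simp add: Suc_le_eq)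
  then have \<kappa>: "?\<kappa> > 0" using ks_pos by blast
  have l: "?l > 0" using n same_n ls_pos by (simp add: Suc_le_eq)
  have c: "eta_inv ?\<kappa> amin = ?l" unfolding eq by (rule eta_inv_eta[OF l amin_pos])
  have "0 \<in> radical (q ?\<kappa>) W"
    using subspace_radical[OF hermitian_form_q subspace_ranPperp] cv.subspace_0 by blast
  then obtain u where u: "u \<in> radical (q ?\<kappa>) W" "u \<noteq> 0"
    using mem_ks_iff[OF \<kappa>] k_in by blast
  then have uW: "u \<in> W" and q0: "q ?\<kappa> u u = 0" by (auto simp: radical_def)
  \<comment> \<open>Since \<open>q ?\<kappa> u u = 0\<close>, the gap bound and the top eigenvalue
    enclose \<open>Re (q 0 u u)\<close> between equal numbers.\<close>
  have Q: "Re (q 0 u u) = ?l * ksq d u"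
    using q_gap_ge[OF \<kappa>, of u] q0_le_top[OF n uW] by (simp add: c q0)
  have "u \<in> radical (L0_form ?l) W"
    by (rule semidefinite_null_vector_in_radical[OF hermitian_form_L0_form subspace_ranPperp _ uW])
      (use Q q0_le_top[OF n] in \<open>auto simp: L0_form_def kinner_self\<close>)
  then have uE: "u \<in> L0_eigenspace ne ni a A B ?l" by (simp add: L0_eigenspace_eq)
  \<comment> \<open>The gap bound is attained at \<open>u\<close>, so every summand of the
    difference vanishes. Only the antisymmetric coefficients on shortest edges are 0.\<close>
  have "edge_quad ne ni (?\<kappa> - ?l) (\<lambda>i. ?\<kappa> * tanh (?\<kappa> * a i / 2) - ?l) (\<lambda>i. eta_inv ?\<kappa> (a i) - ?l) u = 0"
    unfolding Re_q_gap[OF \<kappa>, symmetric] by (simp add: Q q0)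
  note z = edge_quad_eq_0[OF _ _ _ this]
  have p: "?\<kappa> - ?l > 0" using eta_inv_less(1)[OF amin_pos \<kappa>] c by simp
  have r: "?\<kappa> * tanh (?\<kappa> * a i / 2) - ?l > 0" if "i < ni" for i
    using eta_inv_amin_less_tanh[OF \<kappa> that] c by simp
  have s: "eta_inv ?\<kappa> (a i) - ?l \<ge> 0" if "i < ni" for i
    using eta_inv_amin_le[OF \<kappa> that] c by simp
  have s': "eta_inv ?\<kappa> (a i) - ?l > 0" if "i < ni" "a i \<noteq> amin" for i
    using eta_inv_mono_length[OF amin_pos _ \<kappa>, of "a i"] amin_le[OF that(1)] that(2) c by simp
  have "u \<in> cspan {dvec ne ni i | i. i < ni \<and> a i = amin}"
    unfolding span_dvec_iff using z[OF p r s] s' Kvec_ranPperp[OF uW] by blast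
  then show ?thesis using that u(2) uE by blast
qed

text \<open>At \<open>u\<close> the difference M(0) - M(\<kappa>) with \<kappa> =
  \<open>eta (ls ! 0) amin\<close> acts as the scalar \<open>ls ! 0\<close>, so \<open>u\<close> is
  a null vector of \<open>q \<kappa>\<close> and \<kappa> occurs in \<open>ks\<close>. The upper
  bound shows that no entry is larger.\<close>

lemma antisymmetric_eigenvector_imp_optimal:
  assumes n: "length ks \<ge> 1"
    and u: "u \<noteq> 0" "u \<in> cspan {dvec ne ni i | i. i < ni \<and> a i = amin}"
    and uE: "u \<in> L0_eigenspace ne ni a A B (ls ! 0)"
  shows "ks ! 0 = eta (ls ! 0) amin"
proof -
  let ?l = "ls ! 0"
  let ?\<kappa> = "eta ?l amin"
  have l: "?l > 0" using n same_n ls_pos by (simp add: Suc_le_eq)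
  have \<kappa>: "?\<kappa> > 0" and c: "eta_inv ?\<kappa> amin = ?l"
    using eta_pos[OF l amin_pos] eta_inv_eta[OF l amin_pos] by auto
  have ur: "u \<in> radical (L0_form ?l) W" using uE by (simp add: L0_eigenspace_eq)
  have D: "Kvec d u" "\<And>e. e < ne \<Longrightarrow> u e = 0"
    "\<And>i. i < ni \<Longrightarrow> u (ne + ni + i) = - u (ne + i)"
    "\<And>i. i < ni \<Longrightarrow> a i \<noteq> amin \<Longrightarrow> u (ne + i) = 0"
    using u(2) unfolding span_dvec_iff by blast+
  \<comment> \<open>On longer edges the rates differ from this relation, but \<open>u\<close>
    vanishes there.\<close>
  have rate: "of_real (antisym_rate ?\<kappa> (a i)) * u (ne + i) =
      of_real (antisym_rate 0 (a i) + ?l) * u (ne + i)" if "i < ni" for i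
  proof (cases "a i = amin")
    case True
    then have "antisym_rate ?\<kappa> (a i) = antisym_rate 0 (a i) + ?l"
      using c by (simp add: eta_inv_def antisym_rate_def[of 0])
    then show ?thesis by simp
  qed (use D(4) that in simp)
  have anti: "mv d (DN ne ni a t) u (ne + i) = - (of_real (antisym_rate t (a i)) * u (ne + i))"
    "mv d (DN ne ni a t) u (ne + ni + i) = of_real (antisym_rate t (a i)) * u (ne + i)" if "i < ni" for i t
    unfolding DN_def mv_edge_mat_initial[OF that] mv_edge_mat_terminal[OF that] D(3)[OF that]
    by (simp_all add: field_simps)
  have "mv d (DN ne ni a 0) u = mv d (DN ne ni a ?\<kappa>) u + cscale (of_real ?l) u"
  proof
    fix k
    show "mv d (DN ne ni a 0) u k = (mv d (DN ne ni a ?\<kappa>) u + cscale (of_real ?l) u) k"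
    proof (cases "k < Kdim ne ni")
      case True
      then show ?thesis
      proof (cases rule: Kdim_cases)
        case external
        then show ?thesis using D(2) by (simp add: fun_simps DN_def mv_edge_mat_external)
      next
        case (initial i)
        show ?thesis
          unfolding initial(2) fun_simps anti[OF initial(1)] using rate[OF initial(1)]
          by (simp add: algebra_simps)
      next
        case (terminal i)
        show ?thesis
          unfolding terminal(2) fun_simps anti[OF terminal(1)] D(3)[OF terminal(1)]
          using rate[OF terminal(1)] by (simp add: algebra_simps)
      qed
    next
      case False
      then show ?thesis using D(1) by (simp add: fun_simps mv_def Kvec_def)
    qed
  qed
  then have q0: "q 0 u w = q ?\<kappa> u w + of_real ?l * kinner d u w" for w
    by (simp add: q_def qform_eq kinner_add_left kinner_scale_left)
  have "u \<in> radical (q ?\<kappa>) W"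
    using ur by (simp add: radical_def L0_form_def q0)
  then have "?\<kappa> \<in> set ks" using mem_ks_iff[OF \<kappa>] u(1) by blast
  then have "?\<kappa> \<le> ks ! 0"
    using descending_nth[OF ks_sorted] by (metis in_set_conv_nth le0)
  moreover have "ks ! 0 \<le> ?\<kappa>" using upper_bound[of 0] n by linarith
  ultimately show ?thesis by simp
qed

end

theorem theorem3p1:
  fixes ne ni :: nat and a :: "nat \<Rightarrow> real"
    and A B :: "nat \<Rightarrow> nat \<Rightarrow> complex"
    and ks ls :: "real list"
  defines "d \<equiv> Kdim ne ni"
  defines "amin \<equiv> Min (a ` {..<ni})"
  assumes internal: "ni \<ge> 1"
    and lengths: "\<forall>i<ni. a i > 0"
    and surj: "\<forall>y. Kvec d y \<longrightarrow> (\<exists>x z. Kvec d x \<and> Kvec d z \<and> mv d A x + mv d B z = y)"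
    and selfadj: "\<forall>k<d. \<forall>m<d. mmul d A (madj B) k m = mmul d B (madj A) k m"
    and ks_sorted: "sorted_wrt (\<ge>) ks" and ks_pos: "\<forall>\<kappa>\<in>set ks. \<kappa> > 0"
    and ks_mult: "\<forall>\<kappa>>0. count_list ks \<kappa> = lap_mult ne ni a A B (- (\<kappa>\<^sup>2))"
    and ls_sorted: "sorted_wrt (\<ge>) ls" and ls_pos: "\<forall>l\<in>set ls. l > 0"
    and ls_mult: "\<forall>l>0. count_list ls l = L0_mult ne ni a A B l"
    and same_n: "length ks = length ls"
  shows "(\<forall>i<length ks. ls ! i \<le> ks ! i \<and> ks ! i \<le> eta (ls ! i) amin) \<and>
         (length ks \<ge> 1 \<longrightarrow>
            (ks ! 0 = eta (ls ! 0) amin \<longleftrightarrow>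
               cspan {dvec ne ni i | i. i < ni \<and> a i = amin}
                 \<inter> L0_eigenspace ne ni a A B (ls ! 0) \<noteq> {(\<lambda>_. 0)}))"
proof -
  interpret graph_laplacian_spectrum ne ni a A B ks ls
    by unfold_locales (fact assms[unfolded d_def])+
  let ?D = "cspan {dvec ne ni i | i. i < ni \<and> a i = amin}"
  let ?E = "L0_eigenspace ne ni a A B (ls ! 0)"
  \<comment> \<open>Both sets contain 0, so the intersection differs from {0} exactly when it has a
    nonzero element, and not by being empty.\<close>
  have "(0 :: nat \<Rightarrow> complex) \<in> ?D \<inter> ?E"
    using cv.span_zero subspace_radical[OF hermitian_form_L0_form subspace_ranPperp]
    by (simp add: L0_eigenspace_eq cv.subspace_0)
  then have ne0: "?D \<inter> ?E \<noteq> {(\<lambda>_. 0)} \<longleftrightarrow> (\<exists>u. u \<noteq> 0 \<and> u \<in> ?D \<and> u \<in> ?E)"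
    unfolding zero_fun_def by blast
  have "ks ! 0 = eta (ls ! 0) amin \<longleftrightarrow> ?D \<inter> ?E \<noteq> {(\<lambda>_. 0)}" if n: "length ks \<ge> 1"
    unfolding ne0
  proof
    assume "ks ! 0 = eta (ls ! 0) amin"
    then show "\<exists>u. u \<noteq> 0 \<and> u \<in> ?D \<and> u \<in> ?E"
      unfolding amin_def by (rule optimal_imp_antisymmetric_eigenvector[OF n]) blast
  next
    assume "\<exists>u. u \<noteq> 0 \<and> u \<in> ?D \<and> u \<in> ?E"
    then show "ks ! 0 = eta (ls ! 0) amin"
      unfolding amin_def using antisymmetric_eigenvector_imp_optimal[OF n] by blast
  qed
  moreover have "ls ! i \<le> ks ! i \<and> ks ! i \<le> eta (ls ! i) amin" if "i < length ks" for i
    unfolding amin_def using lower_bound[OF that] upper_bound[OF that] by simp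
  ultimately show ?thesis by blast
qed

end
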